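(* Let $1<p<\infty$ and $0<s<1$. The trace map $u\mapsto u^*$ is a surjective isomorphism of Banach spaces $$\mathcal{W}^{s,p}(\mathbb{D})\xrightarrow{\ \sim\ }B^s_{p,p,+}(\mathbb{S}^1),$$ whose inverse is the Poisson extension $g\mapsto P[g]$. Moreover, for every $u\in\mathcal{W}^{s,p}(\mathbb{D})$, $$\|u\|_{\mathcal{W}^{s,p}}\le\|u^*\|_{W^{s,p}(\mathbb{S}^1)}\le(1+C)\,\|u\|_{\mathcal{W}^{s,p}},$$ where $C=\kappa+(2\pi)^{1/p}$ and $\kappa$ is the constant in the fractional Poincaré inequality on $\mathbb{S}^1$.
   Context: $\mathbb{D}$ is the open unit disc, $\mathbb{S}^1$ the unit circle. $L^p(\mathbb{S}^1)$ consists of complex-valued functions, with $\|f\|_{L^p(\mathbb{S}^1)}^p=\int_{-\pi}^{\pi}|f(e^{i\theta})|^p\,d\theta$. The Gagliardo seminorm is $$[f]_{W^{s,p}(\mathbb{S}^1)}:=\left(\int_{-\pi}^{\pi}\int_{-\pi}^{\pi}\frac{|f(e^{i\xi})-f(e^{i\sigma})|^p}{|e^{i\xi}-e^{i\sigma}|^{1+sp}}\,d\xi\,d\sigma\right)^{1/p},$$ $W^{s,p}(\mathbb{S}^1):=\{f\in L^p(\mathbb{S}^1):[f]_{W^{s,p}(\mathbb{S}^1)}<\infty\}$, and $\|f\|_{W^{s,p}(\mathbb{S}^1)}:=\|f\|_{L^p(\mathbb{S}^1)}+[f]_{W^{s,p}(\mathbb{S}^1)}$. For $u$ on $\mathbb{D}$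 and $0<r<1$, $u_r(\xi):=u(r\xi)$, $\xi\in\mathbb{S}^1$. The space $\mathcal{W}^{s,p}(\mathbb{D})$ is the set of analytic $u:\mathbb{D}\to\mathbb{C}$ with $\sup_{0<r<1}[u_r]_{W^{s,p}(\mathbb{S}^1)}<\infty$, with norm $\|u\|_{\mathcal{W}^{s,p}}:=|u(0)|+\sup_{0<r<1}[u_r]_{W^{s,p}(\mathbb{S}^1)}$. For $u\in\mathcal{W}^{s,p}(\mathbb{D})$, the boundary trace is the radial limit $u^*(\xi)=\lim_{r\to1^-}u(r\xi)$, which exists for a.e. $\xi\in\mathbb{S}^1$. The Besov space $B^s_{p,p}(\mathbb{S}^1)$ is identified with $W^{s,p}(\mathbb{S}^1)$, and $B^s_{p,p,+}(\mathbb{S}^1):=\{f\in B^s_{p,p}(\mathbb{S}^1):\hat f(k)=0\text{ for all }k<0\}$, endowed with the norm $\|f\|_{B^s_{p,p}}=\|f\|_{L^p(\mathbb{S}^1)}+[f]_{W^{s,p}(\mathbb{S}^1)}$, where $\hat f(k)=\frac1{2\pi}\int_{-\pi}^{\pi}f(e^{i\theta})e^{-ik\theta}\,d\theta$. The Poisson kernel is $P_r(\theta)=\frac{1-r^2}{1-2r\cos\theta+r^2}$ and the Poisson extension of $g\in L^1(\mathbb{S}^1)$ is $P[g](re^{i\theta})=\frac1{2\pi}\int_{-\pi}^{\pi}P_r(t)\,g(e^{i(\theta-t)})\,dt$. $\kappa=\kappa(s,p)>0$ is a constant such that the fractional Poincaré inequality $\|f-\overline f\|_{L^p(\mathbb{S}^1)}\le\kappa\,[f]_{W^{s,p}(\mathbb{S}^1)}$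 holds for every $f\in W^{s,p}(\mathbb{S}^1)$, where $\overline f=\frac1{2\pi}\int_0^{2\pi}f(e^{i\theta})\,d\theta$. *)

theory Defs
  imports "HOL-Complex_Analysis.Complex_Analysis"
begin

section \<open>Complex Banach spaces with an explicit carrier\<close>

text \<open>
  The spaces below depend on the real parameters \<open>s\<close> and \<open>p\<close>, so they cannot be types
  of class \<open>banach\<close>; the structure is carried by a record instead.
\<close>

record 'a normed_structure =
  vcarrier :: "'a set"
  vadd :: "'a \<Rightarrow> 'a \<Rightarrow> 'a"
  vzero :: "'a"
  vscale :: "complex \<Rightarrow> 'a \<Rightarrow> 'a"
  vnorm :: "'a \<Rightarrow> real"

definition vdiff :: "'a normed_structure \<Rightarrow> 'a \<Rightarrow> 'a \<Rightarrow> 'a" where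
  "vdiff V x y = vadd V x (vscale V (-1) y)"

locale complex_banach_space =
  fixes V :: "'a normed_structure"
  assumes zero_closed: "vzero V \<in> vcarrier V"
    and add_closed: "\<lbrakk>x \<in> vcarrier V; y \<in> vcarrier V\<rbrakk> \<Longrightarrow> vadd V x y \<in> vcarrier V"
    and scale_closed: "x \<in> vcarrier V \<Longrightarrow> vscale V a x \<in> vcarrier V"
    and add_assoc: "\<lbrakk>x \<in> vcarrier V; y \<in> vcarrier V; z \<in> vcarrier V\<rbrakk>
      \<Longrightarrow> vadd V (vadd V x y) z = vadd V x (vadd V y z)"
    and add_commute: "\<lbrakk>x \<in> vcarrier V; y \<in> vcarrier V\<rbrakk> \<Longrightarrow> vadd V x y = vadd V y x"
    and add_zero: "x \<in> vcarrier V \<Longrightarrow> vadd V x (vzero V) = x"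
    and add_inverse: "x \<in> vcarrier V \<Longrightarrow> vdiff V x x = vzero V"
    and scale_add: "\<lbrakk>x \<in> vcarrier V; y \<in> vcarrier V\<rbrakk>
      \<Longrightarrow> vscale V a (vadd V x y) = vadd V (vscale V a x) (vscale V a y)"
    and add_scale: "x \<in> vcarrier V
      \<Longrightarrow> vscale V (a + b) x = vadd V (vscale V a x) (vscale V b x)"
    and scale_scale: "x \<in> vcarrier V \<Longrightarrow> vscale V a (vscale V b x) = vscale V (a * b) x"
    and scale_one: "x \<in> vcarrier V \<Longrightarrow> vscale V 1 x = x"
    and norm_nonneg: "x \<in> vcarrier V \<Longrightarrow> 0 \<le> vnorm V x"
    and norm_eq_zero: "x \<in> vcarrier V \<Longrightarrow> vnorm V x = 0 \<longleftrightarrow> x = vzero V"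
    and norm_scale: "x \<in> vcarrier V \<Longrightarrow> vnorm V (vscale V a x) = cmod a * vnorm V x"
    and norm_triangle: "\<lbrakk>x \<in> vcarrier V; y \<in> vcarrier V\<rbrakk>
      \<Longrightarrow> vnorm V (vadd V x y) \<le> vnorm V x + vnorm V y"
    and complete: "\<lbrakk>\<And>n::nat. X n \<in> vcarrier V;
        \<And>e. 0 < e \<Longrightarrow> \<exists>N. \<forall>m\<ge>N. \<forall>n\<ge>N. vnorm V (vdiff V (X m) (X n)) < e\<rbrakk>
      \<Longrightarrow> \<exists>x\<in>vcarrier V. (\<lambda>n. vnorm V (vdiff V (X n) x)) \<longlonglongrightarrow> 0"

locale banach_isomorphism =
  V: complex_banach_space V + W: complex_banach_space W
  for V :: "'a normed_structure" and W :: "'b normed_structure" +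
  fixes T :: "'a \<Rightarrow> 'b"
  assumes bij: "bij_betw T (vcarrier V) (vcarrier W)"
    and map_add: "\<lbrakk>x \<in> vcarrier V; y \<in> vcarrier V\<rbrakk>
      \<Longrightarrow> T (vadd V x y) = vadd W (T x) (T y)"
    and map_scale: "x \<in> vcarrier V \<Longrightarrow> T (vscale V a x) = vscale W a (T x)"
    and bounded: "\<exists>K. \<forall>x\<in>vcarrier V. vnorm W (T x) \<le> K * vnorm V x"
    and inverse_bounded:
      "\<exists>K. \<forall>y\<in>vcarrier W. vnorm V (inv_into (vcarrier V) T y) \<le> K * vnorm W y"


section \<open>Functions on the unit circle\<close>

text \<open>
  A function on the circle is a function \<open>complex \<Rightarrow> complex\<close> of which only the values
  at the points \<open>cis \<theta>\<close> matter.
\<close>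

abbreviation angles :: "real measure" where
  "angles \<equiv> lebesgue_on {-pi..pi}"

text \<open>
  The \<open>p\<close>-th powers are kept as extended integrals: finiteness is read off from them,
  and the real-valued norms are meaningful only where they are finite.
\<close>

definition Lp_energy :: "real \<Rightarrow> (complex \<Rightarrow> complex) \<Rightarrow> ennreal" where
  "Lp_energy p f = (\<integral>\<^sup>+\<theta>. ennreal (cmod (f (cis \<theta>)) powr p) \<partial>angles)"

definition Lp_norm :: "real \<Rightarrow> (complex \<Rightarrow> complex) \<Rightarrow> real" where
  "Lp_norm p f = enn2real (Lp_energy p f) powr (1 / p)"

text \<open>On the diagonal the integrand below is \<open>0 / 0 = 0\<close>; this is a null set.\<close>

definition gagliardo_energy :: "real \<Rightarrow> real \<Rightarrow> (complex \<Rightarrow> complex) \<Rightarrow> ennreal" where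
  "gagliardo_energy s p f =
     (\<integral>\<^sup>+\<sigma>. (\<integral>\<^sup>+\<xi>. ennreal (cmod (f (cis \<xi>) - f (cis \<sigma>)) powr p
                        / cmod (cis \<xi> - cis \<sigma>) powr (1 + s * p)) \<partial>angles) \<partial>angles)"

definition gagliardo :: "real \<Rightarrow> real \<Rightarrow> (complex \<Rightarrow> complex) \<Rightarrow> real" where
  "gagliardo s p f = enn2real (gagliardo_energy s p f) powr (1 / p)"

definition sobolev_functions :: "real \<Rightarrow> real \<Rightarrow> (complex \<Rightarrow> complex) set" where
  "sobolev_functions s p =
     {f. (\<lambda>\<theta>. f (cis \<theta>)) \<in> borel_measurable angles \<and>
         Lp_energy p f < \<infinity> \<and> gagliardo_energy s p f < \<infinity>}"

definition sobolev_norm :: "real \<Rightarrow> real \<Rightarrow> (complex \<Rightarrow> complex) \<Rightarrow> real" where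
  "sobolev_norm s p f = Lp_norm p f + gagliardo s p f"

definition fourier_coeff :: "(complex \<Rightarrow> complex) \<Rightarrow> int \<Rightarrow> complex" where
  "fourier_coeff f k =
     1 / (2 * of_real pi) * (LINT \<theta>|angles. f (cis \<theta>) * cis (- (of_int k * \<theta>)))"

definition besov_plus_functions :: "real \<Rightarrow> real \<Rightarrow> (complex \<Rightarrow> complex) set" where
  "besov_plus_functions s p =
     {f \<in> sobolev_functions s p. \<forall>k<0. fourier_coeff f k = 0}"

definition circle_mean :: "(complex \<Rightarrow> complex) \<Rightarrow> complex" where
  "circle_mean f =
     1 / (2 * of_real pi) * (LINT \<theta>|lebesgue_on {0..2*pi}. f (cis \<theta>))"

definition poincare_constant :: "real \<Rightarrow> real \<Rightarrow> real \<Rightarrow> bool" where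
  "poincare_constant s p \<kappa> \<longleftrightarrow> 0 < \<kappa> \<and>
     (\<forall>f\<in>sobolev_functions s p.
        Lp_norm p (\<lambda>z. f z - circle_mean f) \<le> \<kappa> * gagliardo s p f)"


section \<open>The Besov space of almost-everywhere classes\<close>

definition circle_ae :: "((complex \<Rightarrow> complex) \<times> (complex \<Rightarrow> complex)) set" where
  "circle_ae = {(f, g). AE \<theta> in angles. f (cis \<theta>) = g (cis \<theta>)}"

definition besov_plus :: "real \<Rightarrow> real \<Rightarrow> (complex \<Rightarrow> complex) set normed_structure" where
  "besov_plus s p =
     \<lparr>vcarrier = besov_plus_functions s p // circle_ae,
      vadd = (\<lambda>X Y. \<Union>f\<in>X. \<Union>g\<in>Y. circle_ae `` {\<lambda>z. f z + g z}),
      vzero = circle_ae `` {\<lambda>z. 0},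
      vscale = (\<lambda>c X. \<Union>f\<in>X. circle_ae `` {\<lambda>z. c * f z}),
      vnorm = (\<lambda>X. the_elem (sobolev_norm s p ` X))\<rparr>"

lemma equiv_circle_ae: "equiv UNIV circle_ae"
proof (rule equivI)
  show "refl circle_ae" by (simp add: refl_on_def circle_ae_def)
  show "sym circle_ae" by (simp add: sym_def circle_ae_def eq_commute)
  show "trans circle_ae"
  proof (rule transI)
    fix f g h assume "(f, g) \<in> circle_ae" "(g, h) \<in> circle_ae"
    then have "AE \<theta> in angles. f (cis \<theta>) = g (cis \<theta>)" "AE \<theta> in angles. g (cis \<theta>) = h (cis \<theta>)"
      by (auto simp: circle_ae_def)
    then have "AE \<theta> in angles. f (cis \<theta>) = h (cis \<theta>)"
      by eventually_elim simp
    then show "(f, h) \<in> circle_ae" by (simp add: circle_ae_def)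
  qed
qed simp

lemma sobolev_norm_cong_AE:
  assumes "(f, g) \<in> circle_ae"
  shows "sobolev_norm s p f = sobolev_norm s p g"
proof -
  have ae: "AE \<theta> in angles. f (cis \<theta>) = g (cis \<theta>)"
    using assms by (simp add: circle_ae_def)
  have "Lp_energy p f = Lp_energy p g"
    unfolding Lp_energy_def by (rule nn_integral_cong_AE) (use ae in eventually_elim, simp)
  moreover have "gagliardo_energy s p f = gagliardo_energy s p g"
    unfolding gagliardo_energy_def
  proof (rule nn_integral_cong_AE, use ae in eventually_elim, goal_cases)
    case (1 \<sigma>)
    show ?case
      by (rule nn_integral_cong_AE) (use ae in eventually_elim, simp add: 1)
  qed
  ultimately show ?thesis
    by (simp add: sobolev_norm_def Lp_norm_def gagliardo_def)
qed

lemma vnorm_besov_plus: "vnorm (besov_plus s p) (circle_ae `` {f}) = sobolev_norm s p f"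
proof -
  have "f \<in> circle_ae `` {f}" by (simp add: circle_ae_def)
  moreover have "sobolev_norm s p g = sobolev_norm s p f" if "g \<in> circle_ae `` {f}" for g
    using sobolev_norm_cong_AE[of f g s p] that by simp
  ultimately have "sobolev_norm s p ` (circle_ae `` {f}) = {sobolev_norm s p f}"
    by blast
  then show ?thesis by (simp add: besov_plus_def)
qed


section \<open>The space of analytic functions on the disc\<close>

definition dilate :: "real \<Rightarrow> (complex \<Rightarrow> complex) \<Rightarrow> complex \<Rightarrow> complex" where
  "dilate r u = (\<lambda>z. u (of_real r * z))"

definition disc_norm :: "real \<Rightarrow> real \<Rightarrow> (complex \<Rightarrow> complex) \<Rightarrow> real" where
  "disc_norm s p u = cmod (u 0) + (SUP r\<in>{0<..<1}. gagliardo s p (dilate r u))"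

text \<open>
  A function on the disc is represented by its extension by \<open>0\<close>, so that equality of
  functions on the disc is HOL equality. Finiteness of the supremum means that every
  seminorm is finite and that together they are bounded.
\<close>

definition disc_functions :: "real \<Rightarrow> real \<Rightarrow> (complex \<Rightarrow> complex) set" where
  "disc_functions s p =
     {u. u holomorphic_on ball 0 1 \<and> (\<forall>z. z \<notin> ball 0 1 \<longrightarrow> u z = 0) \<and>
         (\<forall>r\<in>{0<..<1}. gagliardo_energy s p (dilate r u) < \<infinity>) \<and>
         bdd_above ((\<lambda>r. gagliardo s p (dilate r u)) ` {0<..<1})}"

definition disc_space :: "real \<Rightarrow> real \<Rightarrow> (complex \<Rightarrow> complex) normed_structure" where
  "disc_space s p =
     \<lparr>vcarrier = disc_functions s p,
      vadd = (\<lambda>u v z. u z + v z),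
      vzero = (\<lambda>z. 0),
      vscale = (\<lambda>c u z. c * u z),
      vnorm = disc_norm s p\<rparr>"


section \<open>Boundary trace and Poisson extension\<close>

text \<open>Where the radial limit does not exist the value of \<open>Lim\<close> is unspecified.\<close>

definition boundary_trace :: "(complex \<Rightarrow> complex) \<Rightarrow> complex \<Rightarrow> complex" where
  "boundary_trace u \<xi> = Lim (at_left 1) (\<lambda>r::real. u (of_real r * \<xi>))"

definition trace_map :: "(complex \<Rightarrow> complex) \<Rightarrow> (complex \<Rightarrow> complex) set" where
  "trace_map u = circle_ae `` {boundary_trace u}"

definition poisson_kernel :: "real \<Rightarrow> real \<Rightarrow> real" where
  "poisson_kernel r \<theta> = (1 - r\<^sup>2) / (1 - 2 * r * cos \<theta> + r\<^sup>2)"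

text \<open>Polar coordinates \<open>z = r e\<^sup>i\<^sup>\<theta>\<close> are \<open>r = cmod z\<close> and \<open>\<theta> = Arg z\<close>, with \<open>Arg 0 = 0\<close>.\<close>

definition poisson_ext :: "(complex \<Rightarrow> complex) \<Rightarrow> complex \<Rightarrow> complex" where
  "poisson_ext g z =
     (if z \<in> ball 0 1
      then 1 / (2 * of_real pi) *
        (LINT t|angles. of_real (poisson_kernel (cmod z) t) * g (cis (Arg z - t)))
      else 0)"

end

theory Submission imports Defs begin

text \<open>
  Everything rests on one pointwise estimate. Write
  \<open>G g \<sigma> = \<integral> |g \<xi> - g \<sigma>|\<^sup>p / |\<xi> - \<sigma>|\<^sup>1\<^sup>+\<^sup>s\<^sup>p d\<xi>\<close> for the inner Gagliardo integral. The Poisson kernel at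
  \<open>r\<sigma>\<close> is at most \<open>4 / |\<xi> - \<sigma>|\<close>, so Jensen's inequality with the weight
  \<open>P |\<xi> - \<sigma>|\<^sup>a\<close>, where \<open>a = s p / (p - 1)\<close>, gives
  \<open>|P[g](r\<sigma>) - g \<sigma>|\<^sup>p \<le> \<epsilon>(r) G g \<sigma>\<close> with \<open>\<epsilon>(r) \<rightarrow> 0\<close> independently of \<open>g\<close> and \<open>\<sigma>\<close>.

  Applied to \<open>g\<close> itself, this shows that \<open>P[g]\<close> has radial limit \<open>g \<sigma>\<close> wherever \<open>G g \<sigma>\<close> is finite.
  Applied to the dilates \<open>u\<^sub>\<rho>\<close> of an analytic \<open>u\<close>, for which \<open>u(r\<rho>\<sigma>) = P[u\<^sub>\<rho>](r\<sigma>)\<close>, it shows that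
  \<open>r \<mapsto> u(r\<sigma>)\<close> is Cauchy wherever the lower limit of \<open>G u\<^sub>\<rho> \<sigma>\<close> as \<open>\<rho> \<rightarrow> 1\<close> is finite, which by
  Fatou's lemma is almost everywhere, and that \<open>u\<^sub>\<rho>\<close> converges in \<open>L\<^sup>p\<close>. No maximal
  function and no Lebesgue differentiation is needed. Fatou's lemma also gives \<open>[u\<^sup>*] \<le> sup [u\<^sub>r]\<close>; the
  converse inequality holds because \<open>u\<^sub>r\<close> is an average of rotations of \<open>u\<^sup>*\<close>.
\<close>


section \<open>Minkowski and Jensen inequalities\<close>

text \<open>Sobolev functions are only Lebesgue measurable along \<open>cis\<close> and determined
  only almost everywhere, while the argument needs Tonelli on pairs of boundary points, rotations,
  and pointwise values of g. The analysis is therefore done on Borel functions for the push-forward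
  \<open>circ\<close> of arc length; classes enter through Borel representatives.

  The exponent a meets two demands. Jensen's inequality leaves P |y - \<sigma>|^(a - a p) |g y - g
  \<sigma>|^p under the integral, and the factor 4 / |y - \<sigma>| bounding P completes this to the
  Gagliardo kernel exactly when a (p - 1) = s p. Since a > 0, the weight is small where the Poisson
  mass concentrates, so its total mass tends to 0.

  Finiteness of a lower limit controls G only along infinitely many radii depending on \<sigma>.
  This suffices because u(t\<sigma>) and u(t'\<sigma>) are both compared with u at one single larger
  radius.

  Completeness of the Besov space is inherited from the disc space, where limits are locally
  uniform, through the two-sided norm bounds for the trace. These involve a Poincare constant, so
  one is constructed.\<close>

lemma powr_mean_le:
  fixes x y t p :: real
  assumes "1 \<le> p" "0 \<le> x" "0 \<le> y" "0 < t" "t < 1"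
  shows "(t * x + (1 - t) * y) powr p \<le> t * x powr p + (1 - t) * y powr p"
proof -
  have le: "t powr p \<le> t" if "0 < t" "t < 1" for t :: real
    using powr_mono'[of 1 p t] that assms(1) by simp
  \<comment> \<open>Convexity of the power is applied to positive arguments; a vanishing argument
    leaves the inequality t^p <= t on (0,1).\<close>
  consider "x = 0" | "y = 0" | "0 < x" "0 < y" using assms by linarith
  then show ?thesis
  proof cases
    case 1
    then show ?thesis
      using le[of "1 - t"] assms by (simp add: powr_mult mult_right_mono)
  next
    case 2
    then show ?thesis
      using le[of t] assms by (simp add: powr_mult mult_right_mono)
  next
    case 3
    then show ?thesis
      using convex_onD[OF powr_convex[OF assms(1)], of "1 - t" x y] assms by simp
  qed
qed

lemma ennreal_lincomb:
  assumes "0 \<le> a" "0 \<le> b" "0 \<le> x" "0 \<le> y"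
  shows "ennreal a * ennreal x + ennreal b * ennreal y = ennreal (a * x + b * y)"
  using assms by (subst ennreal_plus) (auto simp: ennreal_mult)

text \<open>The bound in \<open>ennreal\<close> forces \<open>E\<close> to be finite, so the value 0
  of \<open>enn2real\<close> at infinity does no harm.\<close>

lemma enn2real_root_le:
  assumes "0 < p" "0 \<le> a" "E \<le> ennreal (a powr p)"
  shows "enn2real E powr (1 / p) \<le> a"
proof -
  have "enn2real E \<le> a powr p"
    using enn2real_mono[OF assms(3)] by simp
  then have "enn2real E powr (1 / p) \<le> (a powr p) powr (1 / p)"
    using assms by (intro powr_mono2) auto
  then show ?thesis using assms by (simp add: powr_powr)
qed

text \<open>The measure is a parameter because Minkowski's inequality is needed both on
  \<open>circ\<close>, for the L^p norm, and on the product of \<open>circ\<close> with itself, for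
  the Gagliardo seminorm.\<close>

definition pnorm :: "'a measure \<Rightarrow> real \<Rightarrow> ('a \<Rightarrow> complex) \<Rightarrow> real" where
  "pnorm M p F = enn2real (\<integral>\<^sup>+x. ennreal (cmod (F x) powr p) \<partial>M) powr (1 / p)"

lemma pnorm_nonneg: "0 \<le> pnorm M p F"
  by (simp add: pnorm_def)

lemma pnorm_powr:
  assumes "0 < p" "(\<integral>\<^sup>+x. ennreal (cmod (F x) powr p) \<partial>M) < \<infinity>"
  shows "ennreal (pnorm M p F powr p) = (\<integral>\<^sup>+x. ennreal (cmod (F x) powr p) \<partial>M)"
  using assms by (simp add: pnorm_def powr_powr ennreal_enn2real_if)

text \<open>With a and b at least the two norms, F + G is (a + b) times the convex combination of F
  / a and G / b with weights a / (a + b) and b / (a + b); convexity of the p-th power is then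
  integrated. As the norms may vanish, they are first enlarged by e > 0, and e tends to 0 at the
  end. The conclusion in \<open>ennreal\<close> contains the finiteness of the left side.\<close>

lemma minkowski:
  fixes F G :: "'a \<Rightarrow> complex"
  assumes p: "1 \<le> p"
    and [measurable]: "F \<in> borel_measurable M" "G \<in> borel_measurable M"
    and "(\<integral>\<^sup>+x. ennreal (cmod (F x) powr p) \<partial>M) < \<infinity>"
    and "(\<integral>\<^sup>+x. ennreal (cmod (G x) powr p) \<partial>M) < \<infinity>"
  shows "(\<integral>\<^sup>+x. ennreal (cmod (F x + G x) powr p) \<partial>M)
      \<le> ennreal ((pnorm M p F + pnorm M p G) powr p)"
proof -
  have main: "(\<integral>\<^sup>+x. ennreal (cmod (F x + G x) powr p) \<partial>M)
      \<le> ennreal ((a + b) powr p)"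
    if a: "0 < a" "pnorm M p F \<le> a" and b: "0 < b" "pnorm M p G \<le> b" for a b
  proof -
    define t where "t = a / (a + b)"
    have t: "0 < t" "t < 1" and t3: "1 - t = b / (a + b)" using a b by (auto simp: t_def field_simps)
    have pw: "cmod (F x + G x) powr p
        \<le> (a + b) powr p * (t * a powr - p) * cmod (F x) powr p
          + (a + b) powr p * ((1 - t) * b powr - p) * cmod (G x) powr p" for x
    proof -
      have "cmod (F x + G x) \<le> (a + b) * (t * (cmod (F x) / a) + (1 - t) * (cmod (G x) / b))"
      proof -
        have "(a + b) * (t * (cmod (F x) / a) + (1 - t) * (cmod (G x) / b)) = cmod (F x) + cmod (G x)"
          using a b unfolding t3 by (simp add: t_def distrib_left)
        then show ?thesis using norm_triangle_ineq[of "F x" "G x"] by simp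
      qed
      then have "cmod (F x + G x) powr p
          \<le> ((a + b) * (t * (cmod (F x) / a) + (1 - t) * (cmod (G x) / b))) powr p"
        using p by (intro powr_mono2) auto
      also have "\<dots> = (a + b) powr p * (t * (cmod (F x) / a) + (1 - t) * (cmod (G x) / b)) powr p"
        by (rule powr_mult)
      also have "\<dots> \<le> (a + b) powr p
          * (t * (cmod (F x) / a) powr p + (1 - t) * (cmod (G x) / b) powr p)"
        using a b t p by (intro mult_left_mono powr_mean_le) auto
      finally show ?thesis
        using a b by (simp add: powr_divide powr_minus field_simps)
    qed
    have bd: "c powr - p * q powr p \<le> 1" if "0 < c" "0 \<le> q" "q \<le> c" for c q :: real
    proof -
      have "q powr p \<le> c powr p" using that p by (intro powr_mono2) auto
      then show ?thesis using that by (simp add: powr_minus field_simps)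
    qed
    have "(\<integral>\<^sup>+x. ennreal (cmod (F x + G x) powr p) \<partial>M)
        \<le> (\<integral>\<^sup>+x. ennreal ((a + b) powr p * (t * a powr - p))
            * ennreal (cmod (F x) powr p)
          + ennreal ((a + b) powr p * ((1 - t) * b powr - p)) * ennreal (cmod (G x) powr p) \<partial>M)"
      using pw t a b by (intro nn_integral_mono, subst ennreal_lincomb)
          (auto simp del: ennreal_plus intro: ennreal_leI)
    also have "\<dots> = ennreal ((a + b) powr p * (t * a powr - p)) * ennreal (pnorm M p F powr p)
          + ennreal ((a + b) powr p * ((1 - t) * b powr - p)) * ennreal (pnorm M p G powr p)"
      using assms by (simp add: nn_integral_add nn_integral_cmult pnorm_powr)
    also have "\<dots> = ennreal ((a + b) powr p * (t * (a powr - p * pnorm M p F powr p)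
          + (1 - t) * (b powr - p * pnorm M p G powr p)))"
      using t by (subst ennreal_lincomb) (auto simp: distrib_left mult.assoc)
    also have "\<dots> \<le> ennreal ((a + b) powr p * (t * 1 + (1 - t) * 1))"
      using a b t pnorm_nonneg by (intro ennreal_leI mult_left_mono add_mono bd) auto
    finally show ?thesis by simp
  qed
  have "((\<lambda>e. ennreal ((pnorm M p F + e + (pnorm M p G + e)) powr p)) \<longlongrightarrow>
      ennreal ((pnorm M p F + 0 + (pnorm M p G + 0)) powr p)) (at_right 0)"
    using p pnorm_nonneg[of M p F] pnorm_nonneg[of M p G]
    by (intro tendsto_intros tendsto_powr') (auto simp: eventually_at_filter)
  moreover have "\<forall>\<^sub>F e in at_right (0::real). (\<integral>\<^sup>+x. ennreal (cmod (F x
      + G x) powr p) \<partial>M)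
      \<le> ennreal ((pnorm M p F + e + (pnorm M p G + e)) powr p)"
    unfolding eventually_at_right[OF zero_less_one]
    using pnorm_nonneg[of M p F] pnorm_nonneg[of M p G]
    by (intro exI[of _ 1] conjI allI impI main) auto
  ultimately show ?thesis
    by (intro tendsto_lowerbound[where f = "\<lambda>e. ennreal ((pnorm M p F + e
        + (pnorm M p G + e)) powr p)"]) auto
qed

text \<open>
  Both sides are homogeneous in \<open>h\<close>, so this is Young's inequality
  \<open>h \<le> c\<^sup>1\<^sup>-\<^sup>p h\<^sup>p / p + c (1 - 1 / p)\<close> integrated against \<open>w\<close>, at the optimal \<open>c\<close>.
\<close>

lemma jensen_nn:
  fixes w h :: "'a \<Rightarrow> real"
  assumes p: "1 < p" and [measurable]: "w \<in> borel_measurable M" "h \<in> borel_measurable M"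
    and pos: "\<And>x. 0 \<le> w x" "\<And>x. 0 \<le> h x"
    and A: "0 < A" "(\<integral>\<^sup>+x. ennreal (w x) \<partial>M) \<le> ennreal A"
    and B: "0 \<le> B" "(\<integral>\<^sup>+x. ennreal (w x * h x powr p) \<partial>M) \<le> ennreal B"
  shows "(\<integral>\<^sup>+x. ennreal (w x * h x) \<partial>M)
      \<le> ennreal ((A powr (p - 1) * B) powr (1 / p))"
\<comment> \<open>For B = 0 the optimal c below would be 0; in that case w h vanishes almost
  everywhere.\<close>
proof (cases "B = 0")
  case True
  then have "AE x in M. ennreal (w x * h x powr p) = 0"
    using B(2) by (subst nn_integral_0_iff_AE[symmetric]) auto
  then have "AE x in M. ennreal (w x * h x) = 0"
    by eventually_elim (use pos in \<open>auto simp: ennreal_eq_0_iff mult_le_0_iff\<close>)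
  then have "(\<integral>\<^sup>+x. ennreal (w x * h x) \<partial>M) = 0"
    by (subst nn_integral_0_iff_AE) auto
  then show ?thesis by simp
next
  case False
  then have Bp: "0 < B" using B by simp
  \<comment> \<open>The minimiser of c^(1-p) B / p + c (1 - 1/p) A: the derivative vanishes when c^p
    = B / A, and the minimum is A c.\<close>
  define c where "c = (B / A) powr (1 / p)"
  have c: "0 < c" using Bp A by (simp add: c_def)
  have cp: "c powr p = B / A" using Bp A p by (simp add: c_def powr_powr)
  have "h x \<le> c powr (1 - p) / p * h x powr p + c * (1 - 1 / p)" for x
  proof (cases "h x = 0")
    case False
    then have h: "0 < h x" using pos(2)[of x] by simp
    have "(h x powr p * c powr (1 - p)) powr (1 / p) * c powr (1 - 1 / p)
        \<le> (1 / p) * (h x powr p * c powr (1 - p)) + (1 - 1 / p) * c"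
      using p h c by (intro Youngs_inequality_0) (auto simp: field_simps)
    moreover have "(h x powr p * c powr (1 - p)) powr (1 / p) * c powr (1 - 1 / p) = h x"
    proof -
      have "(1 - p) / p + (1 - 1 / p) = 0" using p by (simp add: field_simps)
      then have "c powr ((1 - p) / p) * c powr (1 - 1 / p) = 1"
        using c by (simp add: powr_add[symmetric])
      then show ?thesis using p h c by (simp add: powr_mult powr_powr)
    qed
    ultimately show ?thesis by (simp add: field_simps)
  qed (use c p in \<open>auto simp: field_simps\<close>)
  then have le: "w x * h x \<le> w x * (c powr (1 - p) / p * h x powr p + c * (1 - 1 / p))" for x
    using pos by (intro mult_left_mono) auto
  then have "(\<integral>\<^sup>+x. ennreal (w x * h x) \<partial>M)
     \<le> (\<integral>\<^sup>+x. ennreal (c powr (1 - p) / p) * ennreal (w x * h x powr p)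
         + ennreal (c * (1 - 1 / p)) * ennreal (w x) \<partial>M)"
  proof (intro nn_integral_mono)
    fix x
    have nn: "0 \<le> 1 - 1 / p" using p by simp
    have "ennreal (w x * h x) \<le> ennreal (c powr (1 - p) / p * (w x * h x powr p) + c * (1 - 1 / p)
        * w x)"
      using le[of x] by (intro ennreal_leI) (simp add: algebra_simps)
    also have "\<dots> = ennreal (c powr (1 - p) / p) * ennreal (w x * h x powr p)
        + ennreal (c * (1 - 1 / p)) * ennreal (w x)"
      using nn c p pos by (intro ennreal_lincomb[symmetric]) auto
    finally show "ennreal (w x * h x) \<le> ennreal (c powr (1 - p) / p) * ennreal (w x * h x powr p)
        + ennreal (c * (1 - 1 / p)) * ennreal (w x)" .
  qed
  also have "\<dots> = ennreal (c powr (1 - p) / p)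
      * (\<integral>\<^sup>+x. ennreal (w x * h x powr p) \<partial>M)
      + ennreal (c * (1 - 1 / p)) * (\<integral>\<^sup>+x. ennreal (w x) \<partial>M)"
    by (simp add: nn_integral_add nn_integral_cmult)
  also have "\<dots> \<le> ennreal (c powr (1 - p) / p) * ennreal B + ennreal (c * (1 - 1 / p)) * ennreal A"
    using A B by (intro add_mono mult_left_mono) auto
  also have "\<dots> = ennreal (c powr (1 - p) / p * B + c * (1 - 1 / p) * A)"
    using c p A B by (intro ennreal_lincomb) auto
  also have "c powr (1 - p) / p * B + c * (1 - 1 / p) * A = A * c"
  proof -
    have "c powr (1 - p) = c * (A / B)"
      using c cp by (simp add: powr_diff)
    then show ?thesis using p Bp by (simp add: field_simps)
  qed
  also have "A * c = (A powr (p - 1) * B) powr (1 / p)"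
  proof -
    have "A = A powr ((p - 1) / p) * A powr (1 / p)"
      using A p by (simp add: powr_add[symmetric] add_divide_distrib[symmetric])
    then have "A * c = (A powr ((p - 1) / p) * A powr (1 / p)) * (B powr (1 / p) / A powr (1 / p))"
      using Bp A by (simp add: c_def powr_divide)
    also have "\<dots> = A powr ((p - 1) / p) * B powr (1 / p)" using A by simp
    finally show ?thesis using A Bp p by (simp add: powr_mult powr_powr)
  qed
  finally show ?thesis .
qed

text \<open>The mass bound A is kept as a factor A^(p-1) instead of being normalised to 1: making A
  small is what makes Poisson integrals converge at the boundary.\<close>

lemma jensen_powr:
  fixes w :: "'a \<Rightarrow> real" and F :: "'a \<Rightarrow> complex"
  assumes p: "1 < p" and [measurable]: "w \<in> borel_measurable M" "F \<in> borel_measurable M"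
    and pos: "\<And>x. 0 \<le> w x"
    and A: "0 < A" "(\<integral>\<^sup>+x. ennreal (w x) \<partial>M) \<le> ennreal A"
  shows "ennreal (cmod (LINT x|M. of_real (w x) * F x) powr p)
    \<le> ennreal (A powr (p - 1)) * (\<integral>\<^sup>+x. ennreal (w x * cmod (F x) powr p) \<partial>M)"
proof (cases "(\<integral>\<^sup>+x. ennreal (w x * cmod (F x) powr p) \<partial>M) = \<infinity>")
  case True
  then show ?thesis using A by (simp add: ennreal_mult_top)
next
  case False
  then obtain B where B: "0 \<le> B" "(\<integral>\<^sup>+x. ennreal (w x
      * cmod (F x) powr p) \<partial>M) = ennreal B"
    by (metis ennreal_cases infinity_ennreal_def)
  \<comment> \<open>A non-integrable integrand has Bochner integral 0, so the bound covers that case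
    as well.\<close>
  have "ennreal (cmod (LINT x|M. of_real (w x) * F x))
      \<le> (\<integral>\<^sup>+x. ennreal (cmod (of_real (w x) * F x)) \<partial>M)"
    by (cases "integrable M (\<lambda>x. of_real (w x) * F x)")
       (auto intro: integral_norm_bound_ennreal simp: not_integrable_integral_eq)
  also have "\<dots> = (\<integral>\<^sup>+x. ennreal (w x * cmod (F x)) \<partial>M)"
    using pos by (simp add: norm_mult)
  also have "\<dots> \<le> ennreal ((A powr (p - 1) * B) powr (1 / p))"
    using B pos A p by (intro jensen_nn) auto
  finally have "cmod (LINT x|M. of_real (w x) * F x) \<le> (A powr (p - 1) * B) powr (1 / p)"
    by simp
  then have "cmod (LINT x|M. of_real (w x) * F x) powr p \<le> ((A powr (p - 1) * B) powr (1 / p)) powr p"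
    using p by (intro powr_mono2) auto
  also have "\<dots> = A powr (p - 1) * B" using p A B by (simp add: powr_powr)
  finally show ?thesis using B by (simp add: ennreal_mult[symmetric])
qed

section \<open>Arc length measure on the circle\<close>

lemma measurable_cis_angles [measurable]: "cis \<in> measurable angles borel"
proof -
  have "cis \<in> borel_measurable borel"
    by (intro borel_measurable_continuous_onI continuous_intros)
  then show ?thesis
    by (intro measurable_restrict_space1 measurable_completion) simp
qed

text \<open>A Borel measure on the whole plane of mass 2 pi: rotations and conjugation preserve it,
  and double integrals concern Borel functions of two complex variables instead of periodic
  functions of angles.\<close>

definition circ :: "complex measure" where
  "circ = distr angles borel cis"

lemma sets_circ [measurable_cong, simp]: "sets circ = sets borel"
  and space_circ [simp]: "space circ = UNIV"
  by (simp_all add: circ_def)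

lemma nn_integral_circ:
  assumes [measurable]: "h \<in> borel_measurable borel"
  shows "(\<integral>\<^sup>+z. h z \<partial>circ)
      = (\<integral>\<^sup>+\<theta>. h (cis \<theta>) \<partial>angles)"
  unfolding circ_def by (rule nn_integral_distr) auto

lemma borel_measurable_cis [measurable]: "cis \<in> borel_measurable borel"
  by (intro borel_measurable_continuous_onI continuous_intros)

lemma nn_integral_circ_lborel:
  assumes [measurable]: "h \<in> borel_measurable borel"
  shows "(\<integral>\<^sup>+z. h z \<partial>circ)
      = (\<integral>\<^sup>+\<theta>. h (cis \<theta>) * indicator {-pi..pi} \<theta> \<partial>lborel)"
  unfolding nn_integral_circ[OF assms]
  by (subst nn_integral_restrict_space) (auto simp: nn_integral_completion)

lemma emeasure_circ: "emeasure circ UNIV = ennreal (2 * pi)"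
proof -
  have "emeasure circ UNIV = (\<integral>\<^sup>+z. 1 \<partial>circ)" by simp
  also have "\<dots> = ennreal (2 * pi)"
    by (subst nn_integral_circ_lborel) auto
  finally show ?thesis .
qed

lemma finite_measure_circ: "finite_measure circ"
  by (rule finite_measureI) (simp add: emeasure_circ)

interpretation circ: finite_measure circ
  by (rule finite_measure_circ)

interpretation circ2: pair_sigma_finite circ circ ..

text \<open>Rotation by c in [0, pi] shifts the interval of angles by c, and the part beyond pi is
  moved back by the period 2 pi of \<open>cis\<close>. A negative argument is reduced to this case
  by rotating the already rotated integrand back by - \<open>Arg w\<close>.\<close>

lemma nn_integral_circ_rotate:
  assumes [measurable]: "h \<in> borel_measurable borel" and "cmod w = 1"
  shows "(\<integral>\<^sup>+z. h (w * z) \<partial>circ) = (\<integral>\<^sup>+z. h z \<partial>circ)"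
proof -
  have pos: "(\<integral>\<^sup>+z. h (cis c * z) \<partial>circ)
      = (\<integral>\<^sup>+z. h z \<partial>circ)"
    if c: "0 \<le> c" "c \<le> pi" and [measurable]: "h \<in> borel_measurable borel" for c h
  proof -
    let ?H = "\<lambda>x. h (cis x)"
    have "(\<integral>\<^sup>+z. h (cis c * z) \<partial>circ)
        = (\<integral>\<^sup>+x. ?H (c + 1 * x) * indicator {-pi + c..pi + c} (c + 1 * x) \<partial>lborel)"
      by (subst nn_integral_circ_lborel) (auto simp: cis_mult indicator_def intro!: nn_integral_cong)
    also have "\<dots> = (\<integral>\<^sup>+x. ?H x * indicator {-pi + c..pi + c} x \<partial>lborel)"
      by (subst nn_integral_real_affine[where c = 1 and t = c
          and f = "\<lambda>x. ?H x * indicator {-pi + c..pi + c} x"]) auto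
    also have "\<dots> = (\<integral>\<^sup>+x. ?H x * indicator {-pi + c..pi} x + ?H x
        * indicator {pi<..pi + c} x \<partial>lborel)"
      using c by (intro nn_integral_cong) (auto simp: indicator_def)
    also have "\<dots> = (\<integral>\<^sup>+x. ?H x * indicator {-pi + c..pi} x \<partial>lborel)
        + (\<integral>\<^sup>+x. ?H x * indicator {pi<..pi + c} x \<partial>lborel)"
      by (intro nn_integral_add) auto
    also have "(\<integral>\<^sup>+x. ?H x * indicator {pi<..pi + c} x \<partial>lborel)
        = (\<integral>\<^sup>+x. ?H x * indicator {-pi<..-pi + c} x \<partial>lborel)"
      by (subst nn_integral_real_affine[where c = 1 and t = "2 * pi"])
         (auto simp: cis_mult[symmetric] indicator_def intro!: nn_integral_cong)
    also have "(\<integral>\<^sup>+x. ?H x * indicator {-pi + c..pi} x \<partial>lborel) + \<dots>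
        = (\<integral>\<^sup>+x. ?H x * indicator {-pi + c..pi} x + ?H x
            * indicator {-pi<..-pi + c} x \<partial>lborel)"
      by (intro nn_integral_add[symmetric]) auto
    also have "\<dots> = (\<integral>\<^sup>+x. ?H x * indicator {-pi..pi} x \<partial>lborel)"
    proof (rule nn_integral_cong_AE)
      \<comment> \<open>For c > 0 the two pieces miss the point -pi and count -pi + c twice;
        elsewhere they tile [-pi, pi].\<close>
      have "AE x in lborel. x \<noteq> -pi" "AE x in lborel. x \<noteq> -pi + c"
        by (rule AE_lborel_singleton)+
      then show "AE x in lborel. ?H x * indicator {-pi + c..pi} x + ?H x * indicator {-pi<..-pi + c} x
          = ?H x * indicator {-pi..pi} x"
        by eventually_elim (use c in \<open>auto simp: indicator_def\<close>)
    qed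
    also have "\<dots> = (\<integral>\<^sup>+z. h z \<partial>circ)"
      by (simp add: nn_integral_circ_lborel)
    finally show ?thesis .
  qed
  have w: "w = cis (Arg w)" using assms(2)
      by (metis cis_Arg norm_zero sgn_eq zero_neq_one div_by_1 of_real_1)
  show ?thesis
  proof (cases "0 \<le> Arg w")
    case True
    then show ?thesis using pos[of "Arg w" h] Arg_le_pi[of w] w by simp
  next
    case False
    have "(\<integral>\<^sup>+z. h (cis (Arg w) * (cis (- Arg w) * z)) \<partial>circ)
        = (\<integral>\<^sup>+z. h (cis (Arg w) * z) \<partial>circ)"
      using pos[of "- Arg w" "\<lambda>z. h (cis (Arg w) * z)"] False mpi_less_Arg[of w] by simp
    moreover have "cis (Arg w) * (cis (- Arg w) * z) = z" for z
      by (simp only: mult.assoc[symmetric] cis_mult) simp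
    ultimately show ?thesis by (simp only: w[symmetric])
  qed
qed

lemma nn_integral_circ_cnj:
  assumes [measurable]: "h \<in> borel_measurable borel"
  shows "(\<integral>\<^sup>+z. h (cnj z) \<partial>circ) = (\<integral>\<^sup>+z. h z \<partial>circ)"
proof -
  have [measurable]: "cnj \<in> borel_measurable borel"
    by (intro borel_measurable_continuous_onI continuous_intros)
  show ?thesis
    by (simp add: nn_integral_circ_lborel cis_cnj,
        subst (2) nn_integral_real_affine[where c = "-1" and t = 0])
       (auto simp: indicator_def intro!: nn_integral_cong)
qed

lemma distr_circ_rotate:
  assumes "cmod w = 1"
  shows "distr circ borel ((*) w) = circ"
proof (rule measure_eqI)
  fix A assume "A \<in> sets (distr circ borel ((*) w))"
  then have [measurable]: "A \<in> sets borel" by simp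
  have "emeasure (distr circ borel ((*) w)) A
      = (\<integral>\<^sup>+z. indicator A z \<partial>distr circ borel ((*) w))"
    by simp
  also have "\<dots> = (\<integral>\<^sup>+z. indicator A (w * z) \<partial>circ)"
    by (rule nn_integral_distr) auto
  also have "\<dots> = emeasure circ A"
    by (subst nn_integral_circ_rotate) (use assms in auto)
  finally show "emeasure (distr circ borel ((*) w)) A = emeasure circ A" .
qed simp

lemma borel_measurable_cnj [measurable]: "cnj \<in> borel_measurable borel"
  by (intro borel_measurable_continuous_onI continuous_intros)

lemma distr_circ_cnj: "distr circ borel cnj = circ"
proof (rule measure_eqI)
  fix A assume "A \<in> sets (distr circ borel cnj)"
  then have [measurable]: "A \<in> sets borel" by simp
  have "emeasure (distr circ borel cnj) A
      = (\<integral>\<^sup>+z. indicator A z \<partial>distr circ borel cnj)"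
    by simp
  also have "\<dots> = (\<integral>\<^sup>+z. indicator A (cnj z) \<partial>circ)"
    by (rule nn_integral_distr) auto
  also have "\<dots> = emeasure circ A"
    by (subst nn_integral_circ_cnj) auto
  finally show "emeasure (distr circ borel cnj) A = emeasure circ A" .
qed simp

lemma integral_circ_rotate:
  fixes f :: "complex \<Rightarrow> complex"
  assumes [measurable]: "f \<in> borel_measurable borel" and "cmod w = 1"
  shows "(LINT z|circ. f (w * z)) = (LINT z|circ. f z)"
proof -
  have "(LINT z|circ. f z) = (LINT z|distr circ borel ((*) w). f z)"
    using assms by (simp add: distr_circ_rotate)
  then show ?thesis by (simp add: integral_distr)
qed

lemma integral_circ_cnj:
  fixes f :: "complex \<Rightarrow> complex"
  assumes [measurable]: "f \<in> borel_measurable borel"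
  shows "(LINT z|circ. f (cnj z)) = (LINT z|circ. f z)"
proof -
  have "(LINT z|circ. f z) = (LINT z|distr circ borel cnj. f z)"
    by (simp add: distr_circ_cnj)
  then show ?thesis by (simp add: integral_distr)
qed

lemma AE_circ_rotate:
  assumes "cmod w = 1" "AE z in circ. P z"
  shows "AE z in circ. P (w * z)"
  using assms(2) by (subst (asm) distr_circ_rotate[OF assms(1), symmetric]) (rule AE_distrD[rotated], auto)

lemma AE_circ_cnj:
  assumes "AE z in circ. P z"
  shows "AE z in circ. P (cnj z)"
  using assms by (subst (asm) distr_circ_cnj[symmetric]) (rule AE_distrD[rotated], auto)

text \<open>
  \<open>Arg\<close> restricted to the circle, in a form whose Borel measurability is evident: it is
  discontinuous on the negative axis, where it is replaced by a constant.
\<close>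

definition arg_circ :: "complex \<Rightarrow> real" where
  "arg_circ z = (if z \<in> - \<real>\<^sub>\<le>\<^sub>0 then Arg z else pi)"

lemma borel_measurable_arg_circ [measurable]: "arg_circ \<in> borel_measurable borel"
proof -
  have "- \<real>\<^sub>\<le>\<^sub>0 \<in> sets (borel :: complex measure)"
    by (intro borel_open open_Compl closed_nonpos_Reals_complex)
  then show ?thesis unfolding arg_circ_def
    by (intro borel_measurable_continuous_on_if continuous_on_Arg continuous_intros)
qed

lemma arg_circ_cis: "-pi < \<theta> \<Longrightarrow> \<theta>
    \<le> pi \<Longrightarrow> arg_circ (cis \<theta>) = \<theta>"
proof -
  assume \<theta>: "-pi < \<theta>" "\<theta> \<le> pi"
  have "Arg (cis \<theta>) = \<theta>" using \<theta> by (intro cis_Arg_unique) auto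
  moreover have "\<theta> = pi" if "cis \<theta> \<in> \<real>\<^sub>\<le>\<^sub>0"
    using that \<open>Arg (cis \<theta>) = \<theta>\<close> Arg_eq_pi[of "cis \<theta>"]
    by (metis cis_neq_zero complex_nonpos_Reals_iff complex_eq_iff less_eq_real_def zero_complex.simps)
  ultimately show ?thesis by (auto simp: arg_circ_def)
qed

lemma AE_circ_norm: "AE z in circ. cmod z = 1"
  unfolding circ_def by (subst AE_distr_iff) auto

lemma cis_arg_circ: "cmod z = 1 \<Longrightarrow> cis (arg_circ z) = z"
    and arg_circ_in: "arg_circ z \<in> {-pi..pi}"
proof -
  assume z: "cmod z = 1"
  then have "z \<noteq> 0" by auto
  then have 1: "cis (Arg z) = z" using z by (simp add: cis_Arg sgn_eq)
  moreover have "z = -1" if "z \<in> \<real>\<^sub>\<le>\<^sub>0"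
    using that z by (auto simp: complex_nonpos_Reals_iff complex_eq_iff cmod_def)
  ultimately show "cis (arg_circ z) = z" by (auto simp: arg_circ_def)
next
  show "arg_circ z \<in> {-pi..pi}"
    using mpi_less_Arg[of z] Arg_le_pi[of z] by (auto simp: arg_circ_def)
qed

text \<open>From the circle to angles this is the push-forward. Conversely, \<open>P\<close> is
  arbitrary, so the exceptional angles are first enclosed in a Borel null set N, whose preimage
  under \<open>arg_circ\<close> is a Borel null set on the circle.\<close>

lemma AE_circ_iff: "(AE z in circ. P z) \<longleftrightarrow> (AE \<theta> in angles. P (cis \<theta>))"
proof
  assume "AE z in circ. P z"
  then show "AE \<theta> in angles. P (cis \<theta>)"
    unfolding circ_def by (rule AE_distrD[rotated]) simp
next
  assume "AE \<theta> in angles. P (cis \<theta>)"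
  then have "AE \<theta> in lborel. \<theta> \<in> {-pi..pi} \<longrightarrow> P (cis \<theta>)"
    by (simp add: AE_restrict_space_iff AE_completion_iff)
  then obtain N where N: "{\<theta>. \<not> (\<theta> \<in> {-pi..pi} \<longrightarrow> P (cis \<theta>))}
      \<subseteq> N" "N \<in> null_sets lborel"
    by (auto simp: eventually_ae_filter)
  then have [measurable]: "N \<in> sets borel" by auto
  define B where "B = {z. arg_circ z \<in> N}"
  have [measurable]: "B \<in> sets borel" unfolding B_def by measurable
  have "emeasure circ B = (\<integral>\<^sup>+\<theta>. indicator B (cis \<theta>)
      * indicator {-pi..pi} \<theta> \<partial>lborel)"
    by (subst nn_integral_circ_lborel[symmetric]) auto
  also have "\<dots> = 0"
  proof (subst nn_integral_0_iff_AE)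
    have "AE \<theta> in lborel. \<theta> \<noteq> -pi" "AE \<theta> in lborel. \<theta> \<notin> N"
      using N(2) AE_lborel_singleton AE_not_in by blast+
    then show "AE \<theta> in lborel. indicator B (cis \<theta>) * indicator {- pi..pi} \<theta>
        = (0::ennreal)"
      by eventually_elim (auto simp: indicator_def B_def arg_circ_cis)
  qed auto
  finally have "AE z in circ. z \<notin> B"
    by (intro AE_not_in) auto
  with AE_circ_norm show "AE z in circ. P z"
    by eventually_elim (use N(1) cis_arg_circ arg_circ_in in \<open>force simp: B_def\<close>)
qed

lemma circle_ae_iff: "(f, g) \<in> circle_ae \<longleftrightarrow> (AE z in circ. f z = g z)"
  by (simp add: circle_ae_def AE_circ_iff)

text \<open>Real and imaginary part along \<open>cis\<close> are changed on a null set of angles to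
  become Borel and are then carried to the plane by \<open>arg_circ\<close>. This is the entry point
  for every argument that uses Tonelli on the circle.\<close>

lemma borel_representative:
  fixes f :: "complex \<Rightarrow> complex"
  assumes "(\<lambda>\<theta>. f (cis \<theta>)) \<in> borel_measurable angles"
  obtains g where "g \<in> borel_measurable borel" "AE z in circ. f z = g z"
proof -
  let ?F = "\<lambda>\<theta>. if \<theta> \<in> {-pi..pi} then f (cis \<theta>) else 0"
  have F [measurable]: "?F \<in> borel_measurable lebesgue"
    using assms by (intro borel_measurable_if_I) auto
  have "(\<lambda>\<theta>. Re (?F \<theta>)) \<in> borel_measurable lebesgue"
    by measurable
  from completion_ex_borel_measurable_real[OF this]
  obtain a where [measurable]: "a \<in> borel_measurable borel"
      and a: "AE \<theta> in lborel. Re (?F \<theta>) = a \<theta>"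
    by auto
  have "(\<lambda>\<theta>. Im (?F \<theta>)) \<in> borel_measurable lebesgue"
    by measurable
  from completion_ex_borel_measurable_real[OF this]
  obtain b where [measurable]: "b \<in> borel_measurable borel"
      and b: "AE \<theta> in lborel. Im (?F \<theta>) = b \<theta>"
    by auto
  define g where "g z = Complex (a (arg_circ z)) (b (arg_circ z))" for z
  have g: "g \<in> borel_measurable borel" unfolding g_def Complex_eq by measurable
  \<comment> \<open>\<open>arg_circ\<close> sends \<open>cis (-pi)\<close> to \<open>pi\<close>, so
    the left end point has to be discarded.\<close>
  have "AE \<theta> in lborel. \<theta> \<noteq> -pi" by (rule AE_lborel_singleton)
  with a b have "AE \<theta> in lborel. \<theta> \<in> {-pi..pi} \<longrightarrow> f (cis \<theta>)
      = g (cis \<theta>)"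
    by eventually_elim (auto simp: g_def arg_circ_cis complex_eq_iff)
  then have "AE z in circ. f z = g z"
    by (simp add: AE_circ_iff AE_restrict_space_iff AE_completion_iff)
  then show ?thesis using that g by blast
qed

section \<open>The Poisson integral\<close>

text \<open>The Poisson kernel without polar coordinates: invariance under a simultaneous rotation
  of both arguments is visible, and \<open>poisson_kernel_eq\<close> links it to
  \<open>poisson_kernel\<close>.\<close>

definition poisson_density :: "complex \<Rightarrow> complex \<Rightarrow> real" where
  "poisson_density z y = (1 - (cmod z)\<^sup>2) / (cmod (y - z))\<^sup>2"

definition poisson_integral :: "(complex \<Rightarrow> complex) \<Rightarrow> complex \<Rightarrow> complex" where
  "poisson_integral g z = (LINT y|circ. of_real (poisson_density z y) * g y) / of_real (2 * pi)"

lemma borel_measurable_poisson_density [measurable]: "poisson_density z \<in> borel_measurable borel"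
  unfolding poisson_density_def by measurable

lemma poisson_density_nonneg: "cmod z < 1 \<Longrightarrow> 0 \<le> poisson_density z y"
  unfolding poisson_density_def by (intro divide_nonneg_nonneg) (auto simp: abs_square_le_1)

lemma poisson_density_le:
  assumes "cmod z < 1" "cmod y = 1"
  shows "poisson_density z y \<le> 2 / (1 - cmod z)"
proof -
  have *: "1 - cmod z \<le> cmod (y - z)" using norm_triangle_ineq2[of y z] assms by simp
  then have "(1 - cmod z)\<^sup>2 \<le> (cmod (y - z))\<^sup>2" using assms by (intro power_mono) auto
  then have "(1 + cmod z) * (1 - cmod z)\<^sup>2 \<le> 2 * (cmod (y - z))\<^sup>2"
    using assms by (intro mult_mono) auto
  then have "(1 - (cmod z)\<^sup>2) * (1 - cmod z) \<le> 2 * (cmod (y - z))\<^sup>2"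
    by (simp add: power2_eq_square algebra_simps)
  moreover have "0 < (cmod (y - z))\<^sup>2" "0 < 1 - cmod z" using * assms by auto
  ultimately show ?thesis
    unfolding poisson_density_def by (simp only: pos_divide_le_eq pos_le_divide_eq times_divide_eq_left)
qed

text \<open>On the circle |y - z|^2 factors as (1 - z cnj y)(1 - cnj z y), and partial fractions
  split the kernel into two geometric series, one analytic and one antianalytic in z, whose common
  constant term is subtracted once.\<close>

lemma poisson_density_eq:
  assumes "cmod z < 1" "cmod y = 1"
  shows "complex_of_real (poisson_density z y) = 1 / (1 - z * cnj y) + 1 / (1 - cnj z * y) - 1"
proof -
  have 1: "y * cnj y = 1" using assms by (simp add: complex_norm_square[symmetric])
  have nz: "1 - z * cnj y \<noteq> 0"
  proof
    assume "1 - z * cnj y = 0"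
    then have "cmod (z * cnj y) = 1" by simp
    then show False using assms by (simp add: norm_mult)
  qed
  have nz': "1 - cnj z * y \<noteq> 0"
    using nz by (metis complex_cnj_cnj complex_cnj_diff complex_cnj_mult complex_cnj_one complex_cnj_zero)
  have D: "complex_of_real ((cmod (y - z))\<^sup>2) = (1 - z * cnj y) * (1 - cnj z * y)"
  proof -
    have "complex_of_real ((cmod (y - z))\<^sup>2) = (y - z) * cnj (y - z)"
      by (rule complex_norm_square)
    also have "\<dots> = (y * cnj y) * ((y - z) * cnj (y - z))" by (simp add: 1)
    also have "\<dots> = (y * cnj y - z * cnj y) * (y * cnj y - cnj z * y)"
      by (simp add: algebra_simps)
    finally show ?thesis by (simp add: 1)
  qed
  have "complex_of_real (poisson_density z y)
      = (1 - z * cnj z * (y * cnj y)) / ((1 - z * cnj y) * (1 - cnj z * y))"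
    unfolding poisson_density_def of_real_divide D 1
    by (simp only: of_real_diff of_real_1 complex_norm_square mult_1_right)
  also have "1 - z * cnj z * (y * cnj y)
      = (1 - cnj z * y) + (1 - z * cnj y) - (1 - z * cnj y) * (1 - cnj z * y)"
    by (simp add: algebra_simps)
  finally show ?thesis using nz nz' by (simp add: divide_simps)
qed

lemma integrable_circ_bounded:
  fixes g h :: "complex \<Rightarrow> complex"
  assumes "integrable circ g" and [measurable]: "h \<in> borel_measurable borel"
    and "\<And>y. cmod y = 1 \<Longrightarrow> cmod (h y) \<le> C"
  shows "integrable circ (\<lambda>y. h y * g y)"
proof (rule Bochner_Integration.integrable_bound[where f = "\<lambda>y. of_real C * g y"])
  have [measurable]: "g \<in> borel_measurable borel" using assms(1) by auto
  show "(\<lambda>y. h y * g y) \<in> borel_measurable circ" by measurable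
  show "AE y in circ. cmod (h y * g y) \<le> cmod (of_real C * g y)"
    using AE_circ_norm
  proof eventually_elim
    case (elim y)
    have "cmod (h y) \<le> \<bar>C\<bar>" using assms(3)[OF elim] by simp
    then show ?case by (simp add: norm_mult mult_right_mono)
  qed
qed (use assms(1) in auto)

lemma integrable_poisson_density:
  assumes "cmod z < 1" "integrable circ g"
  shows "integrable circ (\<lambda>y. complex_of_real (poisson_density z y) * g y)"
  by (rule integrable_circ_bounded[where C = "2 / (1 - cmod z)"])
     (use assms poisson_density_le poisson_density_nonneg in auto)

text \<open>\<open>h\<close> stands for \<open>cnj\<close> or the identity, the two halves of the
  Poisson kernel. The majorant |w|^k |g y| justifies integrating term by term.\<close>

lemma geometric_integral_sums:
  fixes g h :: "complex \<Rightarrow> complex"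
  assumes w: "cmod w < 1" and g: "integrable circ g" and h [measurable]: "h \<in> borel_measurable borel"
    and h1: "\<And>y. cmod y = 1 \<Longrightarrow> cmod (h y) \<le> 1"
  shows "(\<lambda>k. w ^ k * (LINT y|circ. h y ^ k * g y)) sums (LINT y|circ. 1 / (1 - w * h y) * g y)"
proof -
  have [measurable]: "g \<in> borel_measurable borel" using g by auto
  have hk: "cmod (h y ^ k) \<le> 1" if "cmod y = 1" for y k
    using h1[OF that] by (simp add: norm_power power_le_one)
  have int: "integrable circ (\<lambda>y. h y ^ k * g y)" for k
    by (rule integrable_circ_bounded[where C = 1]) (use g hk in auto)
  have le: "norm (w ^ k * (h y ^ k * g y)) \<le> cmod w ^ k * cmod (g y)" if "cmod y = 1" for k y
    using hk[OF that, of k] by (simp add: norm_mult norm_power mult_left_mono mult_left_le_one_le)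
  have "(\<lambda>k. LINT y|circ. w ^ k * (h y ^ k * g y))
      sums (LINT y|circ. (\<Sum>k. w ^ k * (h y ^ k * g y)))"
  proof (rule sums_integral)
    show "integrable circ (\<lambda>y. w ^ k * (h y ^ k * g y))" for k
      using int by simp
    show "AE y in circ. summable (\<lambda>k. norm (w ^ k * (h y ^ k * g y)))"
      using AE_circ_norm
    proof eventually_elim
      case (elim y)
      show ?case
      proof (rule summable_comparison_test'[where g = "\<lambda>k. cmod w ^ k * cmod (g y)" and N = 0])
        show "summable (\<lambda>k. cmod w ^ k * cmod (g y))"
          using w by (intro summable_mult2 summable_geometric) auto
        show "norm (norm (w ^ k * (h y ^ k * g y))) \<le> cmod w ^ k * cmod (g y)" for k
          using le[OF elim, of k] by (simp only: real_norm_def abs_norm_cancel)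
      qed
    qed
    show "summable (\<lambda>k. LINT y|circ. norm (w ^ k * (h y ^ k * g y)))"
    proof (rule summable_comparison_test'[where g = "\<lambda>k. cmod w ^ k * (LINT y|circ. cmod (g y))"
        and N = 0])
      show "summable (\<lambda>k. cmod w ^ k * (LINT y|circ. cmod (g y)))"
        using w by (intro summable_mult2 summable_geometric) auto
      fix k :: nat
      have "(LINT y|circ. norm (w ^ k * (h y ^ k * g y))) \<le> (LINT y|circ. cmod w ^ k * cmod (g y))"
      proof (rule integral_mono_AE)
        show "AE y in circ. norm (w ^ k * (h y ^ k * g y)) \<le> cmod w ^ k * cmod (g y)"
          using AE_circ_norm
          by eventually_elim (rule le)
      qed (use int g in auto)
      then show "norm (LINT y|circ. norm (w ^ k * (h y ^ k * g y)))
          \<le> cmod w ^ k * (LINT y|circ. cmod (g y))"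
        by simp
    qed
  qed
  moreover have "(LINT y|circ. (\<Sum>k. w ^ k * (h y ^ k * g y))) = (LINT y|circ. 1 / (1 - w * h y) * g y)"
  proof (rule integral_cong_AE)
    show "AE y in circ. (\<Sum>k. w ^ k * (h y ^ k * g y)) = 1 / (1 - w * h y) * g y"
      using AE_circ_norm
    proof eventually_elim
      case (elim y)
      have "cmod (w * h y) < 1"
        using w h1[OF elim] by (simp add: norm_mult) (meson mult_left_le norm_ge_zero order_le_less_trans)
      then have "(\<lambda>k. (w * h y) ^ k * g y) sums (1 / (1 - w * h y) * g y)"
        by (intro sums_mult2 geometric_sums)
      then show ?case by (simp add: power_mult_distrib mult.assoc sums_iff)
    qed
  qed measurable
  ultimately show ?thesis by simp
qed

lemma integral_circ_cong:
  fixes f g :: "complex \<Rightarrow> complex"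
  assumes "f \<in> borel_measurable borel" "g \<in> borel_measurable borel" "\<And>y. cmod y
      = 1 \<Longrightarrow> f y = g y"
  shows "(LINT y|circ. f y) = (LINT y|circ. g y)"
  by (rule integral_cong_AE) (use assms AE_circ_norm in auto)

text \<open>The antianalytic half has the coefficients in \<open>neg\<close>; only its constant term
  survives, and this cancels against the -1 in the kernel. What remains is a power series in z,
  which is the source of analyticity of Poisson extensions.\<close>

lemma poisson_integral_sums:
  assumes z: "cmod z < 1" and g: "integrable circ g"
    and neg: "\<And>k. 0 < k \<Longrightarrow> (LINT y|circ. y ^ k * g y) = 0"
  shows "(\<lambda>k. (LINT y|circ. cnj y ^ k * g y) / of_real (2 * pi) * z ^ k) sums poisson_integral g z"
proof -
  have [measurable]: "g \<in> borel_measurable borel" using g by auto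
  have s1: "(\<lambda>k. z ^ k * (LINT y|circ. cnj y ^ k * g y))
      sums (LINT y|circ. 1 / (1 - z * cnj y) * g y)"
    by (rule geometric_integral_sums) (use z g in auto)
  have "(\<lambda>k. cnj z ^ k * (LINT y|circ. y ^ k * g y)) sums (LINT y|circ. 1 / (1 - cnj z * y) * g y)"
    by (rule geometric_integral_sums) (use z g in auto)
  moreover have "(\<lambda>k. cnj z ^ k * (LINT y|circ. y ^ k * g y)) sums (LINT y|circ. g y)"
    using sums_finite[of "{0}" "\<lambda>k. cnj z ^ k * (LINT y|circ. y ^ k * g y)"] neg by simp
  ultimately have s2: "(LINT y|circ. 1 / (1 - cnj z * y) * g y) = (LINT y|circ. g y)"
    by (rule sums_unique2)
  have lower: "1 - cmod z \<le> cmod (1 - w)" if "cmod w = cmod z" for w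
    using norm_triangle_ineq2[of 1 w] that by simp
  have i: "integrable circ (\<lambda>y. 1 / (1 - h y) * g y)"
    if [measurable]: "h \<in> borel_measurable borel"
        and h: "\<And>y. cmod y = 1 \<Longrightarrow> cmod (h y) = cmod z" for h
  proof (rule integrable_circ_bounded[where C = "1 / (1 - cmod z)"])
    show "cmod (1 / (1 - h y)) \<le> 1 / (1 - cmod z)" if "cmod y = 1" for y
      using lower[OF h[OF that]] z by (simp add: norm_divide frac_le)
  qed (use g in auto)
  have "(LINT y|circ. of_real (poisson_density z y) * g y)
      = (LINT y|circ. 1 / (1 - z * cnj y) * g y + 1 / (1 - cnj z * y) * g y - g y)"
    by (rule integral_circ_cong) (use z in \<open>auto simp: poisson_density_eq algebra_simps\<close>)
  also have "\<dots> = (LINT y|circ. 1 / (1 - z * cnj y) * g y) + (LINT y|circ. 1 / (1 - cnj z * y) * g y)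
      - (LINT y|circ. g y)"
    using i[of "\<lambda>y. z * cnj y"] i[of "\<lambda>y. cnj z * y"] g
    by (simp add: norm_mult Bochner_Integration.integral_diff Bochner_Integration.integral_add)
  also have "\<dots> = (LINT y|circ. 1 / (1 - z * cnj y) * g y)" by (simp only: s2) simp
  finally have "poisson_integral g z = (LINT y|circ. 1 / (1 - z * cnj y) * g y) / of_real (2 * pi)"
    by (simp add: poisson_integral_def)
  then show ?thesis using sums_divide[OF s1, of "of_real (2 * pi)"] by (simp add: mult.commute)
qed

text \<open>Rotation by \<open>cis (pi / k)\<close> preserves \<open>circ\<close> and changes the
  sign of y^k.\<close>

lemma integral_circ_power:
  assumes "0 < k"
  shows "(LINT y|circ. y ^ k) = 0" "(LINT y|circ. cnj y ^ k) = 0"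
proof -
  have "(LINT y|circ. (cis (pi / k) * y) ^ k) = (LINT y|circ. y ^ k)"
    by (rule integral_circ_rotate) auto
  moreover have "cis (pi / k) ^ k = -1"
    by (subst Complex.DeMoivre) (use assms in simp)
  then have "(cis (pi / k) * y) ^ k = - (y ^ k)" for y
    unfolding power_mult_distrib by simp
  ultimately show 1: "(LINT y|circ. y ^ k) = 0" by simp
  show "(LINT y|circ. cnj y ^ k) = 0"
    using integral_circ_cnj[of "\<lambda>y. y ^ k"] 1 by simp
qed

lemma measure_circ: "measure circ UNIV = 2 * pi"
  by (simp add: measure_def emeasure_circ)

text \<open>For constant data the power series has only its zeroth term. The total mass 2 pi of the
  kernel is read off from this.\<close>

lemma poisson_integral_const: "cmod z < 1 \<Longrightarrow> poisson_integral (\<lambda>_. c) z = c"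
proof -
  assume z: "cmod z < 1"
  have "(\<lambda>k. (LINT y|circ. cnj y ^ k * c) / of_real (2 * pi) * z ^ k)
      sums poisson_integral (\<lambda>_. c) z"
    by (rule poisson_integral_sums) (use z integral_circ_power in auto)
  moreover have "(\<lambda>k. (LINT y|circ. cnj y ^ k * c) / of_real (2 * pi) * z ^ k) sums c"
    using sums_finite[of "{0}" "\<lambda>k. (LINT y|circ. cnj y ^ k * c) / of_real (2 * pi)
        * z ^ k"] integral_circ_power
    by (simp add: measure_circ scaleR_conv_of_real)
  ultimately show ?thesis by (rule sums_unique2)
qed

lemma nn_integral_poisson_density:
  assumes "cmod z < 1"
  shows "(\<integral>\<^sup>+y. ennreal (poisson_density z y) \<partial>circ) = ennreal (2 * pi)"
proof -
  have "integrable circ (\<lambda>y. complex_of_real (poisson_density z y) * 1)"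
    using assms by (intro integrable_poisson_density) auto
  then have i: "integrable circ (poisson_density z)" by (simp add: complex_of_real_integrable_eq)
  have "complex_of_real (LINT y|circ. poisson_density z y) / of_real (2 * pi) = 1"
    using poisson_integral_const[OF assms, of 1] by (simp add: poisson_integral_def)
  then have "complex_of_real (LINT y|circ. poisson_density z y) = of_real (2 * pi)"
      by (simp add: divide_simps split: if_splits)
  then have "(LINT y|circ. poisson_density z y) = 2 * pi" by (simp only: of_real_eq_iff)
  then show ?thesis using i assms by (simp add: nn_integral_eq_integral poisson_density_nonneg)
qed

lemma poisson_integral_diff:
  assumes "cmod z < 1" "integrable circ f" "integrable circ g"
  shows "poisson_integral (\<lambda>y. f y - g y) z = poisson_integral f z - poisson_integral g z"
  using assms integrable_poisson_density[of z f] integrable_poisson_density[of z g]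
  by (simp add: poisson_integral_def right_diff_distrib diff_divide_distrib)

lemma nn_integral_poisson_density_2pi:
  assumes "cmod z < 1"
  shows "(\<integral>\<^sup>+y. ennreal (poisson_density z y / (2 * pi)) \<partial>circ) = 1"
proof -
  have "(\<integral>\<^sup>+y. ennreal (poisson_density z y / (2 * pi)) \<partial>circ)
      = (\<integral>\<^sup>+y. ennreal (1 / (2 * pi)) * ennreal (poisson_density z y) \<partial>circ)"
    using assms poisson_density_nonneg by (simp add: ennreal_mult[symmetric])
  also have "\<dots> = ennreal (1 / (2 * pi)) * ennreal (2 * pi)"
    using assms by (simp add: nn_integral_cmult nn_integral_poisson_density)
  also have "\<dots> = 1" by (simp add: ennreal_mult[symmetric])
  finally show ?thesis .
qed

lemma poisson_integral_diff_const:
  assumes "cmod z < 1" "integrable circ g"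
  shows "poisson_integral (\<lambda>y. g y - c) z = poisson_integral g z - c"
  using assms poisson_integral_diff[of z g "\<lambda>_. c"] by (simp add: poisson_integral_const)

lemma poisson_integral_jensen:
  assumes "1 < p" "cmod z < 1" and [measurable]: "g \<in> borel_measurable borel"
  shows "ennreal (cmod (poisson_integral g z) powr p)
      \<le> (\<integral>\<^sup>+y. ennreal (poisson_density z y / (2 * pi)
          * cmod (g y) powr p) \<partial>circ)"
proof -
  have "(\<integral>\<^sup>+y. ennreal (poisson_density z y / (2 * pi)) \<partial>circ) \<le> ennreal 1"
    using nn_integral_poisson_density_2pi[OF assms(2)] by simp
  then have "ennreal (cmod (LINT y|circ. of_real (poisson_density z y / (2 * pi)) * g y) powr p)
      \<le> ennreal (1 powr (p - 1))
          * (\<integral>\<^sup>+y. ennreal (poisson_density z y / (2 * pi)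
              * cmod (g y) powr p) \<partial>circ)"
    using assms poisson_density_nonneg by (intro jensen_powr) auto
  moreover have "(LINT y|circ. of_real (poisson_density z y / (2 * pi)) * g y) = poisson_integral g z"
    unfolding poisson_integral_def integral_divide_zero[symmetric]
        by (rule Bochner_Integration.integral_cong) simp_all
  ultimately show ?thesis by simp
qed

text \<open>For fixed z the function \<xi> \<mapsto> P[g](z\<xi>) is thus an average of rotated
  copies of g, with weights independent of \<xi>.\<close>

lemma poisson_integral_rotate:
  assumes [measurable]: "g \<in> borel_measurable borel" and \<xi>: "cmod \<xi> = 1"
  shows "poisson_integral g (z * \<xi>) = poisson_integral (\<lambda>\<eta>. g (\<xi> * \<eta>)) z"
proof -
  have "(LINT y|circ. of_real (poisson_density (z * \<xi>) (\<xi> * y)) * g (\<xi> * y))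
      = (LINT y|circ. of_real (poisson_density (z * \<xi>) y) * g y)"
    using \<xi> by (intro integral_circ_rotate[where f = "\<lambda>y. of_real (poisson_density (z
        * \<xi>) y) * g y"]) auto
  moreover have "poisson_density (z * \<xi>) (\<xi> * y) = poisson_density z y" for y
    using \<xi> by (simp add: poisson_density_def norm_mult mult.commute[of z] right_diff_distrib[symmetric])
  ultimately show ?thesis by (simp add: poisson_integral_def)
qed

section \<open>The Gagliardo energy\<close>

definition gagliardo_kernel :: "real \<Rightarrow> real \<Rightarrow> (complex \<Rightarrow> complex) \<Rightarrow> complex \<Rightarrow> complex \<Rightarrow> ennreal" where
  "gagliardo_kernel s p g \<sigma> \<xi>
      = ennreal (cmod (g \<xi> - g \<sigma>) powr p / cmod (\<xi> - \<sigma>) powr (1 + s * p))"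

lemma measurable_gagliardo_kernel [measurable (raw)]:
  assumes [measurable]: "g \<in> borel_measurable borel" "a \<in> measurable M borel" "b \<in> measurable M borel"
  shows "(\<lambda>x. gagliardo_kernel s p g (a x) (b x)) \<in> borel_measurable M"
  unfolding gagliardo_kernel_def by measurable

text \<open>This is \<open>G g \<sigma>\<close> of the overview.\<close>

definition gagliardo_at :: "real \<Rightarrow> real \<Rightarrow> (complex \<Rightarrow> complex) \<Rightarrow> complex \<Rightarrow> ennreal" where
  "gagliardo_at s p g \<sigma>
      = (\<integral>\<^sup>+\<xi>. gagliardo_kernel s p g \<sigma> \<xi> \<partial>circ)"

lemma measurable_gagliardo_at [measurable]:
  assumes [measurable]: "g \<in> borel_measurable borel"
  shows "gagliardo_at s p g \<in> borel_measurable borel"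
  unfolding gagliardo_at_def by measurable

text \<open>The Borel majorant \<open>R\<close> carries the measurability, so the passage from
  angles to \<open>circ\<close> applies to \<xi> \<mapsto> P[g](z\<xi>) directly.\<close>

lemma gagliardo_energy_le_circ:
  assumes [measurable]: "case_prod R \<in> borel_measurable (borel \<Otimes>\<^sub>M borel)"
    and "\<And>\<sigma> \<xi>. cmod \<sigma> = 1 \<Longrightarrow> cmod \<xi>
        = 1 \<Longrightarrow> gagliardo_kernel s p g \<sigma> \<xi> \<le> R \<sigma> \<xi>"
  shows "gagliardo_energy s p g
      \<le> (\<integral>\<^sup>+\<sigma>. (\<integral>\<^sup>+\<xi>. R \<sigma> \<xi> \<partial>circ) \<partial>circ)"
proof -
  have "gagliardo_energy s p g
      \<le> (\<integral>\<^sup>+\<sigma>. (\<integral>\<^sup>+\<xi>. R (cis \<sigma>) (cis \<xi>) \<partial>angles) \<partial>angles)"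
    unfolding gagliardo_energy_def
    by (intro nn_integral_mono assms(2)[unfolded gagliardo_kernel_def]) auto
  also have "\<dots> = (\<integral>\<^sup>+\<sigma>. (\<integral>\<^sup>+\<xi>. R \<sigma> \<xi> \<partial>circ) \<partial>circ)"
  proof -
    have "(\<lambda>\<xi>. case_prod R (\<sigma>, \<xi>)) \<in> borel_measurable borel" for \<sigma>
      by measurable
    then have "R \<sigma> \<in> borel_measurable borel" for \<sigma>
      by simp
    then have "(\<integral>\<^sup>+\<xi>. R \<sigma> \<xi> \<partial>circ)
        = (\<integral>\<^sup>+\<xi>. R \<sigma> (cis \<xi>) \<partial>angles)" for \<sigma>
      by (rule nn_integral_circ)
    moreover have "(\<integral>\<^sup>+\<sigma>. (\<integral>\<^sup>+\<xi>. R \<sigma> \<xi> \<partial>circ) \<partial>circ) = (\<integral>\<^sup>+\<sigma>. (\<integral>\<^sup>+\<xi>. R (cis \<sigma>) \<xi> \<partial>circ) \<partial>angles)"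
      by (rule nn_integral_circ) measurable
    ultimately show ?thesis by simp
  qed
  finally show ?thesis .
qed

lemma gagliardo_energy_circ:
  assumes [measurable]: "g \<in> borel_measurable borel"
  shows "gagliardo_energy s p g = (\<integral>\<^sup>+\<sigma>. gagliardo_at s p g \<sigma> \<partial>circ)"
proof -
  have "(\<integral>\<^sup>+\<sigma>. gagliardo_at s p g \<sigma> \<partial>circ)
      = (\<integral>\<^sup>+\<sigma>. gagliardo_at s p g (cis \<sigma>) \<partial>angles)"
    by (rule nn_integral_circ) simp
  also have "\<dots> = gagliardo_energy s p g"
    unfolding gagliardo_energy_def gagliardo_at_def
    by (subst nn_integral_circ) (auto simp: gagliardo_kernel_def)
  finally show ?thesis by simp
qed

lemma Lp_energy_circ:
  assumes [measurable]: "g \<in> borel_measurable borel"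
  shows "Lp_energy p g = (\<integral>\<^sup>+y. ennreal (cmod (g y) powr p) \<partial>circ)"
  unfolding Lp_energy_def by (rule nn_integral_circ[symmetric]) simp

lemma Lp_energy_cong:
  assumes "AE y in circ. f y = g y"
  shows "Lp_energy p f = Lp_energy p g"
  unfolding Lp_energy_def
  by (rule nn_integral_cong_AE) (use assms[unfolded AE_circ_iff] in eventually_elim, simp)

lemma gagliardo_energy_cong:
  assumes "AE y in circ. f y = g y"
  shows "gagliardo_energy s p f = gagliardo_energy s p g"
  unfolding gagliardo_energy_def
proof (rule nn_integral_cong_AE, use assms[unfolded AE_circ_iff] in eventually_elim, goal_cases)
  case (1 \<sigma>)
  show ?case
    by (rule nn_integral_cong_AE) (use assms[unfolded AE_circ_iff] in eventually_elim, simp add: 1)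
qed

lemma integrable_Lp:
  assumes p: "1 < p" and [measurable]: "g \<in> borel_measurable borel" and "Lp_energy p g < \<infinity>"
  shows "integrable circ g"
proof (rule integrableI_bounded)
  have le: "x \<le> 1 + x powr p" if "0 \<le> x" for x :: real
  proof (cases "x \<le> 1")
    case False
    then have "x powr 1 \<le> x powr p" using p by (intro powr_mono) auto
    then show ?thesis using False by simp
  qed (simp add: add_increasing2)
  have "(\<integral>\<^sup>+y. ennreal (norm (g y)) \<partial>circ)
      \<le> (\<integral>\<^sup>+y. 1 + ennreal (cmod (g y) powr p) \<partial>circ)"
    using le by (intro nn_integral_mono)
      (simp add: ennreal_plus[symmetric] ennreal_1[symmetric] del: ennreal_plus ennreal_1)
  also have "\<dots> = ennreal (2 * pi) + Lp_energy p g"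
    by (subst nn_integral_add) (auto simp: emeasure_circ Lp_energy_circ)
  also have "\<dots> < \<infinity>" using assms by simp
  finally show "(\<integral>\<^sup>+y. ennreal (norm (g y)) \<partial>circ) < \<infinity>" .
qed simp

lemma integrable_circ_rotate:
  fixes g :: "complex \<Rightarrow> complex"
  assumes "integrable circ g" "cmod w = 1"
  shows "integrable circ (\<lambda>y. g (w * y))"
proof -
  have "integrable (distr circ borel ((*) w)) g"
    using assms by (simp add: distr_circ_rotate)
  then show ?thesis by (rule integrable_distr[rotated]) simp
qed

text \<open>Jensen's inequality for a weight of mass 1 bounds the kernel at each pair (\<sigma>,
  \<xi>) by an average over \<eta> of the kernels at (\<sigma>\<eta>, \<xi>\<eta>). Rotation by
  \<eta> changes neither distances nor \<open>circ\<close>, so after Tonelli every \<eta>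
  contributes the energy of g.\<close>

lemma gagliardo_energy_poisson_integral_le:
  assumes p: "1 < p" and z: "cmod z < 1" and g: "integrable circ g"
  shows "gagliardo_energy s p (\<lambda>\<xi>. poisson_integral g (z * \<xi>)) \<le> gagliardo_energy s p g"
proof -
  have [measurable]: "g \<in> borel_measurable borel" using g by auto
  define c where "c \<eta> = ennreal (poisson_density z \<eta> / (2 * pi))" for \<eta>
  have [measurable]: "c \<in> borel_measurable borel" unfolding c_def by measurable
  define R where "R \<sigma> \<xi>
      = (\<integral>\<^sup>+\<eta>. c \<eta>
          * gagliardo_kernel s p g (\<sigma> * \<eta>) (\<xi> * \<eta>) \<partial>circ)" for \<sigma> \<xi>
  have [measurable]: "case_prod R \<in> borel_measurable (borel \<Otimes>\<^sub>M borel)"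
    unfolding R_def by measurable
  have le: "gagliardo_kernel s p (\<lambda>\<xi>. poisson_integral g (z * \<xi>)) \<sigma> \<xi>
      \<le> R \<sigma> \<xi>" if "cmod \<sigma> = 1" "cmod \<xi> = 1" for \<sigma> \<xi>
  proof -
    let ?d = "1 / cmod (\<xi> - \<sigma>) powr (1 + s * p)"
    have "poisson_integral g (z * \<xi>) - poisson_integral g (z * \<sigma>)
        = poisson_integral (\<lambda>\<eta>. g (\<xi> * \<eta>) - g (\<sigma> * \<eta>)) z"
      using that z g integrable_circ_rotate by (simp add: poisson_integral_rotate poisson_integral_diff)
    then have "ennreal (cmod (poisson_integral g (z * \<xi>) - poisson_integral g (z * \<sigma>)) powr p)
       \<le> (\<integral>\<^sup>+\<eta>. ennreal (poisson_density z \<eta> / (2 * pi)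
           * cmod (g (\<xi> * \<eta>) - g (\<sigma> * \<eta>)) powr p) \<partial>circ)"
      using poisson_integral_jensen[OF p z, of "\<lambda>\<eta>. g (\<xi> * \<eta>) - g (\<sigma>
          * \<eta>)"] by simp
    then have "ennreal ?d * ennreal (cmod (poisson_integral g (z * \<xi>) - poisson_integral g (z
        * \<sigma>)) powr p)
       \<le> ennreal ?d * (\<integral>\<^sup>+\<eta>. ennreal (poisson_density z \<eta> / (2 * pi)
           * cmod (g (\<xi> * \<eta>) - g (\<sigma> * \<eta>)) powr p) \<partial>circ)"
      by (rule mult_left_mono) simp
    also have "\<dots> = (\<integral>\<^sup>+\<eta>. ennreal ?d
        * ennreal (poisson_density z \<eta> / (2 * pi)
            * cmod (g (\<xi> * \<eta>) - g (\<sigma> * \<eta>)) powr p) \<partial>circ)"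
      by (rule nn_integral_cmult[symmetric]) measurable
    also have "\<dots> = R \<sigma> \<xi>"
      unfolding R_def
    proof (rule nn_integral_cong_AE, use AE_circ_norm in eventually_elim, goal_cases)
      case (1 \<eta>)
      have "cmod (\<xi> * \<eta> - \<sigma> * \<eta>) = cmod (\<xi> - \<sigma>)"
        using 1 by (metis left_diff_distrib norm_mult mult.right_neutral)
      then show ?case
        using z by (simp add: c_def gagliardo_kernel_def ennreal_mult[symmetric] poisson_density_nonneg)
    qed
    also have "ennreal ?d * ennreal (cmod (poisson_integral g (z * \<xi>) - poisson_integral g (z
        * \<sigma>)) powr p)
      = gagliardo_kernel s p (\<lambda>\<xi>. poisson_integral g (z * \<xi>)) \<sigma> \<xi>"
      by (simp add: gagliardo_kernel_def ennreal_mult[symmetric])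
    finally show ?thesis .
  qed
  have "gagliardo_energy s p (\<lambda>\<xi>. poisson_integral g (z * \<xi>))
      \<le> (\<integral>\<^sup>+\<sigma>. (\<integral>\<^sup>+\<xi>. R \<sigma> \<xi> \<partial>circ) \<partial>circ)"
    by (rule gagliardo_energy_le_circ) (use le in auto)
  \<comment> \<open>The integral over \<eta> is moved outermost in two exchanges, past \<xi> and
    then past \<sigma>.\<close>
  also have "\<dots> = (\<integral>\<^sup>+\<sigma>. (\<integral>\<^sup>+\<eta>. (\<integral>\<^sup>+\<xi>. c \<eta> * gagliardo_kernel s p g (\<sigma> * \<eta>) (\<xi> * \<eta>) \<partial>circ) \<partial>circ) \<partial>circ)"
    unfolding R_def by (intro nn_integral_cong circ2.Fubini') measurable
  also have "\<dots> = (\<integral>\<^sup>+\<eta>. (\<integral>\<^sup>+\<sigma>. (\<integral>\<^sup>+\<xi>. c \<eta> * gagliardo_kernel s p g (\<sigma> * \<eta>) (\<xi> * \<eta>) \<partial>circ) \<partial>circ) \<partial>circ)"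
    by (intro circ2.Fubini') measurable
  also have "\<dots> = (\<integral>\<^sup>+\<eta>. c \<eta> * gagliardo_energy s p g \<partial>circ)"
  proof (rule nn_integral_cong_AE, use AE_circ_norm in eventually_elim, goal_cases)
    case (1 \<eta>)
    have "(\<integral>\<^sup>+\<xi>. c \<eta>
        * gagliardo_kernel s p g (\<sigma> * \<eta>) (\<xi> * \<eta>) \<partial>circ)
            = c \<eta> * gagliardo_at s p g (\<eta> * \<sigma>)" for \<sigma>
    proof -
      have "(\<integral>\<^sup>+\<xi>. c \<eta>
          * gagliardo_kernel s p g (\<sigma> * \<eta>) (\<xi> * \<eta>) \<partial>circ)
              = c \<eta> * (\<integral>\<^sup>+\<xi>. gagliardo_kernel s p g (\<sigma> * \<eta>) (\<xi>
                  * \<eta>) \<partial>circ)"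
        by (rule nn_integral_cmult) measurable
      also have "(\<integral>\<^sup>+\<xi>. gagliardo_kernel s p g (\<sigma> * \<eta>) (\<xi>
          * \<eta>) \<partial>circ) = gagliardo_at s p g (\<sigma> * \<eta>)"
        unfolding gagliardo_at_def
            using nn_integral_circ_rotate[of "gagliardo_kernel s p g (\<sigma> * \<eta>)" \<eta>] 1
        by (simp add: mult.commute[of _ \<eta>])
      finally show ?thesis by (simp add: mult.commute)
    qed
    then have "(\<integral>\<^sup>+\<sigma>. (\<integral>\<^sup>+\<xi>. c \<eta>
        * gagliardo_kernel s p g (\<sigma> * \<eta>) (\<xi> * \<eta>) \<partial>circ) \<partial>circ)
            = c \<eta> * (\<integral>\<^sup>+\<sigma>. gagliardo_at s p g (\<eta>
                * \<sigma>) \<partial>circ)"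
      by (simp add: nn_integral_cmult)
    also have "(\<integral>\<^sup>+\<sigma>. gagliardo_at s p g (\<eta> * \<sigma>) \<partial>circ)
        = gagliardo_energy s p g"
      using nn_integral_circ_rotate[of "gagliardo_at s p g" \<eta>] 1 by (simp add: gagliardo_energy_circ)
    finally show ?case .
  qed
  also have "\<dots> = gagliardo_energy s p g"
    using nn_integral_poisson_density_2pi[OF z] by (simp add: nn_integral_multc c_def)
  finally show ?thesis .
qed

text \<open>
  \<open>A\<close> bounds the integral of the Jensen weight \<open>P |y - \<sigma>|\<^sup>a\<close>, the two summands coming from the
  parts \<open>|y - \<sigma>| \<le> \<delta>\<close> and \<open>|y - \<sigma>| > \<delta>\<close> of the circle. The exponent \<open>a\<close> is chosen such that
  \<open>a (p - 1) = s p\<close>.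
\<close>

lemma poisson_approx_bound:
  fixes r s p \<delta> :: real
  assumes p: "1 < p" and s: "0 < s" and r: "0 < r" "r < 1" and \<delta>: "0 < \<delta>"
    and \<sigma>: "cmod \<sigma> = 1" and g: "integrable circ g"
    and A: "A = 2 * pi * (\<delta> powr (s * p / (p - 1)) + 8 * (1 - r)
        * 2 powr (s * p / (p - 1)) / \<delta>\<^sup>2)"
  shows "ennreal (cmod (poisson_integral g (of_real r * \<sigma>) - g \<sigma>) powr p)
      \<le> ennreal (4 * A powr (p - 1)) * gagliardo_at s p g \<sigma>"
proof -
  have [measurable]: "g \<in> borel_measurable borel" using g by auto
  define a where "a = s * p / (p - 1)"
  have a: "0 < a" "a * (p - 1) = s * p" using p s by (auto simp: a_def)
  define z where "z = of_real r * \<sigma>"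
  have z: "cmod z < 1" "cmod z = r" using r \<sigma> by (auto simp: z_def norm_mult)
  have zs: "cmod (z - \<sigma>) = 1 - r"
  proof -
    have "z - \<sigma> = of_real (r - 1) * \<sigma>" by (simp add: z_def algebra_simps)
    then show ?thesis using r \<sigma> by (simp only: norm_mult norm_of_real) simp
  qed
  have d1: "1 - r \<le> cmod (y - z)" if "cmod y = 1" for y
    using norm_triangle_ineq2[of y z] that z by simp
  have d2: "cmod (y - \<sigma>) \<le> 2 * cmod (y - z)" if "cmod y = 1" for y
    using norm_triangle_ineq[of "y - z" "z - \<sigma>"] d1[OF that] zs by simp
  \<comment> \<open>With D = |y - z|, both 1 - r^2 <= 2 (1 - r) <= 2 D and |y - \<sigma>| <= D + (1
    - r) <= 2 D; the product is at most 4 D^2.\<close>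
  have poisson_density_le1: "poisson_density z y \<le> 4 / cmod (y - \<sigma>)"
      if "cmod y = 1" "y \<noteq> \<sigma>" for y
  proof -
    let ?D = "cmod (y - z)"
    have D: "0 < ?D" using d1[OF that(1)] r by linarith
    have "(1 - r\<^sup>2) * cmod (y - \<sigma>) \<le> (2 * ?D) * (2 * ?D)"
    proof (rule mult_mono)
      have "1 - r\<^sup>2 \<le> 2 * (1 - r)"
        using zero_le_power2[of "1 - r"] by (simp add: power2_eq_square algebra_simps)
      then show "1 - r\<^sup>2 \<le> 2 * ?D" using d1[OF that(1)] by simp
    qed (use d2[OF that(1)] in auto)
    then have "(1 - r\<^sup>2) * cmod (y - \<sigma>) \<le> 4 * ?D\<^sup>2" by (simp add: power2_eq_square)
    moreover have "0 < ?D\<^sup>2" "0 < cmod (y - \<sigma>)" using D that by auto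
    ultimately show ?thesis
      unfolding poisson_density_def z(2)
          by (simp only: pos_divide_le_eq pos_le_divide_eq times_divide_eq_left)
  qed
  \<comment> \<open>Away from \<sigma> the denominator is at least \<delta>^2 / 4 and the numerator
    at most 2 (1 - r).\<close>
  have poisson_density_le2: "poisson_density z y \<le> 8 * (1 - r) / \<delta>\<^sup>2"
      if "cmod y = 1" "\<delta> \<le> cmod (y - \<sigma>)" for y
  proof -
    let ?D = "cmod (y - z)"
    have D: "0 < ?D" using d1[OF that(1)] r by linarith
    have "\<delta>\<^sup>2 \<le> (2 * ?D)\<^sup>2" using d2[OF that(1)] that \<delta>
        by (intro power_mono) auto
    moreover have "1 - r\<^sup>2 \<le> 2 * (1 - r)"
      using zero_le_power2[of "1 - r"] by (simp add: power2_eq_square algebra_simps)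
    ultimately have "(1 - r\<^sup>2) * \<delta>\<^sup>2 \<le> (2 * (1 - r)) * (2 * ?D)\<^sup>2"
      using r by (intro mult_mono) auto
    then have "(1 - r\<^sup>2) * \<delta>\<^sup>2 \<le> 8 * (1 - r) * ?D\<^sup>2"
        by (simp add: power_mult_distrib algebra_simps)
    moreover have "0 < ?D\<^sup>2" "0 < \<delta>\<^sup>2" using D \<delta> by auto
    ultimately show ?thesis
      unfolding poisson_density_def z(2)
          by (simp only: pos_divide_le_eq pos_le_divide_eq times_divide_eq_left)
  qed
  define w where "w y = poisson_density z y * cmod (y - \<sigma>) powr a" for y
  have w0: "0 \<le> w y" for y using poisson_density_nonneg[OF z(1)] by (simp add: w_def)
  have [measurable]: "w \<in> borel_measurable borel" unfolding w_def by measurable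
  \<comment> \<open>\<open>F\<close> divides by the power that \<open>w\<close> carries, so w F = P
    (g - g \<sigma>); at y = \<sigma> both sides are 0 because division by 0 gives 0.\<close>
  define F where "F y = (g y - g \<sigma>) / of_real (cmod (y - \<sigma>) powr a)" for y
  have [measurable]: "F \<in> borel_measurable borel" unfolding F_def by measurable
  let ?B = "8 * (1 - r) * 2 powr a / \<delta>\<^sup>2"
  have A': "A = 2 * pi * (\<delta> powr a + ?B)" by (simp add: A a_def)
  have B0: "0 \<le> ?B" using r by simp
  have Apos: "0 < A" unfolding A' using \<delta> B0 by (intro mult_pos_pos add_pos_nonneg) auto
  have wA: "(\<integral>\<^sup>+y. ennreal (w y) \<partial>circ) \<le> ennreal A"
  proof -
    have "(\<integral>\<^sup>+y. ennreal (w y) \<partial>circ)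
        \<le> (\<integral>\<^sup>+y. ennreal (\<delta> powr a) * ennreal (poisson_density z y)
            + ennreal ?B \<partial>circ)"
    proof (rule nn_integral_mono_AE, use AE_circ_norm in eventually_elim, goal_cases)
      case (1 y)
      have "w y \<le> \<delta> powr a * poisson_density z y + ?B"
      proof (cases "cmod (y - \<sigma>) \<le> \<delta>")
        case True
        then have "cmod (y - \<sigma>) powr a \<le> \<delta> powr a" using a by (intro powr_mono2) auto
        then have "w y \<le> \<delta> powr a * poisson_density z y"
          unfolding w_def using poisson_density_nonneg[OF z(1), of y]
              by (subst mult.commute) (intro mult_right_mono)
        then show ?thesis using B0 by linarith
      next
        case False
        have "cmod (y - \<sigma>) \<le> 2" using norm_triangle_ineq4[of y \<sigma>] 1 \<sigma> by simp
        then have "cmod (y - \<sigma>) powr a \<le> 2 powr a" using a by (intro powr_mono2) auto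
        then have "w y \<le> 8 * (1 - r) / \<delta>\<^sup>2 * 2 powr a"
          unfolding w_def using poisson_density_nonneg[OF z(1), of y] poisson_density_le2[OF 1] False r
              by (intro mult_mono) auto
        moreover have "0 \<le> \<delta> powr a * poisson_density z y"
            using poisson_density_nonneg[OF z(1), of y] by simp
        ultimately show ?thesis by simp
      qed
      then have "ennreal (w y) \<le> ennreal (\<delta> powr a * poisson_density z y + ?B)"
          by (rule ennreal_leI)
      also have "\<dots> = ennreal (\<delta> powr a) * ennreal (poisson_density z y) + ennreal ?B"
        using poisson_density_nonneg[OF z(1), of y] B0 by (subst ennreal_plus) (auto simp: ennreal_mult)
      finally show ?case .
    qed
    also have "\<dots> = ennreal (\<delta> powr a) * ennreal (2 * pi) + ennreal ?B * ennreal (2 * pi)"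
      by (subst nn_integral_add)
          (auto simp: nn_integral_cmult nn_integral_poisson_density[OF z(1)] emeasure_circ)
    also have "\<dots> = ennreal A"
      using B0 unfolding A' by (subst ennreal_lincomb) (auto simp: algebra_simps)
    finally show ?thesis .
  qed
  have wF: "of_real (w y) * F y = of_real (poisson_density z y) * (g y - g \<sigma>)" for y
    by (cases "y = \<sigma>") (auto simp: w_def F_def)
  have "ennreal (cmod (LINT y|circ. of_real (w y) * F y) powr p)
      \<le> ennreal (A powr (p - 1))
          * (\<integral>\<^sup>+y. ennreal (w y * cmod (F y) powr p) \<partial>circ)"
    using p w0 Apos wA by (intro jensen_powr) auto
  also have "(\<integral>\<^sup>+y. ennreal (w y * cmod (F y) powr p) \<partial>circ)
      \<le> (\<integral>\<^sup>+y. ennreal 4 * gagliardo_kernel s p g \<sigma> y \<partial>circ)"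
  proof (rule nn_integral_mono_AE, use AE_circ_norm in eventually_elim, goal_cases)
    case (1 y)
    have "w y * cmod (F y) powr p
        \<le> 4 * (cmod (g y - g \<sigma>) powr p / cmod (y - \<sigma>) powr (1 + s * p))"
    proof (cases "y = \<sigma>")
      case False
      let ?d = "cmod (y - \<sigma>)"
      have d: "0 < ?d" using False by simp
      \<comment> \<open>The weight contributes d^a and the p-th power of F contributes d^(-a p),
        together d^(-s p). The bound 4 / d on the kernel then supplies the missing exponent
        1.\<close>
      have e: "?d powr a / (?d powr a) powr p = 1 / ?d powr (s * p)"
      proof -
        have "?d powr a / (?d powr a) powr p = ?d powr (a - a * p)"
          using d by (simp add: powr_powr powr_diff)
        also have "a - a * p = - (s * p)" using a(2) by (simp add: algebra_simps)
        finally show ?thesis by (simp add: powr_minus_divide)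
      qed
      have "w y * cmod (F y) powr p
          = poisson_density z y * cmod (g y - g \<sigma>) powr p * (?d powr a / (?d powr a) powr p)"
        by (simp add: w_def F_def norm_divide powr_divide)
      also have "\<dots> \<le> 4 / ?d * cmod (g y - g \<sigma>) powr p * (?d powr a / (?d powr a) powr p)"
        using poisson_density_le1[OF 1 False] by (intro mult_right_mono) auto
      also have "\<dots> = 4 * (cmod (g y - g \<sigma>) powr p / (?d powr 1 * ?d powr (s * p)))"
        unfolding e using d by simp
      finally show ?thesis by (simp only: powr_add)
    qed (simp add: F_def)
    then show ?case unfolding gagliardo_kernel_def
      by (subst ennreal_mult[symmetric]) (auto intro: ennreal_leI)
  qed
  also have "\<dots> = ennreal 4 * gagliardo_at s p g \<sigma>"
    unfolding gagliardo_at_def by (rule nn_integral_cmult) measurable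
  finally have 1: "ennreal (cmod (LINT y|circ. of_real (poisson_density z y) * (g y - g \<sigma>)) powr p)
     \<le> ennreal (4 * A powr (p - 1)) * gagliardo_at s p g \<sigma>"
    unfolding wF by (simp add: mult_left_mono ennreal_mult mult.assoc mult.left_commute)
  have "poisson_integral g z - g \<sigma>
      = (LINT y|circ. of_real (poisson_density z y) * (g y - g \<sigma>)) / of_real (2 * pi)"
    using poisson_integral_diff_const[OF z(1) g, of "g \<sigma>"] by (simp add: poisson_integral_def)
  then have "cmod (poisson_integral g z - g \<sigma>)
      = cmod (LINT y|circ. of_real (poisson_density z y) * (g y - g \<sigma>)) / (2 * pi)"
    by (simp add: norm_divide norm_mult)
  also have "\<dots> \<le> cmod (LINT y|circ. of_real (poisson_density z y) * (g y - g \<sigma>)) / 1"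
    using pi_ge_two by (intro divide_left_mono) auto
  finally have "cmod (poisson_integral g z - g \<sigma>) powr p
      \<le> cmod (LINT y|circ. of_real (poisson_density z y) * (g y - g \<sigma>)) powr p"
    using p by (intro powr_mono2) auto
  with 1 show ?thesis unfolding z_def by (meson ennreal_leI order_trans)
qed

text \<open>\<open>R\<close> is chosen before g and \<sigma>: this uniformity allows one radius to
  serve all dilates of an analytic function at once.\<close>

lemma poisson_approx:
  fixes s p e :: real
  assumes p: "1 < p" and s: "0 < s" and e: "0 < e"
  obtains R where "0 < R" "R < 1"
    "\<And>r g \<sigma>. \<lbrakk>R \<le> r; r < 1; integrable circ g; cmod \<sigma>
        = 1\<rbrakk> \<Longrightarrow>
       ennreal (cmod (poisson_integral g (of_real r * \<sigma>) - g \<sigma>) powr p)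
           \<le> ennreal e * gagliardo_at s p g \<sigma>"
proof -
  define a where "a = s * p / (p - 1)"
  have a: "0 < a" using p s by (simp add: a_def)
  \<comment> \<open>\<open>A0\<close> is the largest admissible mass, 4 A0^(p-1) = e. Next \<delta>
    makes the near part 2 pi \<delta>^a equal to A0 / 2, and R makes the far part at most A0 / 2;
    the maximum with 1/2 keeps R positive.\<close>
  define A0 where "A0 = (e / 4) powr (1 / (p - 1))"
  have A0: "0 < A0" "4 * A0 powr (p - 1) = e" using e p by (auto simp: A0_def powr_powr)
  define \<delta> where "\<delta> = (A0 / (4 * pi)) powr (1 / a)"
  have \<delta>: "0 < \<delta>" "\<delta> powr a = A0 / (4 * pi)" using A0 a
      by (auto simp: \<delta>_def powr_powr)
  define R where "R = max (1 / 2) (1 - A0 * \<delta>\<^sup>2 / (4 * pi * 8 * 2 powr a))"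
  have R: "0 < R" "R < 1" using A0 \<delta> by (auto simp: R_def)
  show ?thesis
  proof (rule that[OF R])
    fix r :: real and g :: "complex \<Rightarrow> complex" and \<sigma> assume r: "R \<le> r" "r < 1"
        and g: "integrable circ g" and \<sigma>: "cmod \<sigma> = (1::real)"
    define A where "A = 2 * pi * (\<delta> powr a + 8 * (1 - r) * 2 powr a / \<delta>\<^sup>2)"
    have "1 - r \<le> A0 * \<delta>\<^sup>2 / (4 * pi * 8 * 2 powr a)" using r by (auto simp: R_def)
    then have "8 * (1 - r) * 2 powr a / \<delta>\<^sup>2
        \<le> 8 * (A0 * \<delta>\<^sup>2 / (4 * pi * 8 * 2 powr a)) * 2 powr a / \<delta>\<^sup>2"
      by (intro divide_right_mono mult_right_mono mult_left_mono) auto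
    also have "\<dots> = A0 / (4 * pi)" using \<delta> by simp
    finally have "A \<le> 2 * pi * (A0 / (4 * pi) + A0 / (4 * pi))"
      unfolding A_def \<delta>(2) by (intro mult_left_mono add_left_mono) auto
    then have "A \<le> A0" by simp
    moreover have "0 \<le> A" unfolding A_def using r \<delta> A0
        by (intro mult_nonneg_nonneg add_nonneg_nonneg divide_nonneg_nonneg) auto
    ultimately have "4 * A powr (p - 1) \<le> e"
      unfolding A0(2)[symmetric] using p by (intro mult_left_mono powr_mono2) auto
    have "ennreal (cmod (poisson_integral g (of_real r * \<sigma>) - g \<sigma>) powr p)
        \<le> ennreal (4 * A powr (p - 1)) * gagliardo_at s p g \<sigma>"
      using R r by (intro poisson_approx_bound[OF p s _ _ \<delta>(1) \<sigma> g]) (auto simp: A_def a_def)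
    also have "\<dots> \<le> ennreal e * gagliardo_at s p g \<sigma>"
      using \<open>4 * A powr (p - 1) \<le> e\<close> by (intro mult_right_mono ennreal_leI) auto
    finally show "ennreal (cmod (poisson_integral g (of_real r * \<sigma>) - g \<sigma>) powr p)
        \<le> ennreal e * gagliardo_at s p g \<sigma>" .
  qed
qed

section \<open>Radial limits\<close>

definition gagliardo_sup :: "real \<Rightarrow> real \<Rightarrow> (complex \<Rightarrow> complex) \<Rightarrow> real" where
  "gagliardo_sup s p u = (SUP r\<in>{0<..<1}. gagliardo s p (dilate r u))"

lemma gagliardo_nonneg: "0 \<le> gagliardo s p f"
  by (simp add: gagliardo_def)

lemma gagliardo_powr:
  assumes "0 < p" "gagliardo_energy s p f < \<infinity>"
  shows "ennreal (gagliardo s p f powr p) = gagliardo_energy s p f"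
  using assms by (simp add: gagliardo_def powr_powr ennreal_enn2real_if)

lemma gagliardo_le_gagliardo_sup:
  assumes "u \<in> disc_functions s p" "0 < r" "r < 1"
  shows "gagliardo s p (dilate r u) \<le> gagliardo_sup s p u"
  unfolding gagliardo_sup_def using assms by (intro cSUP_upper) (auto simp: disc_functions_def)

lemma gagliardo_sup_nonneg:
  assumes "u \<in> disc_functions s p"
  shows "0 \<le> gagliardo_sup s p u"
  using gagliardo_le_gagliardo_sup[OF assms, of "1/2"] gagliardo_nonneg[of s p "dilate (1/2) u"] by simp

lemma gagliardo_energy_dilate_le:
  assumes "0 < p" "u \<in> disc_functions s p" "0 < r" "r < 1"
  shows "gagliardo_energy s p (dilate r u) \<le> ennreal (gagliardo_sup s p u powr p)"
proof -
  have "gagliardo_energy s p (dilate r u) < \<infinity>" using assms by (auto simp: disc_functions_def)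
  then have "gagliardo_energy s p (dilate r u) = ennreal (gagliardo s p (dilate r u) powr p)"
    using gagliardo_powr assms(1) by metis
  also have "\<dots> \<le> ennreal (gagliardo_sup s p u powr p)"
    using assms gagliardo_nonneg gagliardo_le_gagliardo_sup by (intro ennreal_leI powr_mono2) auto
  finally show ?thesis .
qed

lemma borel_measurable_disc:
  assumes "u holomorphic_on ball 0 1" "\<And>z. z \<notin> ball 0 1 \<Longrightarrow> u z = 0"
  shows "u \<in> borel_measurable borel"
proof -
  have "(\<lambda>z. if z \<in> ball 0 1 then u z else 0) \<in> borel_measurable borel"
    using assms(1) by (intro borel_measurable_continuous_on_if holomorphic_on_imp_continuous_on) auto
  also have "(\<lambda>z. if z \<in> ball 0 1 then u z else 0) = u" using assms(2) by auto
  finally show ?thesis .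
qed

lemma integrable_circ_bounded1:
  fixes g :: "complex \<Rightarrow> complex"
  assumes "g \<in> borel_measurable borel" "\<And>y. cmod y = 1 \<Longrightarrow> cmod (g y) \<le> C"
  shows "integrable circ g"
  using integrable_circ_bounded[of "\<lambda>_. 1" g C] assms by simp

section \<open>Dilates of an analytic function: bounds, Fourier coefficients, Poisson
  formula\<close>

context
  fixes u :: "complex \<Rightarrow> complex"
  assumes hol: "u holomorphic_on ball 0 1"
      and zero: "\<And>z. z \<notin> ball 0 1 \<Longrightarrow> u z = 0"
begin

lemma measurable_dilate: "dilate r u \<in> borel_measurable borel"
  using measurable_compose[OF _ borel_measurable_disc[OF hol zero], of "\<lambda>z. of_real r * z"]
  by (simp add: dilate_def)

lemma dilate_bounded:
  assumes "0 < r" "r < 1"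
  obtains C where "\<And>y. cmod y = 1 \<Longrightarrow> cmod (dilate r u y) \<le> C"
proof -
  have "continuous_on (cball 0 r) u"
    using hol assms by (intro holomorphic_on_imp_continuous_on) (auto elim!: holomorphic_on_subset)
  then have "compact (u ` cball 0 r)" by (intro compact_continuous_image) auto
  then obtain C where C: "\<forall>x\<in>u ` cball 0 r. cmod x \<le> C"
    using compact_imp_bounded bounded_iff by metis
  show ?thesis
    by (rule that[of C]) (use C assms in \<open>auto simp: dilate_def norm_mult\<close>)
qed

lemma integrable_dilate:
  assumes "0 < r" "r < 1"
  shows "integrable circ (dilate r u)"
  using dilate_bounded[OF assms] integrable_circ_bounded1[OF measurable_dilate] by metis

lemma Lp_energy_dilate:
  assumes "0 < r" "r < 1" "0 < p"
  shows "Lp_energy p (dilate r u) < \<infinity>"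
proof -
  note [measurable] = measurable_dilate
  obtain C where C: "\<And>y. cmod y = 1 \<Longrightarrow> cmod (dilate r u y) \<le> C"
    using dilate_bounded[OF assms(1,2)] by metis
  have "Lp_energy p (dilate r u) \<le> (\<integral>\<^sup>+y. ennreal (C powr p) \<partial>circ)"
    unfolding Lp_energy_circ[OF measurable_dilate]
    by (rule nn_integral_mono_AE, use AE_circ_norm in eventually_elim)
       (use C assms in \<open>auto intro!: ennreal_leI powr_mono2\<close>)
  also have "\<dots> < \<infinity>" by (simp add: emeasure_circ ennreal_mult_less_top)
  finally show ?thesis .
qed

text \<open>Term-by-term integration of the Taylor series on the circle of radius r, against m = y^k
  or m = cnj y^k; the majorant is the absolutely convergent series at r.\<close>

lemma dilate_integral_sums:
  fixes m :: "complex \<Rightarrow> complex"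
  assumes r: "0 < r" "r < 1" and [measurable]: "m \<in> borel_measurable borel"
    and m: "\<And>y. cmod y = 1 \<Longrightarrow> cmod (m y) \<le> 1"
  shows "(\<lambda>j. (deriv ^^ j) u 0 / fact j * of_real r ^ j * (LINT y|circ. m y * y ^ j))
    sums (LINT y|circ. m y * dilate r u y)"
proof -
  define c where "c j = (deriv ^^ j) u 0 / fact j" for j
  have c: "(\<lambda>j. c j * w ^ j) sums u w" if "cmod w < 1" for w
    using holomorphic_power_series[OF hol, of w] that by (simp add: c_def)
  \<comment> \<open>Convergence at an intermediate radius t > r gives absolute convergence at
    r.\<close>
  define t where "t = (1 + r) / 2"
  have t: "r < t" "t < 1" using r by (auto simp: t_def)
  have "summable (\<lambda>j. c j * of_real t ^ j)" using c[of "of_real t"] t r by (auto simp: sums_iff)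
  then have sm: "summable (\<lambda>j. norm (c j * of_real r ^ j))"
    by (rule powser_insidea) (use t r in auto)
  note [measurable] = measurable_dilate
  let ?f = "\<lambda>j y. c j * of_real r ^ j * (m y * y ^ j)"
  have le: "norm (?f j y) \<le> norm (c j * of_real r ^ j)" if "cmod y = 1" for j y
    using m[OF that] that by (simp add: norm_mult norm_power mult_left_le)
  have int: "integrable circ (?f j)" for j
    by (rule integrable_circ_bounded1[OF _ le]) measurable
  have "(\<lambda>j. LINT y|circ. ?f j y) sums (LINT y|circ. (\<Sum>j. ?f j y))"
  proof (rule sums_integral)
    show "AE y in circ. summable (\<lambda>j. norm (?f j y))"
      using AE_circ_norm
    proof eventually_elim
      case (elim y)
      show ?case
      proof (rule summable_comparison_test'[OF sm, of 0])
        show "norm (norm (?f j y)) \<le> norm (c j * of_real r ^ j)" for j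
          using le[OF elim, of j] by (simp only: real_norm_def abs_norm_cancel)
      qed
    qed
    show "summable (\<lambda>j. LINT y|circ. norm (?f j y))"
    proof (rule summable_comparison_test'[of "\<lambda>j. norm (c j * of_real r ^ j) * (2 * pi)" 0])
      show "summable (\<lambda>j. norm (c j * of_real r ^ j) * (2 * pi))"
        using sm by (rule summable_mult2)
      fix j :: nat
      have "(LINT y|circ. norm (?f j y)) \<le> (LINT y|circ. norm (c j * of_real r ^ j))"
      proof (rule integral_mono_AE)
        show "AE y in circ. norm (?f j y) \<le> norm (c j * of_real r ^ j)"
          using AE_circ_norm by eventually_elim (rule le)
        show "integrable circ (\<lambda>y. norm (?f j y))" using int by (rule integrable_norm)
      qed simp
      also have "\<dots> = norm (c j * of_real r ^ j) * (2 * pi)" by (simp add: measure_circ)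
      finally show "norm (LINT y|circ. norm (?f j y)) \<le> norm (c j * of_real r ^ j) * (2 * pi)"
        by simp
    qed
  qed (rule int)
  moreover have "(LINT y|circ. (\<Sum>j. ?f j y)) = (LINT y|circ. m y * dilate r u y)"
  proof (rule integral_circ_cong)
    fix y :: complex assume "cmod y = 1"
    then have "(\<lambda>j. m y * (c j * (of_real r * y) ^ j)) sums (m y * dilate r u y)"
      unfolding dilate_def using r by (intro sums_mult c) (simp add: norm_mult)
    moreover have "m y * (c j * (of_real r * y) ^ j) = ?f j y" for j
      by (simp add: power_mult_distrib)
    ultimately show "(\<Sum>j. ?f j y) = m y * dilate r u y" by (simp add: sums_iff)
  qed measurable
  moreover have "(LINT y|circ. ?f j y) = c j * of_real r ^ j * (LINT y|circ. m y * y ^ j)" for j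
    by simp
  ultimately show ?thesis unfolding c_def by simp
qed

lemma dilate_fourier_neg:
  assumes "0 < r" "r < 1" "0 < k"
  shows "(LINT y|circ. y ^ k * dilate r u y) = 0"
proof -
  have "(\<lambda>j. (deriv ^^ j) u 0 / fact j * of_real r ^ j * (LINT y|circ. y ^ k * y ^ j))
    sums (LINT y|circ. y ^ k * dilate r u y)"
    by (rule dilate_integral_sums) (use assms in \<open>auto simp: norm_power\<close>)
  moreover have "(LINT y|circ. y ^ k * y ^ j) = 0" for j
    using integral_circ_power(1)[of "k + j"] assms by (simp add: power_add)
  ultimately show ?thesis by (simp add: sums_iff)
qed

lemma dilate_fourier_pos:
  assumes "0 < r" "r < 1"
  shows "(LINT y|circ. cnj y ^ k * dilate r u y)
      = of_real (2 * pi) * ((deriv ^^ k) u 0 / fact k * of_real r ^ k)"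
proof -
  have "(\<lambda>j. (deriv ^^ j) u 0 / fact j * of_real r ^ j * (LINT y|circ. cnj y ^ k * y ^ j))
    sums (LINT y|circ. cnj y ^ k * dilate r u y)"
    by (rule dilate_integral_sums) (use assms in \<open>auto simp: norm_power\<close>)
  moreover have "(LINT y|circ. cnj y ^ k * y ^ j) = (if j = k then of_real (2 * pi) else 0)" for j
  proof -
    have 1: "cnj y ^ n * y ^ n = 1" if "cmod y = 1" for y n
    proof -
      have "cnj y * y = 1"
        using that complex_norm_square[of y] by (simp add: mult.commute)
      then show ?thesis unfolding power_mult_distrib[symmetric] by simp
    qed
    consider "j = k" | "j < k" | "k < j" by linarith
    then show ?thesis
    proof cases
      case eq: 1
      have "(LINT y|circ. cnj y ^ k * y ^ j) = (LINT y|circ. 1)"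
        by (rule integral_circ_cong) (use eq 1 in auto)
      then show ?thesis using eq by (simp add: measure_circ scaleR_conv_of_real)
    next
      case 2
      have "cnj y ^ k * y ^ j = cnj y ^ (k - j)" if "cmod y = 1" for y
      proof -
        have "cnj y ^ k = cnj y ^ (k - j) * cnj y ^ j" using 2 by (simp add: power_add[symmetric])
        then show ?thesis using 1[OF that, of j] by (simp add: mult.assoc)
      qed
      then have "(LINT y|circ. cnj y ^ k * y ^ j) = (LINT y|circ. cnj y ^ (k - j))"
        by (intro integral_circ_cong) auto
      then show ?thesis using 2 integral_circ_power(2)[of "k - j"] by simp
    next
      case 3
      have "cnj y ^ k * y ^ j = y ^ (j - k)" if "cmod y = 1" for y
      proof -
        have "y ^ j = y ^ k * y ^ (j - k)" using 3 by (simp add: power_add[symmetric])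
        then show ?thesis using 1[OF that, of k] by (simp add: mult.assoc[symmetric])
      qed
      then have "(LINT y|circ. cnj y ^ k * y ^ j) = (LINT y|circ. y ^ (j - k))"
        by (intro integral_circ_cong) auto
      then show ?thesis using 3 integral_circ_power(1)[of "j - k"] by simp
    qed
  qed
  ultimately have s1: "(\<lambda>j. if j
      = k then (deriv ^^ j) u 0 / fact j * of_real r ^ j * of_real (2 * pi) else 0)
      sums (LINT y|circ. cnj y ^ k * dilate r u y)"
    by (simp only: if_distrib[of "\<lambda>x. _ * x"] mult_zero_right)
  have s2: "(\<lambda>j. if j = k then (deriv ^^ j) u 0 / fact j * of_real r ^ j * of_real (2 * pi) else 0)
      sums ((deriv ^^ k) u 0 / fact k * of_real r ^ k * of_real (2 * pi))"
    by (rule sums_single)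
  show ?thesis unfolding sums_unique2[OF s1 s2] by (rule mult.commute)
qed

text \<open>Comparison of power series in z: the coefficients of P[u_r] are the Fourier coefficients
  of the dilate, and these are the Taylor coefficients of u times r^k.\<close>

lemma poisson_integral_dilate:
  assumes r: "0 < r" "r < 1" and z: "cmod z < 1"
  shows "poisson_integral (dilate r u) z = u (of_real r * z)"
proof -
  have "(\<lambda>k. (LINT y|circ. cnj y ^ k * dilate r u y) / of_real (2 * pi) * z ^ k)
      sums poisson_integral (dilate r u) z"
    using z integrable_dilate[OF r] dilate_fourier_neg[OF r] by (rule poisson_integral_sums)
  moreover have "(LINT y|circ. cnj y ^ k * dilate r u y) / of_real (2 * pi) * z ^ k
      = (deriv ^^ k) u 0 / fact k * (of_real r * z - 0) ^ k" for k
    unfolding dilate_fourier_pos[OF r] by (simp add: power_mult_distrib)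
  moreover have "(\<lambda>k. (deriv ^^ k) u 0 / fact k * (of_real r * z - 0) ^ k) sums u (of_real r * z)"
  proof (rule holomorphic_power_series[OF hol])
    have "r * cmod z < 1" using r z
        by (meson mult_left_le_one_le norm_ge_zero less_imp_le order_le_less_trans)
    then show "of_real r * z \<in> ball 0 1" using r by (simp add: norm_mult)
  qed
  ultimately show ?thesis using sums_unique2 by simp
qed

end

text \<open>Fatou's lemma and measurability of limits need a sequence of radii; the shift by 2 keeps
  all of them strictly between 0 and 1.\<close>

definition radii :: "nat \<Rightarrow> real" where
  "radii n = 1 - 1 / (real n + 2)"

lemma radii: "0 < radii n" "radii n < 1"
  by (auto simp: radii_def field_simps)

lemma radii_tendsto: "radii \<longlonglongrightarrow> 1"
proof -
  have "(\<lambda>n. 1 - inverse (real (Suc (Suc n)))) \<longlonglongrightarrow> 1 - 0"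
    by (intro tendsto_intros LIMSEQ_Suc[OF LIMSEQ_inverse_real_of_nat])
  moreover have "radii = (\<lambda>n. 1 - inverse (real (Suc (Suc n))))"
    by (simp add: fun_eq_iff radii_def inverse_eq_divide add.commute)
  ultimately have "radii \<longlonglongrightarrow> 1 - 0" by (simp only:)
  then show ?thesis by simp
qed

lemma radii_at_left: "filterlim radii (at_left 1) sequentially"
  using radii_tendsto radii(2) by (auto simp: filterlim_at less_imp_neq)

lemma tendsto_at_left_CauchyI:
  fixes f :: "real \<Rightarrow> 'a::complete_space"
  assumes "\<And>e. 0 < e \<Longrightarrow> \<exists>R<1. \<forall>t t'. R \<le> t \<and> t < 1 \<and> R
      \<le> t' \<and> t' < 1 \<longrightarrow> dist (f t) (f t') < e"
  shows "\<exists>l. (f \<longlongrightarrow> l) (at_left 1)"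
proof -
  have "Cauchy (\<lambda>n. f (radii n))"
  proof (rule metric_CauchyI)
    fix e :: real assume "0 < e"
    then obtain R where R: "R < 1" "\<And>t t'. R \<le> t \<and> t < 1 \<and> R \<le> t' \<and> t'
        < 1 \<Longrightarrow> dist (f t) (f t') < e"
      using assms by metis
    have "\<forall>\<^sub>F n in sequentially. R < radii n" using order_tendstoD(1)[OF radii_tendsto R(1)] .
    then obtain N where "\<And>n. N \<le> n \<Longrightarrow> R < radii n"
        by (auto simp: eventually_sequentially)
    then show "\<exists>M. \<forall>m\<ge>M. \<forall>n\<ge>M. dist (f (radii m)) (f (radii n)) < e"
      using R(2) radii(2) by (meson less_imp_le)
  qed
  then obtain l where l: "(\<lambda>n. f (radii n)) \<longlonglongrightarrow> l"
    using Cauchy_convergent convergent_def by blast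
  have "(f \<longlongrightarrow> l) (at_left 1)"
  proof (rule tendstoI)
    fix e :: real assume e: "0 < e"
    then obtain R where R: "R < 1" "\<And>t t'. R \<le> t \<and> t < 1 \<and> R \<le> t' \<and> t'
        < 1 \<Longrightarrow> dist (f t) (f t') < e / 2"
      using assms[of "e / 2"] by auto
    have "\<forall>\<^sub>F n in sequentially. R < radii n \<and> dist (f (radii n)) l < e / 2"
      using order_tendstoD(1)[OF radii_tendsto R(1)] tendstoD[OF l, of "e / 2"] e
          by (simp add: eventually_conj)
    then obtain n where n: "R < radii n" "dist (f (radii n)) l < e / 2"
      by (auto simp: eventually_sequentially)
    have "dist (f t) l < e" if "R < t" "t < 1" for t
      using R(2)[of t "radii n"] n that radii(2)[of n] dist_triangle[of "f t" l "f (radii n)"] by simp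
    then show "\<forall>\<^sub>F t in at_left 1. dist (f t) l < e"
      using eventually_at_left_field R(1) by blast
  qed
  then show ?thesis by blast
qed

text \<open>u(t\<sigma>) is the Poisson integral of the dilate by r at the point (t/r)\<sigma>, and
  t/r >= t >= R, so \<open>poisson_approx\<close> applies with the dilate as boundary function.
  \<open>R\<close> is independent of u, t, r and \<sigma>.\<close>

lemma dilate_increment:
  fixes s p e :: real
  assumes p: "1 < p" and s: "0 < s" and e: "0 < e"
  obtains R where "0 < R" "R < 1"
    "\<And>t r u \<sigma>. \<lbrakk>u holomorphic_on ball 0 1; \<And>z. z \<notin> ball 0 1 \<Longrightarrow> u z = 0;
       R \<le> t; t < r; r < 1; cmod \<sigma> = 1\<rbrakk> \<Longrightarrow>
       ennreal (cmod (dilate t u \<sigma> - dilate r u \<sigma>) powr p)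
           \<le> ennreal e * gagliardo_at s p (dilate r u) \<sigma>"
proof -
  obtain R where R: "0 < R" "R < 1" and
    *: "\<And>r g \<sigma>. \<lbrakk>R \<le> r; r < 1; integrable circ g; cmod \<sigma>
        = 1\<rbrakk> \<Longrightarrow>
       ennreal (cmod (poisson_integral g (of_real r * \<sigma>) - g \<sigma>) powr p)
           \<le> ennreal e * gagliardo_at s p g \<sigma>"
    using poisson_approx[OF p s e] by metis
  show ?thesis
  proof (rule that[OF R])
    fix t r :: real and u and \<sigma> :: complex
    assume hol: "u holomorphic_on ball 0 1"
        and zero: "\<And>z. z \<notin> ball 0 1 \<Longrightarrow> u z = 0"
      and tr: "R \<le> t" "t < r" "r < 1" and \<sigma>: "cmod \<sigma> = 1"
    have pos: "0 < r" "0 < t" using R tr by auto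
    have q: "R \<le> t / r" "t / r < 1"
    proof -
      show "t / r < 1" using tr pos by simp
      have "t * r \<le> t" using tr pos by simp
      then have "t \<le> t / r" using pos by (simp add: pos_le_divide_eq)
      then show "R \<le> t / r" using tr by simp
    qed
    have "poisson_integral (dilate r u) (of_real (t / r) * \<sigma>)
        = u (of_real r * (of_real (t / r) * \<sigma>))"
    proof (rule poisson_integral_dilate[OF hol zero])
      show "cmod (of_real (t / r) * \<sigma>) < 1"
        using q pos \<sigma> unfolding norm_mult norm_of_real by simp
    qed (use pos tr in auto)
    also have "\<dots> = dilate t u \<sigma>" using pos by (simp add: dilate_def)
    finally show "ennreal (cmod (dilate t u \<sigma> - dilate r u \<sigma>) powr p)
        \<le> ennreal e * gagliardo_at s p (dilate r u) \<sigma>"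
      using *[OF q integrable_dilate[OF hol zero pos(1) tr(3)] \<sigma>] by simp
  qed
qed

text \<open>A finite lower limit B yields G < B + 1 for infinitely many radii, hence for one beyond
  both t and t'. Both values of u are compared with the value at that radius.\<close>

lemma radial_limit_exists:
  fixes s p :: real
  assumes p: "1 < p" and s: "0 < s" and hol: "u holomorphic_on ball 0 1"
    and zero: "\<And>z. z \<notin> ball 0 1 \<Longrightarrow> u z = 0" and \<sigma>: "cmod \<sigma> = 1"
    and fin: "liminf (\<lambda>n. gagliardo_at s p (dilate (radii n) u) \<sigma>) < \<infinity>"
  shows "\<exists>l. ((\<lambda>r::real. u (of_real r * \<sigma>)) \<longlongrightarrow> l) (at_left 1)"
proof (rule tendsto_at_left_CauchyI)
  fix e :: real assume e: "0 < e"
  obtain B where B: "0 \<le> B" "liminf (\<lambda>n. gagliardo_at s p (dilate (radii n) u) \<sigma>)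
      = ennreal B"
    using fin by (metis ennreal_cases infinity_ennreal_def less_irrefl)
  have freq: "\<exists>\<^sub>F n in sequentially. gagliardo_at s p (dilate (radii n) u) \<sigma>
      < ennreal (B + 1)"
  proof (rule ccontr)
    assume "\<not> ?thesis"
    then have "\<forall>\<^sub>F n in sequentially. ennreal (B + 1)
        \<le> gagliardo_at s p (dilate (radii n) u) \<sigma>"
      by (simp add: frequently_def not_less)
    then have "ennreal (B + 1) \<le> ennreal B"
      unfolding B(2)[symmetric] by (rule Liminf_bounded)
    then show False using B(1) by (simp add: ennreal_le_iff)
  qed
  \<comment> \<open>Each of the two comparisons then costs at most e / 4, so the distance is at most
    e / 2 < e.\<close>
  define e' where "e' = (e / 4) powr p / (B + 1)"
  have e': "0 < e'" "e' * (B + 1) = (e / 4) powr p" using e B(1) by (auto simp: e'_def)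
  obtain R where R: "0 < R" "R < 1" and
    *: "\<And>t r u \<sigma>. \<lbrakk>u holomorphic_on ball 0 1; \<And>z. z \<notin> ball 0 1 \<Longrightarrow> u z = 0;
       R \<le> t; t < r; r < 1; cmod \<sigma> = 1\<rbrakk> \<Longrightarrow>
       ennreal (cmod (dilate t u \<sigma> - dilate r u \<sigma>) powr p)
           \<le> ennreal e' * gagliardo_at s p (dilate r u) \<sigma>"
    using dilate_increment[OF p s e'(1)] by metis
  have "dist (u (of_real t * \<sigma>)) (u (of_real t' * \<sigma>)) < e"
    if t: "R \<le> t \<and> t < 1 \<and> R \<le> t' \<and> t' < 1" for t t'
  proof -
    have "max t t' < 1" using t by simp
    then have "\<forall>\<^sub>F n in sequentially. max t t' < radii n"
        by (rule order_tendstoD(1)[OF radii_tendsto])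
    then have "\<exists>\<^sub>F n in sequentially. gagliardo_at s p (dilate (radii n) u) \<sigma>
        < ennreal (B + 1) \<and> max t t' < radii n"
      by (rule frequently_eventually_frequently[OF freq])
    then obtain n where n: "gagliardo_at s p (dilate (radii n) u) \<sigma> < ennreal (B + 1)" "max t t'
        < radii n"
      using frequently_ex by blast
    have le: "cmod (dilate q u \<sigma> - dilate (radii n) u \<sigma>) \<le> e / 4"
        if "R \<le> q" "q < radii n" for q
    proof -
      have "ennreal (cmod (dilate q u \<sigma> - dilate (radii n) u \<sigma>) powr p)
          \<le> ennreal e' * gagliardo_at s p (dilate (radii n) u) \<sigma>"
        using * hol zero that radii(2) \<sigma> by blast
      also have "\<dots> \<le> ennreal e' * ennreal (B + 1)" using n(1) by (intro mult_left_mono) auto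
      also have "\<dots> = ennreal ((e / 4) powr p)"
        using e' B(1) by (subst ennreal_mult[symmetric]) auto
      finally have "cmod (dilate q u \<sigma> - dilate (radii n) u \<sigma>) powr p \<le> (e / 4) powr p"
          by simp
      then show ?thesis using e p by (meson powr_less_mono2 not_le norm_ge_zero less_trans zero_less_one
          divide_nonneg_nonneg less_imp_le zero_le_numeral)
    qed
    have "cmod (dilate t u \<sigma> - dilate t' u \<sigma>) \<le> e / 4 + e / 4"
      using le[of t] le[of t'] t n(2)
        norm_triangle_ineq4[of "dilate t u \<sigma> - dilate (radii n) u \<sigma>" "dilate t' u \<sigma> - dilate (radii n) u \<sigma>"]
      by simp
    then show ?thesis using e by (simp add: dist_norm dilate_def)
  qed
  then show "\<exists>R<1. \<forall>t t'. R \<le> t \<and> t < 1 \<and> R \<le> t' \<and> t'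
      < 1 \<longrightarrow>
      dist (u (of_real t * \<sigma>)) (u (of_real t' * \<sigma>)) < e"
    using R(2) by blast
qed

section \<open>The boundary function of an analytic function\<close>

lemma borel_lim [measurable]:
  fixes u :: "complex \<Rightarrow> complex"
  assumes "u holomorphic_on ball 0 1" "\<And>z. z \<notin> ball 0 1 \<Longrightarrow> u z = 0"
  shows "(\<lambda>\<sigma>. lim (\<lambda>n. dilate (radii n) u \<sigma>)) \<in> borel_measurable borel"
  using measurable_dilate[OF assms] by (rule borel_measurable_lim_metric)

lemma tendsto_ennreal_liminf:
  fixes f :: "nat \<Rightarrow> ennreal"
  assumes "f \<longlonglongrightarrow> l"
  shows "l = liminf f"
  using lim_imp_Liminf[OF _ assms] by simp

text \<open>\<open>d\<close> may vanish, as it does on the diagonal of the Gagliardo kernel; all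
  quotients are then 0.\<close>

lemma tendsto_ennreal_powr:
  fixes f :: "nat \<Rightarrow> complex" and p d :: real
  assumes "f \<longlonglongrightarrow> l" "0 < p"
  shows "(\<lambda>n. ennreal (cmod (f n) powr p / d))
      \<longlonglongrightarrow> ennreal (cmod l powr p / d)"
proof (cases "d = 0")
  case False
  have "(\<lambda>n. cmod (f n) powr p) \<longlonglongrightarrow> cmod l powr p"
    using assms by (intro tendsto_powr2 tendsto_norm tendsto_const) auto
  then show ?thesis using False by (intro tendsto_ennrealI tendsto_divide tendsto_const)
qed simp

text \<open>Fatou's lemma is applied twice, in \<xi> for fixed \<sigma> and then in \<sigma>.
  Convergence is required at both points, hence almost everywhere in each variable.\<close>

lemma gagliardo_energy_Fatou:
  assumes p: "0 < p" and [measurable]: "\<And>n. f n \<in> borel_measurable borel" "g \<in> borel_measurable borel"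
    and lim: "AE \<sigma> in circ. (\<lambda>n. f n \<sigma>) \<longlonglongrightarrow> g \<sigma>"
  shows "gagliardo_energy s p g \<le> liminf (\<lambda>n. gagliardo_energy s p (f n))"
proof -
  have "AE \<sigma> in circ. gagliardo_at s p g \<sigma>
      \<le> liminf (\<lambda>n. gagliardo_at s p (f n) \<sigma>)"
    using lim
  proof eventually_elim
    case (elim \<sigma>)
    have "gagliardo_at s p g \<sigma>
        = (\<integral>\<^sup>+\<xi>. liminf (\<lambda>n. gagliardo_kernel s p (f n) \<sigma> \<xi>) \<partial>circ)"
      unfolding gagliardo_at_def
    proof (rule nn_integral_cong_AE, use lim in eventually_elim, goal_cases)
      case (1 \<xi>)
      show ?case
        unfolding gagliardo_kernel_def using p 1 elim
            by (intro tendsto_ennreal_liminf tendsto_ennreal_powr tendsto_diff)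
    qed
    also have "\<dots> \<le> liminf (\<lambda>n. gagliardo_at s p (f n) \<sigma>)"
      unfolding gagliardo_at_def by (rule nn_integral_liminf) measurable
    finally show ?case .
  qed
  then have "gagliardo_energy s p g
      \<le> (\<integral>\<^sup>+\<sigma>. liminf (\<lambda>n. gagliardo_at s p (f n) \<sigma>) \<partial>circ)"
    unfolding gagliardo_energy_circ[OF assms(3)] by (rule nn_integral_mono_AE)
  also have "\<dots> \<le> liminf (\<lambda>n. \<integral>\<^sup>+\<sigma>. gagliardo_at s p (f n) \<sigma> \<partial>circ)"
    by (rule nn_integral_liminf) simp
  also have "\<dots> = liminf (\<lambda>n. gagliardo_energy s p (f n))"
    by (simp add: gagliardo_energy_circ)
  finally show ?thesis .
qed

lemma weighted_integral_Lp_bound: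
  assumes p: "1 < p" and [measurable]: "f \<in> borel_measurable borel" "m \<in> borel_measurable borel"
    and m: "\<And>y. cmod y = 1 \<Longrightarrow> cmod (m y) \<le> C"
  shows "ennreal (cmod (LINT y|circ. m y * f y) powr p)
    \<le> ennreal ((2 * pi) powr (p - 1) * C powr p) * Lp_energy p f"
proof -
  have "cmod (m 1) \<le> C" by (rule m) simp
  then have C: "0 \<le> C" using norm_ge_zero[of "m 1"] by linarith
  have "ennreal (cmod (LINT y|circ. of_real 1 * (m y * f y)) powr p)
      \<le> ennreal ((2 * pi) powr (p - 1))
          * (\<integral>\<^sup>+y. ennreal (1 * cmod (m y * f y) powr p) \<partial>circ)"
    using p by (intro jensen_powr) (auto simp: emeasure_circ)
  also have "\<dots> \<le> ennreal ((2 * pi) powr (p - 1))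
      * (\<integral>\<^sup>+y. ennreal (C powr p) * ennreal (cmod (f y) powr p) \<partial>circ)"
  proof (intro mult_left_mono nn_integral_mono_AE, use AE_circ_norm in eventually_elim, goal_cases)
    case (1 y)
    have "cmod (m y * f y) powr p \<le> (C * cmod (f y)) powr p"
      using m[OF 1] p by (intro powr_mono2) (auto simp: norm_mult mult_right_mono)
    also have "\<dots> = C powr p * cmod (f y) powr p" by (rule powr_mult)
    finally show ?case by (simp add: ennreal_mult[symmetric] ennreal_leI)
  qed simp
  also have "\<dots> = ennreal ((2 * pi) powr (p - 1) * C powr p) * Lp_energy p f"
    by (simp add: nn_integral_cmult Lp_energy_circ ennreal_mult mult.assoc)
  finally show ?thesis by simp
qed

text \<open>Used with m = y^k and with m the Poisson kernel: it carries the vanishing Fourier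
  coefficients and the Poisson formula from the dilates to their L^p limit.\<close>

lemma weighted_integral_tendsto:
  assumes p: "1 < p" and f: "\<And>n. integrable circ (f n)" and g: "integrable circ g"
    and lim: "(\<lambda>n. Lp_energy p (\<lambda>y. f n y - g y)) \<longlonglongrightarrow> 0"
    and [measurable]: "m \<in> borel_measurable borel"
        and m: "\<And>y. cmod y = 1 \<Longrightarrow> cmod (m y) \<le> C"
  shows "(\<lambda>n. LINT y|circ. m y * f n y) \<longlonglongrightarrow> (LINT y|circ. m y * g y)"
proof -
  have [measurable]: "f n \<in> borel_measurable borel" "g \<in> borel_measurable borel" for n
    using f[of n] g by auto
  let ?K = "ennreal ((2 * pi) powr (p - 1) * C powr p)"
  have "(\<lambda>n. ?K * Lp_energy p (\<lambda>y. f n y - g y)) \<longlonglongrightarrow> ?K * 0"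
    using lim by (intro ennreal_tendsto_cmult) auto
  then have K: "(\<lambda>n. ?K * Lp_energy p (\<lambda>y. f n y - g y))
      \<longlonglongrightarrow> ennreal 0" by simp
  have "(\<lambda>n. ennreal (cmod (LINT y|circ. m y * (f n y - g y)) powr p))
      \<longlonglongrightarrow> ennreal 0"
  proof (rule tendsto_sandwich[OF _ _ _ K, of "\<lambda>_. ennreal 0"])
    show "\<forall>\<^sub>F n in sequentially. ennreal (cmod (LINT y|circ. m y * (f n y - g y)) powr p)
        \<le> ?K * Lp_energy p (\<lambda>y. f n y - g y)"
      by (intro always_eventually allI weighted_integral_Lp_bound[OF p]) (use m in auto)
  qed auto
  then have "(\<lambda>n. cmod (LINT y|circ. m y * (f n y - g y)) powr p) \<longlonglongrightarrow> 0"
    by (rule tendsto_ennrealD) auto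
  then have "(\<lambda>n. (cmod (LINT y|circ. m y * (f n y - g y)) powr p) powr (1 / p))
      \<longlonglongrightarrow> 0 powr (1 / p)"
    using p by (intro tendsto_powr2 tendsto_const) auto
  then have "(\<lambda>n. cmod (LINT y|circ. m y * (f n y - g y))) \<longlonglongrightarrow> 0"
    using p by (simp add: powr_powr)
  moreover have "(LINT y|circ. m y * (f n y - g y))
      = (LINT y|circ. m y * f n y) - (LINT y|circ. m y * g y)" for n
    using integrable_circ_bounded[OF f, of m C n] integrable_circ_bounded[OF g, of m C] m
    by (simp add: right_diff_distrib)
  ultimately show ?thesis by (simp add: tendsto_norm_zero_iff LIM_zero_iff)
qed

lemma AE_radial_limit:
  fixes s p :: real
  assumes p: "1 < p" and s: "0 < s" and u: "u \<in> disc_functions s p"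
  shows "AE \<sigma> in circ. \<exists>l. ((\<lambda>r::real. u (of_real r * \<sigma>))
      \<longlongrightarrow> l) (at_left 1)"
proof -
  have hol: "u holomorphic_on ball 0 1" and zero: "\<And>z. z \<notin> ball 0 1 \<Longrightarrow> u z = 0"
    using u by (auto simp: disc_functions_def)
  note [measurable] = measurable_dilate[OF hol zero]
  have "(\<integral>\<^sup>+\<sigma>. liminf (\<lambda>n. gagliardo_at s p (dilate (radii n) u) \<sigma>) \<partial>circ)
      \<le> liminf (\<lambda>n. \<integral>\<^sup>+\<sigma>. gagliardo_at s p (dilate (radii n) u) \<sigma> \<partial>circ)"
    by (rule nn_integral_liminf) simp
  also have "\<dots> \<le> ennreal (gagliardo_sup s p u powr p)"
    using gagliardo_energy_dilate_le[OF _ u radii] p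
    by (intro Liminf_le) (simp_all add: gagliardo_energy_circ)
  also have "\<dots> < \<infinity>" by simp
  finally have "AE \<sigma> in circ. liminf (\<lambda>n. gagliardo_at s p (dilate (radii n) u) \<sigma>) \<noteq> \<infinity>"
    by (intro nn_integral_PInf_AE) auto
  with AE_circ_norm show ?thesis
  proof eventually_elim
    case (elim \<sigma>)
    then show ?case by (intro radial_limit_exists[OF p s hol zero]) (auto simp: top.not_eq_extremum)
  qed
qed

text \<open>Pointwise convergence of the dilates comes from \<open>AE_radial_limit\<close>, the
  energy bound from Fatou's lemma. Strong L^p convergence comes from the increments, and through it
  the Fourier and Poisson identities of the dilates pass to the limit.\<close>

lemma disc_trace:
  fixes s p :: real
  assumes p: "1 < p" and s: "0 < s" and u: "u \<in> disc_functions s p"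
  obtains g where "g \<in> borel_measurable borel"
    "AE \<sigma> in circ. ((\<lambda>r::real. u (of_real r * \<sigma>))
        \<longlongrightarrow> g \<sigma>) (at_left 1)"
    "Lp_energy p g < \<infinity>" "gagliardo_energy s p g \<le> ennreal (gagliardo_sup s p u powr p)"
    "\<And>k. 0 < k \<Longrightarrow> (LINT y|circ. y ^ k * g y) = 0"
    "\<And>z. cmod z < 1 \<Longrightarrow> poisson_integral g z = u z"
proof -
  have hol: "u holomorphic_on ball 0 1" and zero: "\<And>z. z \<notin> ball 0 1 \<Longrightarrow> u z = 0"
    using u by (auto simp: disc_functions_def)
  note [measurable] = measurable_dilate[OF hol zero]
  \<comment> \<open>The sequential \<open>lim\<close> of Borel functions is Borel on the whole
    plane, whatever its values where the limit fails to exist; \<open>boundary_trace\<close> is only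
    shown to agree with it almost everywhere.\<close>
  define g where "g \<sigma> = lim (\<lambda>n. dilate (radii n) u \<sigma>)" for \<sigma>
  have g [measurable]: "g \<in> borel_measurable borel"
    unfolding g_def using hol zero by (rule borel_lim)
  have lim: "AE \<sigma> in circ. ((\<lambda>r::real. u (of_real r * \<sigma>))
      \<longlongrightarrow> g \<sigma>) (at_left 1)"
    using AE_radial_limit[OF p s u]
  proof eventually_elim
    case (elim \<sigma>)
    then obtain l where l: "((\<lambda>r::real. u (of_real r * \<sigma>))
        \<longlongrightarrow> l) (at_left 1)" by blast
    then have "(\<lambda>n. dilate (radii n) u \<sigma>) \<longlonglongrightarrow> l"
      unfolding dilate_def by (rule filterlim_compose[OF _ radii_at_left])
    then show ?case using l by (simp add: g_def limI)
  qed
  then have limn: "AE \<sigma> in circ. (\<lambda>n. dilate (radii n) u \<sigma>)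
      \<longlonglongrightarrow> g \<sigma>"
  proof eventually_elim
    case (elim \<sigma>)
    then show ?case unfolding dilate_def by (rule filterlim_compose[OF _ radii_at_left])
  qed
  let ?M = "gagliardo_sup s p u powr p"
  have En: "gagliardo_energy s p (dilate (radii n) u) \<le> ennreal ?M" for n
    using gagliardo_energy_dilate_le[OF _ u radii] p by simp
  have gg: "gagliardo_energy s p g \<le> ennreal ?M"
  proof -
    have "gagliardo_energy s p g \<le> liminf (\<lambda>n. gagliardo_energy s p (dilate (radii n) u))"
      using p limn by (intro gagliardo_energy_Fatou) auto
    also have "\<dots> \<le> ennreal ?M" using En by (intro Liminf_le) auto
    finally show ?thesis .
  qed
  \<comment> \<open>For fixed t the increment to the n-th dilate is integrated, giving at most e
    times an energy bounded by \<open>?M\<close>; Fatou's lemma in n then replaces the n-th dilate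
    by g.\<close>
  have close: "\<exists>R<1. \<forall>t. R \<le> t \<and> t
      < 1 \<longrightarrow> Lp_energy p (\<lambda>y. dilate t u y - g y) \<le> ennreal (e * ?M)"
    if e: "0 < e" for e
  proof -
    obtain R where R: "0 < R" "R < 1" and
      *: "\<And>t r u \<sigma>. \<lbrakk>u holomorphic_on ball 0 1; \<And>z. z \<notin> ball 0 1 \<Longrightarrow> u z = 0;
         R \<le> t; t < r; r < 1; cmod \<sigma> = 1\<rbrakk> \<Longrightarrow>
         ennreal (cmod (dilate t u \<sigma> - dilate r u \<sigma>) powr p)
             \<le> ennreal e * gagliardo_at s p (dilate r u) \<sigma>"
      using dilate_increment[OF p s e] by metis
    have "Lp_energy p (\<lambda>y. dilate t u y - g y) \<le> ennreal (e * ?M)" if t: "R \<le> t" "t < 1"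
        for t
    proof -
      have mt: "(\<lambda>y. dilate t u y - g y) \<in> borel_measurable borel" by measurable
      have "Lp_energy p (\<lambda>y. dilate t u y - g y)
          = (\<integral>\<^sup>+\<sigma>. liminf (\<lambda>n. ennreal (cmod (dilate t u \<sigma> - dilate (radii n) u \<sigma>) powr p)) \<partial>circ)"
        unfolding Lp_energy_circ[OF mt]
      proof (rule nn_integral_cong_AE, use limn in eventually_elim, goal_cases)
        case (1 \<sigma>)
        have "(\<lambda>n. ennreal (cmod (dilate t u \<sigma> - dilate (radii n) u \<sigma>) powr p / 1))
            \<longlonglongrightarrow> ennreal (cmod (dilate t u \<sigma> - g \<sigma>) powr p / 1)"
          using p 1 by (intro tendsto_ennreal_powr tendsto_diff tendsto_const) auto
        then show ?case by (intro tendsto_ennreal_liminf) simp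
      qed
      also have "\<dots> \<le> liminf (\<lambda>n. \<integral>\<^sup>+\<sigma>. ennreal (cmod (dilate t u \<sigma> - dilate (radii n) u \<sigma>) powr p) \<partial>circ)"
        by (rule nn_integral_liminf) measurable
      also have "\<dots> \<le> ennreal (e * ?M)"
      proof (rule Liminf_le)
        have "\<forall>\<^sub>F n in sequentially. t < radii n" using t
            by (intro order_tendstoD(1)[OF radii_tendsto])
        then show "\<forall>\<^sub>F n in sequentially. (\<integral>\<^sup>+\<sigma>. ennreal (cmod (dilate t u \<sigma> - dilate (radii n) u \<sigma>) powr p) \<partial>circ) \<le> ennreal (e * ?M)"
        proof eventually_elim
          case (elim n)
          have "(\<integral>\<^sup>+\<sigma>. ennreal (cmod (dilate t u \<sigma> - dilate (radii n) u \<sigma>) powr p) \<partial>circ)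
              \<le> (\<integral>\<^sup>+\<sigma>. ennreal e
                  * gagliardo_at s p (dilate (radii n) u) \<sigma> \<partial>circ)"
            by (rule nn_integral_mono_AE, use AE_circ_norm in eventually_elim)
               (use * hol zero t elim radii(2) in blast)
          also have "\<dots> = ennreal e * gagliardo_energy s p (dilate (radii n) u)"
            by (simp add: nn_integral_cmult gagliardo_energy_circ)
          also have "\<dots> \<le> ennreal e * ennreal ?M" using En by (intro mult_left_mono) auto
          also have "\<dots> = ennreal (e * ?M)" using e by (simp add: ennreal_mult)
          finally show ?case .
        qed
      qed simp
      finally show ?thesis .
    qed
    then show ?thesis using R(2) by blast
  qed
  have limL: "(\<lambda>n. Lp_energy p (\<lambda>y. dilate (radii n) u y - g y))
      \<longlonglongrightarrow> 0"
  proof (rule order_tendstoI)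
    fix a :: ennreal assume a: "0 < a"
    \<comment> \<open>\<open>a\<close> may be infinite, so a finite positive bound below it is
      chosen.\<close>
    obtain c where c: "0 < c" "c < a" using dense[OF a] by blast
    have "c < top" using c(2) top_greatest by (rule order_less_le_trans)
    define b where "b = enn2real c"
    have "ennreal b = c" using \<open>c < top\<close> by (simp add: b_def)
    then have b: "0 < b" "ennreal b < a" using c by auto
    \<comment> \<open>The summand 1 covers the case where the supremum of the seminorms is
      0.\<close>
    define e where "e = b / (?M + 1)"
    have M0: "0 \<le> ?M" by simp
    have e: "0 < e" "e * ?M \<le> b"
      using b M0 by (auto simp: e_def pos_divide_le_eq add_pos_nonneg add_nonneg_pos mult_left_mono)
    obtain R where R: "R < 1" "\<And>t. R \<le> t \<and> t
        < 1 \<Longrightarrow> Lp_energy p (\<lambda>y. dilate t u y - g y) \<le> ennreal (e * ?M)"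
      using close[OF e(1)] by metis
    have "\<forall>\<^sub>F n in sequentially. R < radii n"
        by (rule order_tendstoD(1)[OF radii_tendsto R(1)])
    then show "\<forall>\<^sub>F n in sequentially. Lp_energy p (\<lambda>y. dilate (radii n) u y - g y)
        < a"
    proof eventually_elim
      case (elim n)
      have "Lp_energy p (\<lambda>y. dilate (radii n) u y - g y) \<le> ennreal (e * ?M)"
          using R(2) elim radii(2) by simp
      also have "\<dots> \<le> ennreal b" using e by (intro ennreal_leI)
      finally show ?case using b(2) by simp
    qed
  qed simp
  have Lg: "Lp_energy p g < \<infinity>"
  proof -
    have "\<forall>\<^sub>F n in sequentially. Lp_energy p (\<lambda>y. dilate (radii n) u y - g y) < 1"
      by (rule order_tendstoD(2)[OF limL]) simp
    then obtain n where n: "Lp_energy p (\<lambda>y. dilate (radii n) u y - g y) < 1"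
      by (auto simp: eventually_sequentially)
    have "(\<integral>\<^sup>+y. ennreal (cmod ((g y - dilate (radii n) u y)
        + dilate (radii n) u y) powr p) \<partial>circ)
      \<le> ennreal ((pnorm circ p (\<lambda>y. g y - dilate (radii n) u y)
          + pnorm circ p (dilate (radii n) u)) powr p)"
    proof (rule minkowski)
      show "(\<integral>\<^sup>+y. ennreal (cmod (g y - dilate (radii n) u y) powr p) \<partial>circ)
          < \<infinity>"
        using n by (auto simp: Lp_energy_circ norm_minus_commute intro: less_trans)
      show "(\<integral>\<^sup>+y. ennreal (cmod (dilate (radii n) u y) powr p) \<partial>circ)
          < \<infinity>"
        using Lp_energy_dilate[OF hol zero radii, of p] p by (simp add: Lp_energy_circ)
    qed (use p in auto)
    also have "\<dots> < \<infinity>" by simp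
    finally show ?thesis by (simp add: Lp_energy_circ)
  qed
  have ig: "integrable circ g" by (rule integrable_Lp[OF p g Lg])
  have iu: "integrable circ (dilate (radii n) u)" for n by (rule integrable_dilate[OF hol zero radii])
  have four: "(LINT y|circ. y ^ k * g y) = 0" if "0 < k" for k
  proof -
    have "(\<lambda>n. LINT y|circ. y ^ k * dilate (radii n) u y)
        \<longlonglongrightarrow> (LINT y|circ. y ^ k * g y)"
      by (rule weighted_integral_tendsto[OF p iu ig limL, where C = 1]) (auto simp: norm_power)
    then show ?thesis
      using dilate_fourier_neg[OF hol zero radii that] by (simp add: LIMSEQ_const_iff)
  qed
  have pg: "poisson_integral g z = u z" if z: "cmod z < 1" for z
  proof -
    have "(\<lambda>n. LINT y|circ. of_real (poisson_density z y) * dilate (radii n) u y)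
        \<longlonglongrightarrow> (LINT y|circ. of_real (poisson_density z y) * g y)"
      by (rule weighted_integral_tendsto[OF p iu ig limL, where C = "2 / (1 - cmod z)"])
         (use z poisson_density_le poisson_density_nonneg in auto)
    then have "(\<lambda>n. poisson_integral (dilate (radii n) u) z)
        \<longlonglongrightarrow> poisson_integral g z"
      unfolding poisson_integral_def by (intro tendsto_divide tendsto_const) auto
    then have "(\<lambda>n. u (of_real (radii n) * z)) \<longlonglongrightarrow> poisson_integral g z"
      using poisson_integral_dilate[OF hol zero radii z] by simp
    moreover have "(\<lambda>n. u (of_real (radii n) * z)) \<longlonglongrightarrow> u (of_real 1 * z)"
    proof (rule isCont_tendsto_compose[where g = u])
      have "continuous_on (ball 0 1) u" using hol by (rule holomorphic_on_imp_continuous_on)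
      then show "isCont u (of_real 1 * z)"
        using z by (simp add: continuous_on_eq_continuous_at)
      show "(\<lambda>n. of_real (radii n) * z) \<longlonglongrightarrow> of_real 1 * z"
        by (intro tendsto_intros radii_tendsto)
    qed
    ultimately show ?thesis using LIMSEQ_unique by force
  qed
  show ?thesis by (rule that[OF g lim Lg gg four pg])
qed

section \<open>Poisson extensions and norm inequalities\<close>

text \<open>Completeness of Lebesgue measure: this is the converse passage to
  \<open>borel_representative\<close>, from a Borel function back to an almost everywhere equal
  one.\<close>

lemma measurable_lebesgue_on_cong_AE:
  fixes F G :: "real \<Rightarrow> complex"
  assumes [measurable]: "G \<in> borel_measurable borel" and S: "S \<in> sets lebesgue"
    and "AE \<theta> in lebesgue_on S. F \<theta> = G \<theta>"
  shows "F \<in> borel_measurable (lebesgue_on S)"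
proof -
  have "(\<lambda>\<theta>. if \<theta> \<in> S then G \<theta> else 0) \<in> borel_measurable lebesgue"
    using S by (intro borel_measurable_if_I measurable_restrict_space1 measurable_completion) auto
  moreover have "AE \<theta> in lebesgue. (if \<theta> \<in> S then G \<theta> else 0)
      = (if \<theta> \<in> S then F \<theta> else 0)"
    using assms(3) S by (auto simp: AE_restrict_space_iff elim!: AE_mp)
  ultimately have "(\<lambda>\<theta>.
      if \<theta> \<in> S then F \<theta> else 0) \<in> borel_measurable lebesgue"
    by (rule borel_measurable_AE)
  then show ?thesis by (rule borel_measurable_if_D)
qed

text \<open>The set of angles is a parameter because \<open>circle_mean\<close> integrates over
  [0, 2 pi] and all other definitions over [-pi, pi].\<close>

lemma integral_lebesgue_on_circ:
  fixes f g :: "complex \<Rightarrow> complex"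
  assumes S: "S \<in> sets lebesgue" and distr: "distr (lebesgue_on S) borel cis = circ"
    and g [measurable]: "g \<in> borel_measurable borel" and ae: "AE z in circ. f z = g z"
  shows "(LINT \<theta>|lebesgue_on S. f (cis \<theta>)) = (LINT z|circ. g z)"
proof -
  have cis [measurable]: "cis \<in> measurable (lebesgue_on S) borel"
    by (intro measurable_restrict_space1 measurable_completion) simp
  have "AE \<theta> in lebesgue_on S. f (cis \<theta>) = g (cis \<theta>)"
    using ae unfolding distr[symmetric] by (rule AE_distrD[rotated]) simp
  then have "(LINT \<theta>|lebesgue_on S. f (cis \<theta>))
      = (LINT \<theta>|lebesgue_on S. g (cis \<theta>))"
    using S by (intro integral_cong_AE measurable_lebesgue_on_cong_AE[of "\<lambda>\<theta>. g (cis \<theta>)"]) auto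
  also have "\<dots> = (LINT z|distr (lebesgue_on S) borel cis. g z)"
    by (rule integral_distr[symmetric]) measurable
  finally show ?thesis unfolding distr .
qed

text \<open>Translation by pi takes [-pi, pi] to [0, 2 pi] and acts on the circle as rotation by
  \<open>cis pi\<close>.\<close>

lemma distr_cis_0_2pi: "distr (lebesgue_on {0..2*pi}) borel cis = circ"
proof (rule measure_eqI)
  fix A assume "A \<in> sets (distr (lebesgue_on {0..2*pi}) borel cis)"
  then have [measurable]: "A \<in> sets borel" by simp
  have [measurable]: "cis \<in> measurable (lebesgue_on {0..2*pi}) borel"
    by (intro measurable_restrict_space1 measurable_completion) simp
  let ?h = "indicator A :: complex \<Rightarrow> ennreal"
  have "emeasure (distr (lebesgue_on {0..2*pi}) borel cis) A
      = (\<integral>\<^sup>+z. ?h z \<partial>distr (lebesgue_on {0..2*pi}) borel cis)"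
    by simp
  also have "\<dots> = (\<integral>\<^sup>+\<theta>. ?h (cis \<theta>) \<partial>lebesgue_on {0..2*pi})"
    by (rule nn_integral_distr) auto
  also have "\<dots> = (\<integral>\<^sup>+\<theta>. ?h (cis \<theta>)
      * indicator {0..2*pi} \<theta> \<partial>lborel)"
    by (subst nn_integral_restrict_space) (auto simp: nn_integral_completion)
  also have "\<dots> = (\<integral>\<^sup>+\<theta>. ?h (cis (pi + 1 * \<theta>))
      * indicator {0..2*pi} (pi + 1 * \<theta>) \<partial>lborel)"
    by (subst nn_integral_real_affine[where c = 1 and t = pi]) auto
  also have "\<dots> = (\<integral>\<^sup>+\<theta>. ?h (cis pi * cis \<theta>)
      * indicator {-pi..pi} \<theta> \<partial>lborel)"
  proof (rule nn_integral_cong)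
    fix \<theta> :: real
    have "cis (pi + 1 * \<theta>) = cis pi * cis \<theta>" by (simp only: cis_mult mult_1)
    moreover have "pi + 1 * \<theta> \<in> {0..2*pi} \<longleftrightarrow> \<theta> \<in> {-pi..pi}" by auto
    ultimately show "?h (cis (pi + 1 * \<theta>)) * indicator {0..2*pi} (pi + 1 * \<theta>)
        = ?h (cis pi * cis \<theta>) * indicator {-pi..pi} \<theta>"
      by (simp only: indicator_def)
  qed
  also have "\<dots> = (\<integral>\<^sup>+z. ?h (cis pi * z) \<partial>circ)"
    by (subst nn_integral_circ_lborel) auto
  also have "\<dots> = (\<integral>\<^sup>+z. ?h z \<partial>circ)"
    by (rule nn_integral_circ_rotate) auto
  finally show "emeasure (distr (lebesgue_on {0..2*pi}) borel cis) A = emeasure circ A" by simp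
qed simp

text \<open>The Poisson kernel at the centre is 1 on the circle. For the trace of u this identifies
  the mean with u(0), which links the Poincare inequality to \<open>disc_norm\<close>.\<close>

lemma circle_mean_eq:
  assumes g: "g \<in> borel_measurable borel" "AE z in circ. f z = g z"
  shows "circle_mean f = poisson_integral g 0"
proof -
  have "(LINT \<theta>|lebesgue_on {0..2*pi}. f (cis \<theta>)) = (LINT z|circ. g z)"
    using g by (intro integral_lebesgue_on_circ distr_cis_0_2pi) auto
  also have "\<dots> = (LINT z|circ. of_real (poisson_density 0 z) * g z)"
    using g by (intro integral_circ_cong) (auto simp: poisson_density_def)
  finally show ?thesis by (simp add: circle_mean_def poisson_integral_def)
qed

lemma fourier_coeff_eq:
  assumes [measurable]: "g \<in> borel_measurable borel" and ae: "AE z in circ. f z = g z"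
  shows "fourier_coeff f (- int n) = (LINT z|circ. z ^ n * g z) / of_real (2 * pi)"
proof -
  have "(\<lambda>\<theta>. f (cis \<theta>) * cis (- (of_int (- int n) * \<theta>)))
      = (\<lambda>\<theta>. (\<lambda>z. z ^ n * f z) (cis \<theta>))"
    by (simp add: Complex.DeMoivre mult.commute)
  moreover have "(LINT \<theta>|angles. (\<lambda>z. z ^ n * f z) (cis \<theta>))
      = (LINT z|circ. z ^ n * g z)"
  proof (rule integral_lebesgue_on_circ)
    show "AE z in circ. z ^ n * f z = z ^ n * g z" using ae by eventually_elim simp
  qed (auto simp: circ_def)
  ultimately show ?thesis unfolding fourier_coeff_def by simp
qed

lemma poisson_kernel_eq: "poisson_kernel r t = poisson_density (of_real r) (cnj (cis t))"
proof -
  have "(cmod (cnj (cis t) - of_real r))\<^sup>2 = (cos t - r)\<^sup>2 + (sin t)\<^sup>2"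
    by (simp add: cmod_power2)
  also have "\<dots> = (cos t)\<^sup>2 + (sin t)\<^sup>2 - 2 * r * cos t + r\<^sup>2"
    by (simp add: power2_eq_square algebra_simps)
  finally show ?thesis by (simp add: poisson_kernel_def poisson_density_def)
qed

text \<open>The convolution evaluates f at e^(i(Arg z - t)), hence the conjugate of
  \<open>cis t\<close>: conjugation and then rotation by e^(i Arg z) turn it into an integral over
  \<open>circ\<close>. In particular the extension depends only on the class of f.\<close>

lemma poisson_ext_eq:
  assumes [measurable]: "g \<in> borel_measurable borel" and ae: "AE z in circ. f z = g z"
      and z: "cmod z < 1"
  shows "poisson_ext f z = poisson_integral g z"
proof -
  define e where "e = cis (Arg z)"
  have e: "cmod e = 1" "of_real (cmod z) * e = z"
    by (auto simp: e_def rcis_def[symmetric] rcis_cmod_Arg)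
  let ?r = "complex_of_real (cmod z)"
  have "(LINT t|angles. of_real (poisson_kernel (cmod z) t) * f (cis (Arg z - t)))
      = (LINT t|angles. (\<lambda>y. of_real (poisson_density ?r (cnj y)) * f (e * cnj y)) (cis t))"
    by (simp add: poisson_kernel_eq e_def cis_cnj cis_mult)
  also have "\<dots> = (LINT y|circ. of_real (poisson_density ?r (cnj y)) * g (e * cnj y))"
  proof (rule integral_lebesgue_on_circ)
    have "AE y in circ. f (e * cnj y) = g (e * cnj y)"
      by (rule AE_circ_cnj, rule AE_circ_rotate) (use e ae in auto)
    then show "AE y in circ. of_real (poisson_density ?r (cnj y)) * f (e * cnj y)
        = of_real (poisson_density ?r (cnj y)) * g (e * cnj y)"
      by eventually_elim simp
  qed (auto simp: circ_def)
  also have "\<dots> = (LINT y|circ. of_real (poisson_density ?r y) * g (e * y))"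
    by (rule integral_circ_cnj[of "\<lambda>y. of_real (poisson_density ?r y) * g (e * y)"]) measurable
  finally have "poisson_ext f z = poisson_integral (\<lambda>\<eta>. g (e * \<eta>)) ?r"
    using z by (simp add: poisson_ext_def poisson_integral_def)
  also have "\<dots> = poisson_integral g (?r * e)"
    using e by (intro poisson_integral_rotate[symmetric]) auto
  finally show ?thesis by (simp add: e)
qed

section \<open>Borel representatives of Sobolev and Besov functions\<close>

lemma sobolev_rep:
  assumes "f \<in> sobolev_functions s p"
  obtains g where "g \<in> borel_measurable borel" "AE z in circ. f z = g z"
    "Lp_energy p g < \<infinity>" "gagliardo_energy s p g < \<infinity>"
proof -
  obtain g where g: "g \<in> borel_measurable borel" "AE z in circ. f z = g z"
    using assms borel_representative[of f] by (auto simp: sobolev_functions_def)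
  then show ?thesis
    using that[OF g] assms by (simp add: sobolev_functions_def Lp_energy_cong[OF g(2)] gagliardo_energy_cong[OF g(2)])
qed

lemma sobolev_functionsI:
  assumes "g \<in> borel_measurable borel" "AE z in circ. f z = g z"
    "Lp_energy p g < \<infinity>" "gagliardo_energy s p g < \<infinity>"
  shows "f \<in> sobolev_functions s p"
proof -
  have "(\<lambda>\<theta>. f (cis \<theta>)) \<in> borel_measurable angles"
    using assms(1,2)
    by (intro measurable_lebesgue_on_cong_AE[of "\<lambda>\<theta>. g (cis \<theta>)"])
        (auto simp: AE_circ_iff)
  then show ?thesis
    using assms by (simp add: sobolev_functions_def Lp_energy_cong[OF assms(2)] gagliardo_energy_cong[OF assms(2)])
qed

lemma besov_rep:
  assumes "f \<in> besov_plus_functions s p"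
  obtains g where "g \<in> borel_measurable borel" "AE z in circ. f z = g z"
    "Lp_energy p g < \<infinity>" "gagliardo_energy s p g < \<infinity>"
    "\<And>k. 0 < k \<Longrightarrow> (LINT y|circ. y ^ k * g y) = 0"
proof -
  have f: "f \<in> sobolev_functions s p" "\<And>k. k < 0 \<Longrightarrow> fourier_coeff f k = 0"
    using assms by (auto simp: besov_plus_functions_def)
  obtain g where g: "g \<in> borel_measurable borel" "AE z in circ. f z = g z"
    "Lp_energy p g < \<infinity>" "gagliardo_energy s p g < \<infinity>"
    using sobolev_rep[OF f(1)] by metis
  have "(LINT y|circ. y ^ k * g y) = 0" if "0 < k" for k
    using fourier_coeff_eq[OF g(1,2), of k] f(2)[of "- int k"] that by simp
  with g show ?thesis by (rule that)
qed

lemma besov_plus_functionsI: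
  assumes g: "g \<in> borel_measurable borel" "AE z in circ. f z = g z"
    "Lp_energy p g < \<infinity>" "gagliardo_energy s p g < \<infinity>"
    and k: "\<And>k. 0 < k \<Longrightarrow> (LINT y|circ. y ^ k * g y) = 0"
  shows "f \<in> besov_plus_functions s p"
proof -
  have "fourier_coeff f k = 0" if "k < 0" for k
  proof -
    have "k = - int (nat (- k))" "0 < nat (- k)" using that by auto
    then show ?thesis using fourier_coeff_eq[OF g(1,2), of "nat (- k)"] k by simp
  qed
  then show ?thesis using sobolev_functionsI[OF g] by (simp add: besov_plus_functions_def)
qed

lemma gagliardo_mono:
  assumes "0 < p" "gagliardo_energy s p f \<le> gagliardo_energy s p g" "gagliardo_energy s p g
      < \<infinity>"
  shows "gagliardo s p f \<le> gagliardo s p g"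
  unfolding gagliardo_def using assms by (intro powr_mono2 enn2real_mono) auto

lemma gagliardo_leI:
  assumes "0 < p" "0 \<le> a" "gagliardo_energy s p f \<le> ennreal (a powr p)"
  shows "gagliardo s p f \<le> a"
  unfolding gagliardo_def using assms by (rule enn2real_root_le)

lemma gagliardo_energy_cong_circle:
  assumes "\<And>z. cmod z = 1 \<Longrightarrow> f z = g z"
  shows "gagliardo_energy s p f = gagliardo_energy s p g"
  unfolding gagliardo_energy_def using assms by (intro nn_integral_cong) simp

text \<open>The converse of \<open>disc_trace\<close>. The condition \<open>neg\<close> makes the
  Poisson integral a power series, the energies of its dilates are those of averages of g, and the
  radial limit exists wherever G is finite.\<close>

lemma poisson_ext_disc:
  fixes s p :: real
  assumes p: "1 < p" and s: "0 < s"
    and f: "AE z in circ. f z = g z" and g [measurable]: "g \<in> borel_measurable borel"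
    and Lp: "Lp_energy p g < \<infinity>" and gag: "gagliardo_energy s p g < \<infinity>"
    and neg: "\<And>k. 0 < k \<Longrightarrow> (LINT y|circ. y ^ k * g y) = 0"
  shows "poisson_ext f \<in> disc_functions s p"
    and "AE \<sigma> in circ. ((\<lambda>r::real. poisson_ext f (of_real r * \<sigma>))
        \<longlongrightarrow> g \<sigma>) (at_left 1)"
    and "\<And>r. 0 < r \<Longrightarrow> r < 1 \<Longrightarrow> gagliardo s p (dilate r (poisson_ext f))
        \<le> gagliardo s p g"
proof -
  have ig: "integrable circ g" by (rule integrable_Lp[OF p g Lp])
  have eq: "poisson_ext f z = poisson_integral g z" if "cmod z < 1" for z
    using g f that by (rule poisson_ext_eq)
  have E: "gagliardo_energy s p (dilate r (poisson_ext f)) \<le> gagliardo_energy s p g"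
      if r: "0 < r" "r < 1" for r :: real
  proof -
    have "gagliardo_energy s p (dilate r (poisson_ext f))
        = gagliardo_energy s p (\<lambda>\<xi>. poisson_integral g (of_real r * \<xi>))"
      using r by (intro gagliardo_energy_cong_circle) (simp add: dilate_def eq norm_mult)
    also have "\<dots> \<le> gagliardo_energy s p g"
      using r by (intro gagliardo_energy_poisson_integral_le[OF p _ ig]) simp
    finally show ?thesis .
  qed
  show G: "\<And>r. 0 < r \<Longrightarrow> r
      < 1 \<Longrightarrow> gagliardo s p (dilate r (poisson_ext f)) \<le> gagliardo s p g"
    using p E gag by (intro gagliardo_mono) auto
  have hol: "poisson_ext f holomorphic_on ball 0 1"
  proof (rule power_series_holomorphic)
    fix w :: complex assume "w \<in> ball 0 1"
    then show "(\<lambda>k. (LINT y|circ. cnj y ^ k * g y) / of_real (2 * pi) * (w - 0) ^ k)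
        sums poisson_ext f w"
      using poisson_integral_sums[OF _ ig neg, of w] by (simp add: eq)
  qed
  have "gagliardo_energy s p (dilate r (poisson_ext f)) < \<infinity>" if "0 < r" "r < 1" for r :: real
    using E[OF that] gag by (rule order_le_less_trans)
  then show "poisson_ext f \<in> disc_functions s p"
    using hol G unfolding disc_functions_def by (auto simp: poisson_ext_def intro!: bdd_aboveI2)
  have "AE \<sigma> in circ. gagliardo_at s p g \<sigma> \<noteq> \<infinity>"
    using gag by (intro nn_integral_PInf_AE) (auto simp: gagliardo_energy_circ)
  with AE_circ_norm show "AE \<sigma> in circ. ((\<lambda>r::real. poisson_ext f (of_real r * \<sigma>))
      \<longlongrightarrow> g \<sigma>) (at_left 1)"
  proof eventually_elim
    case (elim \<sigma>)
    then obtain B where B: "0 \<le> B" "gagliardo_at s p g \<sigma> = ennreal B"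
      by (metis ennreal_cases infinity_ennreal_def)
    show ?case
    proof (rule tendstoI)
      fix e :: real assume e: "0 < e"
      \<comment> \<open>Chosen so that the bound e' B is at most (e/2)^p; the summand 1 allows B =
        0.\<close>
      define e' where "e' = (e / 2) powr p / (B + 1)"
      have e': "0 < e'" "e' * B \<le> (e / 2) powr p"
        using e B(1) by (auto simp: e'_def field_simps)
      obtain R where R: "0 < R" "R < 1"
        "\<And>r g \<sigma>. \<lbrakk>R \<le> r; r < 1; integrable circ g; cmod \<sigma>
            = 1\<rbrakk> \<Longrightarrow>
           ennreal (cmod (poisson_integral g (of_real r * \<sigma>) - g \<sigma>) powr p)
               \<le> ennreal e' * gagliardo_at s p g \<sigma>"
        using poisson_approx[OF p s e'(1)] by metis
      have "dist (poisson_ext f (of_real r * \<sigma>)) (g \<sigma>) < e" if r: "R < r" "r < 1" for r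
      proof -
        have "ennreal (cmod (poisson_integral g (of_real r * \<sigma>) - g \<sigma>) powr p)
            \<le> ennreal e' * gagliardo_at s p g \<sigma>"
          using R(3) r ig elim(1) by simp
        also have "\<dots> = ennreal (e' * B)" using e' B by (simp add: ennreal_mult)
        also have "\<dots> \<le> ennreal ((e / 2) powr p)" using e' by (intro ennreal_leI)
        finally have "cmod (poisson_integral g (of_real r * \<sigma>) - g \<sigma>) powr p
            \<le> (e / 2) powr p" by simp
        then have "cmod (poisson_integral g (of_real r * \<sigma>) - g \<sigma>) \<le> e / 2"
          using e p powr_less_mono2[of p "e / 2" "cmod (poisson_integral g (of_real r
              * \<sigma>) - g \<sigma>)"] by force
        moreover have "cmod (of_real r * \<sigma>) < 1" using r R elim(1) by (simp add: norm_mult)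
        ultimately show ?thesis using e by (simp add: eq dist_norm)
      qed
      then show "\<forall>\<^sub>F r in at_left 1. dist (poisson_ext f (of_real r
          * \<sigma>)) (g \<sigma>) < e"
        using eventually_at_left_field R(2) by blast
    qed
  qed
qed

lemma boundary_trace_AE:
  assumes "AE \<sigma> in circ. ((\<lambda>r::real. u (of_real r * \<sigma>))
      \<longlongrightarrow> g \<sigma>) (at_left 1)"
  shows "AE \<sigma> in circ. boundary_trace u \<sigma> = g \<sigma>"
  using assms
proof eventually_elim
  case (elim \<sigma>)
  then show ?case unfolding boundary_trace_def
    by (intro tendsto_Lim) (auto simp: trivial_limit_at_left_real)
qed

section \<open>Norms on the circle and point evaluation\<close>

lemma Lp_norm_cong: "AE z in circ. f z = g z \<Longrightarrow> Lp_norm p f = Lp_norm p g"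
  by (simp add: Lp_norm_def Lp_energy_cong)

lemma gagliardo_cong: "AE z in circ. f z = g z \<Longrightarrow> gagliardo s p f = gagliardo s p g"
  by (simp add: gagliardo_def gagliardo_energy_cong)

lemma Lp_norm_pnorm: "f \<in> borel_measurable borel \<Longrightarrow> Lp_norm p f = pnorm circ p f"
  by (simp add: Lp_norm_def pnorm_def Lp_energy_circ)

lemma Lp_norm_powr:
  assumes "0 < p" "Lp_energy p f < \<infinity>"
  shows "ennreal (Lp_norm p f powr p) = Lp_energy p f"
  using assms by (simp add: Lp_norm_def powr_powr ennreal_enn2real_if)

lemma Lp_norm_leI:
  assumes "0 < p" "0 \<le> a" "Lp_energy p f \<le> ennreal (a powr p)"
  shows "Lp_norm p f \<le> a"
  unfolding Lp_norm_def using assms by (rule enn2real_root_le)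

text \<open>Jensen's inequality together with the bound 2 / (1 - |z|) on the kernel, divided by the
  normalisation 2 pi. At z = 0 the constant is below 1; on |z| <= R it is bounded, which gives
  locally uniform control.\<close>

lemma poisson_integral_le_Lp_norm:
  assumes p: "1 < p" and [measurable]: "g \<in> borel_measurable borel"
      and Lp: "Lp_energy p g < \<infinity>"
    and z: "cmod z < 1"
  shows "cmod (poisson_integral g z) \<le> (1 / (pi * (1 - cmod z))) powr (1 / p) * Lp_norm p g"
proof -
  let ?c = "1 / (pi * (1 - cmod z))"
  have c: "0 < ?c" using z by simp
  have "ennreal (cmod (poisson_integral g z) powr p)
      \<le> (\<integral>\<^sup>+y. ennreal (poisson_density z y / (2 * pi)
          * cmod (g y) powr p) \<partial>circ)"
    using p z by (intro poisson_integral_jensen) auto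
  also have "\<dots> \<le> (\<integral>\<^sup>+y. ennreal ?c * ennreal (cmod (g y) powr p) \<partial>circ)"
  proof (rule nn_integral_mono_AE, use AE_circ_norm in eventually_elim, goal_cases)
    case (1 y)
    have "poisson_density z y / (2 * pi) \<le> 2 / (1 - cmod z) / (2 * pi)"
      using poisson_density_le[OF z 1] by (intro divide_right_mono) auto
    also have "\<dots> = ?c" by simp
    finally have "poisson_density z y / (2 * pi) * cmod (g y) powr p \<le> ?c * cmod (g y) powr p"
      by (intro mult_right_mono) auto
    then show ?case using c by (simp only: ennreal_mult[symmetric] less_imp_le powr_ge_zero ennreal_leI)
  qed
  also have "\<dots> = ennreal ?c * Lp_energy p g" by (simp add: nn_integral_cmult Lp_energy_circ)
  also have "\<dots> = ennreal (?c * Lp_norm p g powr p)"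
    using c p Lp Lp_norm_powr[of p g] by (simp only: ennreal_mult less_imp_le powr_ge_zero)
  finally have "cmod (poisson_integral g z) powr p \<le> ?c * Lp_norm p g powr p"
    using c by (subst (asm) ennreal_le_iff) auto
  then have "(cmod (poisson_integral g z) powr p) powr (1 / p) \<le> (?c * Lp_norm p g powr p) powr (1 / p)"
    using p by (intro powr_mono2) auto
  also have "\<dots> = ?c powr (1 / p) * (Lp_norm p g powr p) powr (1 / p)" by (rule powr_mult)
  finally show ?thesis using p by (simp add: powr_powr Lp_norm_def)
qed

lemma Lp_energy_const: "Lp_energy p (\<lambda>_. c) = ennreal (2 * pi * cmod c powr p)"
  by (simp add: Lp_energy_circ emeasure_circ ennreal_mult mult.commute)

lemma Lp_norm_const: "0 < p \<Longrightarrow> Lp_norm p (\<lambda>_. c) = (2 * pi) powr (1 / p) * cmod c"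
  by (simp add: Lp_norm_def Lp_energy_const powr_mult powr_powr)

lemma Lp_norm_add:
  assumes p: "1 < p" and [measurable]: "f \<in> borel_measurable borel" "g \<in> borel_measurable borel"
    and fin: "Lp_energy p f < \<infinity>" "Lp_energy p g < \<infinity>"
  shows "Lp_energy p (\<lambda>z. f z + g z) < \<infinity>" "Lp_norm p (\<lambda>z. f z + g z)
      \<le> Lp_norm p f + Lp_norm p g"
proof -
  have 1: "Lp_energy p (\<lambda>z. f z + g z) \<le> ennreal ((Lp_norm p f + Lp_norm p g) powr p)"
    using minkowski[of p f circ g] p fin by (simp add: Lp_energy_circ Lp_norm_pnorm)
  then show "Lp_energy p (\<lambda>z. f z + g z) < \<infinity>" by (rule order_le_less_trans) simp
  show "Lp_norm p (\<lambda>z. f z + g z) \<le> Lp_norm p f + Lp_norm p g"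
    using p 1 by (intro Lp_norm_leI) (auto simp: Lp_norm_def)
qed

text \<open>The p-th root of the denominator is put inside the norm, so the energy is the p-th power
  of an L^p norm, over the product measure, of a quotient linear in f. The triangle inequality for
  the seminorm then is Minkowski's inequality.\<close>

lemma gagliardo_energy_pair:
  assumes [measurable]: "f \<in> borel_measurable borel" and p: "0 < p"
  shows "gagliardo_energy s p f = (\<integral>\<^sup>+x. ennreal (cmod ((f (snd x) - f (fst x))
      / of_real (cmod (snd x - fst x) powr ((1 + s
          * p) / p))) powr p) \<partial>(circ \<Otimes>\<^sub>M circ))"
  (is "_ = integral\<^sup>N _ ?F")
proof -
  have [measurable]: "?F \<in> borel_measurable (circ \<Otimes>\<^sub>M circ)" by measurable
  have "integral\<^sup>N (circ \<Otimes>\<^sub>M circ) ?F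
      = (\<integral>\<^sup>+\<sigma>. \<integral>\<^sup>+\<xi>. ?F (\<sigma>, \<xi>) \<partial>circ \<partial>circ)"
    by (rule circ.nn_integral_fst[symmetric]) measurable
  also have "\<dots> = (\<integral>\<^sup>+\<sigma>. gagliardo_at s p f \<sigma> \<partial>circ)"
    unfolding gagliardo_at_def gagliardo_kernel_def using p
    by (intro nn_integral_cong) (simp add: norm_divide powr_divide powr_powr)
  finally show ?thesis by (simp add: gagliardo_energy_circ)
qed

lemma gagliardo_add:
  assumes p: "1 < p" and [measurable]: "f \<in> borel_measurable borel" "g \<in> borel_measurable borel"
    and fin: "gagliardo_energy s p f < \<infinity>" "gagliardo_energy s p g < \<infinity>"
  shows "gagliardo_energy s p (\<lambda>z. f z + g z) < \<infinity>"
    "gagliardo s p (\<lambda>z. f z + g z) \<le> gagliardo s p f + gagliardo s p g"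
proof -
  define Q where "Q f x = (f (snd x) - f (fst x)) / of_real (cmod (snd x - fst x) powr ((1 + s * p) / p))"
    for f :: "complex \<Rightarrow> complex" and x :: "complex \<times> complex"
  have E: "gagliardo_energy s p h
      = (\<integral>\<^sup>+x. ennreal (cmod (Q h x) powr p) \<partial>(circ \<Otimes>\<^sub>M circ))"
    if "h \<in> borel_measurable borel" for h
    using gagliardo_energy_pair[OF that, of p s] p by (simp add: Q_def)
  have N: "gagliardo s p h = pnorm (circ \<Otimes>\<^sub>M circ) p (Q h)"
      if "h \<in> borel_measurable borel" for h
    using E[OF that] by (simp add: gagliardo_def pnorm_def)
  have [measurable]: "Q h \<in> borel_measurable (circ \<Otimes>\<^sub>M circ)"
      if [measurable]: "h \<in> borel_measurable borel" for h
    unfolding Q_def by measurable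
  have Qadd: "Q (\<lambda>z. f z + g z) x = Q f x + Q g x" for x
    by (simp add: Q_def add_divide_distrib[symmetric])
  have 1: "gagliardo_energy s p (\<lambda>z. f z + g z)
      \<le> ennreal ((gagliardo s p f + gagliardo s p g) powr p)"
    using minkowski[of p "Q f" "circ \<Otimes>\<^sub>M circ" "Q g"] p fin by (simp add: E N Qadd)
  then show "gagliardo_energy s p (\<lambda>z. f z + g z) < \<infinity>" by (rule order_le_less_trans) simp
  show "gagliardo s p (\<lambda>z. f z + g z) \<le> gagliardo s p f + gagliardo s p g"
    using p 1 gagliardo_nonneg[of s p] by (intro gagliardo_leI) auto
qed

lemma Lp_energy_scale:
  assumes [measurable]: "f \<in> borel_measurable borel"
  shows "Lp_energy p (\<lambda>z. c * f z) = ennreal (cmod c powr p) * Lp_energy p f"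
  by (simp add: Lp_energy_circ norm_mult powr_mult ennreal_mult nn_integral_cmult)

lemma gagliardo_energy_scale:
  assumes [measurable]: "f \<in> borel_measurable borel"
  shows "gagliardo_energy s p (\<lambda>z. c * f z) = ennreal (cmod c powr p) * gagliardo_energy s p f"
proof -
  have "gagliardo_kernel s p (\<lambda>z. c * f z) \<sigma> \<xi>
      = ennreal (cmod c powr p) * gagliardo_kernel s p f \<sigma> \<xi>" for \<sigma> \<xi>
    by (simp add: gagliardo_kernel_def right_diff_distrib[symmetric] norm_mult powr_mult ennreal_mult[symmetric])
  then have "gagliardo_at s p (\<lambda>z. c * f z) \<sigma>
      = ennreal (cmod c powr p) * gagliardo_at s p f \<sigma>" for \<sigma>
    by (simp add: gagliardo_at_def nn_integral_cmult)
  then show ?thesis by (simp add: gagliardo_energy_circ nn_integral_cmult)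
qed

lemma Lp_norm_scale:
  assumes "f \<in> borel_measurable borel" "0 < p"
  shows "Lp_norm p (\<lambda>z. c * f z) = cmod c * Lp_norm p f"
  using assms by (simp add: Lp_norm_def Lp_energy_scale enn2real_mult powr_mult powr_powr)

lemma gagliardo_scale:
  assumes "f \<in> borel_measurable borel" "0 < p"
  shows "gagliardo s p (\<lambda>z. c * f z) = cmod c * gagliardo s p f"
  using assms by (simp add: gagliardo_def gagliardo_energy_scale enn2real_mult powr_mult powr_powr)

text \<open>Points of the circle are at distance at most 2, so the Gagliardo kernel dominates 2^(-(1
  + s p)) |g y - g \<sigma>|^p. Jensen's inequality bounds |g \<sigma> - mean|^p by an average of
  such differences over y.\<close>

lemma poincare_inequality:
  assumes p: "1 < p" and s: "0 < s" and g [measurable]: "g \<in> borel_measurable borel" 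
    and Lp: "Lp_energy p g < \<infinity>" and gag: "gagliardo_energy s p g < \<infinity>"
  shows "Lp_norm p (\<lambda>z. g z - poisson_integral g 0)
      \<le> (2 powr (1 + s * p)) powr (1 / p) * gagliardo s p g"
proof -
  have ig: "integrable circ g" by (rule integrable_Lp[OF p g Lp])
  have "Lp_energy p (\<lambda>z. g z - poisson_integral g 0)
      = (\<integral>\<^sup>+\<sigma>. ennreal (cmod (g \<sigma> - poisson_integral g 0) powr p) \<partial>circ)"
    by (rule Lp_energy_circ) measurable
  also have "\<dots> \<le> (\<integral>\<^sup>+\<sigma>. ennreal (2 powr (1 + s * p))
      * gagliardo_at s p g \<sigma> \<partial>circ)"
  proof (rule nn_integral_mono_AE, use AE_circ_norm in eventually_elim, goal_cases)
    case (1 \<sigma>)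
    have "ennreal (cmod (poisson_integral (\<lambda>y. g y - g \<sigma>) 0) powr p)
        \<le> (\<integral>\<^sup>+y. ennreal (poisson_density 0 y / (2 * pi)
            * cmod (g y - g \<sigma>) powr p) \<partial>circ)"
      using p by (intro poisson_integral_jensen) auto
    also have "\<dots> \<le> (\<integral>\<^sup>+y. ennreal (2 powr (1 + s * p))
        * gagliardo_kernel s p g \<sigma> y \<partial>circ)"
    proof (rule nn_integral_mono_AE, use AE_circ_norm in eventually_elim, goal_cases)
      case (1 y)
      have "poisson_density 0 y / (2 * pi) * cmod (g y - g \<sigma>) powr p
          \<le> 1 * cmod (g y - g \<sigma>) powr p"
        using 1 pi_ge_two by (intro mult_right_mono) (auto simp: poisson_density_def)
      also have "\<dots> \<le> 2 powr (1 + s * p)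
          * (cmod (g y - g \<sigma>) powr p / cmod (y - \<sigma>) powr (1 + s * p))"
      proof (cases "y = \<sigma>")
        case False
        have "cmod (y - \<sigma>) \<le> 2" using norm_triangle_ineq4[of y \<sigma>] 1 \<open>cmod \<sigma>
            = 1\<close> by simp
        then have "cmod (y - \<sigma>) powr (1 + s * p) \<le> 2 powr (1 + s * p)"
          using p s by (intro powr_mono2) auto
        then show ?thesis
          using False mult_right_mono[of "cmod (y - \<sigma>) powr (1 + s * p)" "2 powr (1 + s
              * p)" "cmod (g y - g \<sigma>) powr p"]
          by (simp add: pos_le_divide_eq mult.commute)
      qed simp
      finally show ?case
        by (simp add: gagliardo_kernel_def ennreal_mult[symmetric] ennreal_leI)
    qed
    also have "\<dots> = ennreal (2 powr (1 + s * p)) * gagliardo_at s p g \<sigma>"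
      unfolding gagliardo_at_def by (rule nn_integral_cmult) measurable
    finally show ?case
      using ig by (simp add: poisson_integral_diff_const norm_minus_commute)
  qed
  also have "\<dots> = ennreal (2 powr (1 + s * p)) * gagliardo_energy s p g"
    by (simp add: nn_integral_cmult gagliardo_energy_circ)
  also have "\<dots> = ennreal (((2 powr (1 + s * p)) powr (1 / p) * gagliardo s p g) powr p)"
    using p gag gagliardo_powr[of p s g] by (simp add: powr_mult powr_powr ennreal_mult)
  finally show ?thesis
    using p gagliardo_nonneg by (intro Lp_norm_leI) auto
qed

text \<open>Boundedness of the trace and completeness of the Besov space are asserted without
  reference to any \<kappa>, so some constant has to be produced.\<close>

lemma poincare_constant_exists:
  assumes p: "1 < p" and s: "0 < s"
  shows "\<exists>\<kappa>. poincare_constant s p \<kappa>"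
proof -
  let ?\<kappa> = "(2 powr (1 + s * p)) powr (1 / p)"
  have "Lp_norm p (\<lambda>z. f z - circle_mean f) \<le> ?\<kappa> * gagliardo s p f"
      if f: "f \<in> sobolev_functions s p" for f
  proof -
    obtain g where g: "g \<in> borel_measurable borel" "AE z in circ. f z = g z"
      "Lp_energy p g < \<infinity>" "gagliardo_energy s p g < \<infinity>"
      using sobolev_rep[OF f] by metis
    have "Lp_norm p (\<lambda>z. f z - circle_mean f) = Lp_norm p (\<lambda>z. g z - poisson_integral g 0)"
      unfolding circle_mean_eq[OF g(1,2)] by (rule Lp_norm_cong, use g(2) in eventually_elim) simp
    then show ?thesis
      using poincare_inequality[OF p s g(1,3,4)] gagliardo_cong[OF g(2)] by simp
  qed
  then have "poincare_constant s p ?\<kappa>" by (simp add: poincare_constant_def)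
  then show ?thesis ..
qed

section \<open>The space of analytic functions\<close>

lemma disc_norm_eq: "disc_norm s p u = cmod (u 0) + gagliardo_sup s p u"
  by (simp add: disc_norm_def gagliardo_sup_def)

lemma disc_functionsD:
  assumes "u \<in> disc_functions s p"
  shows "u holomorphic_on ball 0 1" "\<And>z. z \<notin> ball 0 1 \<Longrightarrow> u z = 0"
    "\<And>r. 0 < r \<Longrightarrow> r < 1 \<Longrightarrow> gagliardo_energy s p (dilate r u)
        < \<infinity>"
    "\<And>r. dilate r u \<in> borel_measurable borel"
proof -
  show h: "u holomorphic_on ball 0 1" and z: "\<And>z. z \<notin> ball 0 1 \<Longrightarrow> u z = 0"
    and "\<And>r. 0 < r \<Longrightarrow> r < 1 \<Longrightarrow> gagliardo_energy s p (dilate r u)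
        < \<infinity>"
    using assms by (auto simp: disc_functions_def)
  show "\<And>r. dilate r u \<in> borel_measurable borel" using h z by (rule measurable_dilate)
qed

lemma gagliardo_sup_leI:
  assumes "\<And>r. 0 < r \<Longrightarrow> r < 1 \<Longrightarrow> gagliardo s p (dilate r u) \<le> M"
  shows "gagliardo_sup s p u \<le> M"
  unfolding gagliardo_sup_def using assms by (intro cSUP_least) auto

lemma disc_functionsI:
  assumes "u holomorphic_on ball 0 1" "\<And>z. z \<notin> ball 0 1 \<Longrightarrow> u z = 0"
    and "\<And>r. 0 < r \<Longrightarrow> r < 1 \<Longrightarrow> gagliardo_energy s p (dilate r u)
        < \<infinity>"
    and "\<And>r. 0 < r \<Longrightarrow> r < 1 \<Longrightarrow> gagliardo s p (dilate r u) \<le> M"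
  shows "u \<in> disc_functions s p"
  unfolding disc_functions_def using assms by (auto intro!: bdd_aboveI2)

context
  fixes s p :: real
  assumes p: "1 < p" and s: "0 < s"
begin

text \<open>The Borel function g from \<open>disc_trace\<close> equals the trace almost everywhere,
  so all quantities attached to the trace are computed from g.\<close>

lemma trace_besov:
  assumes u: "u \<in> disc_functions s p"
  shows "boundary_trace u \<in> besov_plus_functions s p"
    and "poisson_ext (boundary_trace u) = u"
    and "gagliardo s p (boundary_trace u) \<le> gagliardo_sup s p u"
    and "disc_norm s p u \<le> sobolev_norm s p (boundary_trace u)"
    and "circle_mean (boundary_trace u) = u 0"
proof -
  obtain g where g: "g \<in> borel_measurable borel"
    "AE \<sigma> in circ. ((\<lambda>r::real. u (of_real r * \<sigma>))
        \<longlongrightarrow> g \<sigma>) (at_left 1)"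
    "Lp_energy p g < \<infinity>" "gagliardo_energy s p g \<le> ennreal (gagliardo_sup s p u powr p)"
    "\<And>k. 0 < k \<Longrightarrow> (LINT y|circ. y ^ k * g y) = 0"
    "\<And>z. cmod z < 1 \<Longrightarrow> poisson_integral g z = u z"
    using that by (rule disc_trace[OF p s u])
  have gf: "gagliardo_energy s p g < \<infinity>"
    using g(4) by (rule order_le_less_trans) simp
  have ae: "AE \<sigma> in circ. boundary_trace u \<sigma> = g \<sigma>"
    using g(2) by (rule boundary_trace_AE)
  show "boundary_trace u \<in> besov_plus_functions s p"
    by (rule besov_plus_functionsI[OF g(1) ae g(3) gf g(5)])
  show ext: "poisson_ext (boundary_trace u) = u"
  proof
    fix z
    show "poisson_ext (boundary_trace u) z = u z"
      using poisson_ext_eq[OF g(1) ae, of z] g(6)[of z] disc_functionsD(2)[OF u, of z]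
      by (cases "cmod z < 1") (auto simp: poisson_ext_def)
  qed
  show "gagliardo s p (boundary_trace u) \<le> gagliardo_sup s p u"
    unfolding gagliardo_cong[OF ae] using p gagliardo_sup_nonneg[OF u] g(4) by (intro gagliardo_leI) auto
  \<comment> \<open>Since u is the Poisson extension of its own trace, the averaging estimate for
    Poisson extensions applies to its dilates.\<close>
  have "gagliardo s p (dilate r u) \<le> gagliardo s p g" if "0 < r" "r < 1" for r
    using poisson_ext_disc(3)[OF p s ae g(1,3) gf g(5) that] by (simp add: ext)
  then have "gagliardo_sup s p u \<le> gagliardo s p g" by (rule gagliardo_sup_leI)
  moreover have "cmod (u 0) \<le> Lp_norm p g"
  proof -
    have "cmod (u 0) \<le> (1 / pi) powr (1 / p) * Lp_norm p g"
      using poisson_integral_le_Lp_norm[OF p g(1,3), of 0] g(6)[of 0] by simp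
    also have "\<dots> \<le> 1 powr (1 / p) * Lp_norm p g"
      using p pi_ge_two by (intro mult_right_mono powr_mono2) (auto simp: Lp_norm_def)
    finally show ?thesis by simp
  qed
  ultimately show "disc_norm s p u \<le> sobolev_norm s p (boundary_trace u)"
    by (simp add: disc_norm_eq sobolev_norm_def gagliardo_cong[OF ae] Lp_norm_cong[OF ae])
  show "circle_mean (boundary_trace u) = u 0"
    using circle_mean_eq[OF g(1) ae] g(6)[of 0] by simp
qed

text \<open>Origin of C: subtracting the mean u(0) costs at most \<kappa> times the seminorm by
  Poincare's inequality, and the constant u(0) has L^p norm (2 pi)^(1/p) |u(0)|. Adding the seminorm
  itself gives the coefficients \<kappa> + 1 and (2 pi)^(1/p), both at most 1 + C.\<close>

lemma sobolev_norm_trace_le: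
  assumes u: "u \<in> disc_functions s p" and \<kappa>: "poincare_constant s p \<kappa>"
  shows "sobolev_norm s p (boundary_trace u)
      \<le> (1 + (\<kappa> + (2 * pi) powr (1 / p))) * disc_norm s p u"
proof -
  let ?f = "boundary_trace u"
  have f: "?f \<in> sobolev_functions s p"
    using trace_besov(1)[OF u] by (simp add: besov_plus_functions_def)
  then obtain g where g: "g \<in> borel_measurable borel" "AE z in circ. ?f z = g z"
    "Lp_energy p g < \<infinity>" "gagliardo_energy s p g < \<infinity>"
    using sobolev_rep by metis
  have \<kappa>0: "0 < \<kappa>" using \<kappa> by (simp add: poincare_constant_def)
  have "Lp_norm p (\<lambda>z. g z - u 0) = Lp_norm p (\<lambda>z. ?f z - circle_mean ?f)"
    unfolding trace_besov(5)[OF u] by (rule Lp_norm_cong, use g(2) in eventually_elim) simp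
  also have "\<dots> \<le> \<kappa> * gagliardo s p ?f"
    using \<kappa> f by (simp add: poincare_constant_def)
  also have "\<dots> \<le> \<kappa> * gagliardo_sup s p u"
    using \<kappa>0 trace_besov(3)[OF u] by (intro mult_left_mono) auto
  finally have 1: "Lp_norm p (\<lambda>z. g z - u 0) \<le> \<kappa> * gagliardo_sup s p u" .
  have fin: "Lp_energy p (\<lambda>z. g z + (- u 0)) < \<infinity>"
    using p g by (intro Lp_norm_add) (auto simp: Lp_energy_const)
  have "Lp_norm p (\<lambda>z. (g z + (- u 0)) + u 0)
      \<le> Lp_norm p (\<lambda>z. g z + (- u 0)) + Lp_norm p (\<lambda>_. u 0)"
    by (rule Lp_norm_add(2)) (use p g fin in \<open>auto simp: Lp_energy_const\<close>)
  then have "Lp_norm p ?f \<le> \<kappa> * gagliardo_sup s p u + (2 * pi) powr (1 / p) * cmod (u 0)"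
    using 1 p by (simp add: Lp_norm_cong[OF g(2)] Lp_norm_const)
  then have "sobolev_norm s p ?f
      \<le> (\<kappa> + 1) * gagliardo_sup s p u + (2 * pi) powr (1 / p) * cmod (u 0)"
    using trace_besov(3)[OF u] by (simp add: sobolev_norm_def algebra_simps)
  also have "\<dots> \<le> (1 + (\<kappa> + (2 * pi) powr (1 / p))) * gagliardo_sup s p u
      + (1 + (\<kappa> + (2 * pi) powr (1 / p))) * cmod (u 0)"
  proof -
    have "\<kappa> + 1 \<le> 1 + (\<kappa> + (2 * pi) powr (1 / p))"
      "(2 * pi) powr (1 / p) \<le> 1 + (\<kappa> + (2 * pi) powr (1 / p))"
      using \<kappa>0 by auto
    then show ?thesis
      using gagliardo_sup_nonneg[OF u] by (intro add_mono[OF mult_right_mono mult_right_mono]) auto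
  qed
  finally show ?thesis by (simp add: disc_norm_eq algebra_simps)
qed

lemma disc_norm_nonneg: "u \<in> disc_functions s p \<Longrightarrow> 0 \<le> disc_norm s p u"
  using gagliardo_sup_nonneg by (simp add: disc_norm_eq)

text \<open>Makes the norm definite and turns norm-Cauchy sequences into locally uniformly Cauchy
  ones. The proof passes through the trace, as u is the Poisson integral of its boundary
  values.\<close>

lemma point_evaluation_bound:
  obtains K where "0 \<le> K"
    "\<And>u z. u \<in> disc_functions s p \<Longrightarrow> cmod z < 1 \<Longrightarrow>
      cmod (u z) \<le> (1 / (pi * (1 - cmod z))) powr (1 / p) * (K * disc_norm s p u)"
proof -
  obtain \<kappa> where \<kappa>: "poincare_constant s p \<kappa>" using poincare_constant_exists[OF p s]
      by blast
  let ?K = "1 + (\<kappa> + (2 * pi) powr (1 / p))"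
  show ?thesis
  proof (rule that)
    show "0 \<le> ?K" using \<kappa> by (auto simp: poincare_constant_def)
    fix u z assume u: "u \<in> disc_functions s p" and z: "cmod z < 1"
    have "boundary_trace u \<in> sobolev_functions s p"
      using trace_besov(1)[OF u] by (simp add: besov_plus_functions_def)
    then obtain g where g: "g \<in> borel_measurable borel" "AE z in circ. boundary_trace u z = g z"
      "Lp_energy p g < \<infinity>" "gagliardo_energy s p g < \<infinity>"
      using sobolev_rep by metis
    have "u z = poisson_integral g z"
      using poisson_ext_eq[OF g(1,2) z] trace_besov(2)[OF u] by simp
    then have "cmod (u z) \<le> (1 / (pi * (1 - cmod z))) powr (1 / p) * Lp_norm p g"
      using poisson_integral_le_Lp_norm[OF p g(1,3) z] by simp
    also have "Lp_norm p g \<le> sobolev_norm s p (boundary_trace u)"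
      using gagliardo_nonneg by (simp add: sobolev_norm_def Lp_norm_cong[OF g(2)])
    also have "\<dots> \<le> ?K * disc_norm s p u" by (rule sobolev_norm_trace_le[OF u \<kappa>])
    finally show "cmod (u z) \<le> (1 / (pi * (1 - cmod z))) powr (1 / p) * (?K * disc_norm s p u)"
      by (simp add: mult_left_mono)
  qed
qed

lemma disc_add:
  assumes u: "u \<in> disc_functions s p" and v: "v \<in> disc_functions s p"
  shows "(\<lambda>z. u z + v z) \<in> disc_functions s p"
    and "gagliardo_sup s p (\<lambda>z. u z + v z) \<le> gagliardo_sup s p u + gagliardo_sup s p v"
proof -
  have d: "dilate r (\<lambda>z. u z + v z) = (\<lambda>z. dilate r u z + dilate r v z)" for r
    by (simp add: dilate_def)
  have le: "gagliardo s p (dilate r (\<lambda>z. u z + v z))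
      \<le> gagliardo_sup s p u + gagliardo_sup s p v" if "0 < r" "r < 1" for r
    unfolding d using gagliardo_add(2)[OF p disc_functionsD(4)[OF u] disc_functionsD(4)[OF v]
        disc_functionsD(3)[OF u that] disc_functionsD(3)[OF v that]]
      gagliardo_le_gagliardo_sup[OF u that] gagliardo_le_gagliardo_sup[OF v that] by linarith
  then show "gagliardo_sup s p (\<lambda>z. u z + v z) \<le> gagliardo_sup s p u + gagliardo_sup s p v"
    by (rule gagliardo_sup_leI)
  show "(\<lambda>z. u z + v z) \<in> disc_functions s p"
  proof (rule disc_functionsI[OF _ _ _ le])
    fix r :: real assume r: "0 < r" "r < 1"
    show "gagliardo_energy s p (dilate r (\<lambda>z. u z + v z)) < \<infinity>"
      unfolding d by (rule gagliardo_add(1)[OF p disc_functionsD(4)[OF u] disc_functionsD(4)[OF v]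
        disc_functionsD(3)[OF u r] disc_functionsD(3)[OF v r]])
  qed (use disc_functionsD[OF u] disc_functionsD[OF v] in \<open>auto intro: holomorphic_intros\<close>)
qed

lemma disc_scale:
  assumes u: "u \<in> disc_functions s p"
  shows "(\<lambda>z. c * u z) \<in> disc_functions s p"
    and "gagliardo_sup s p (\<lambda>z. c * u z) = cmod c * gagliardo_sup s p u"
proof -
  have d: "dilate r (\<lambda>z. c * u z) = (\<lambda>z. c * dilate r u z)" for r
    by (simp add: dilate_def)
  have g: "gagliardo s p (dilate r (\<lambda>z. c * u z)) = cmod c * gagliardo s p (dilate r u)" for r
    unfolding d using p disc_functionsD(4)[OF u] by (intro gagliardo_scale) auto
  have le: "gagliardo s p (dilate r (\<lambda>z. c * u z)) \<le> cmod c * gagliardo_sup s p u"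
      if "0 < r" "r < 1" for r
    unfolding g using gagliardo_le_gagliardo_sup[OF u that] by (intro mult_left_mono) auto
  show c: "(\<lambda>z. c * u z) \<in> disc_functions s p"
  proof (rule disc_functionsI[OF _ _ _ le])
    fix r :: real assume r: "0 < r" "r < 1"
    show "gagliardo_energy s p (dilate r (\<lambda>z. c * u z)) < \<infinity>"
      unfolding d gagliardo_energy_scale[OF disc_functionsD(4)[OF u]]
      using disc_functionsD(3)[OF u r] by (simp add: ennreal_mult_less_top)
  qed (use disc_functionsD[OF u] in \<open>auto intro: holomorphic_intros\<close>)
  show "gagliardo_sup s p (\<lambda>z. c * u z) = cmod c * gagliardo_sup s p u"
  proof (rule antisym)
    show "gagliardo_sup s p (\<lambda>z. c * u z) \<le> cmod c * gagliardo_sup s p u"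
      using le by (rule gagliardo_sup_leI)
    show "cmod c * gagliardo_sup s p u \<le> gagliardo_sup s p (\<lambda>z. c * u z)"
    proof (cases "c = 0")
      case False
      have "gagliardo s p (dilate r u) \<le> gagliardo_sup s p (\<lambda>z. c * u z) / cmod c"
          if "0 < r" "r < 1" for r
        using gagliardo_le_gagliardo_sup[OF c that] False by (simp add: g pos_le_divide_eq mult.commute)
      then have "gagliardo_sup s p u \<le> gagliardo_sup s p (\<lambda>z. c * u z) / cmod c"
          by (rule gagliardo_sup_leI)
      then show ?thesis using False by (simp add: pos_le_divide_eq mult.commute)
    qed (use gagliardo_sup_nonneg[OF c] in simp)
  qed
qed

lemma disc_zero: "(\<lambda>z. 0) \<in> disc_functions s p" "disc_norm s p (\<lambda>z. 0) = 0"
proof -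
  have "gagliardo_energy s p (dilate r (\<lambda>z. 0)) = 0" for r
    by (simp add: gagliardo_energy_def dilate_def)
  then have E: "gagliardo_energy s p (dilate r (\<lambda>z. 0))
      = 0" "gagliardo s p (dilate r (\<lambda>z. 0)) = 0" for r
    by (simp_all add: gagliardo_def)
  show z: "(\<lambda>z. 0) \<in> disc_functions s p"
    by (rule disc_functionsI[where M = 0]) (auto simp: E)
  have "gagliardo_sup s p (\<lambda>z. 0) \<le> 0" by (rule gagliardo_sup_leI) (simp add: E)
  then show "disc_norm s p (\<lambda>z. 0) = 0"
    using gagliardo_sup_nonneg[OF z] by (simp add: disc_norm_eq)
qed

lemma disc_diff:
  assumes u: "u \<in> disc_functions s p" and v: "v \<in> disc_functions s p"
  shows "(\<lambda>z. u z - v z) \<in> disc_functions s p"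
  using disc_add(1)[OF u disc_scale(1)[OF v, of "-1"]] by simp

text \<open>The limit is locally uniform, hence holomorphic. Its distance in the seminorm is
  estimated circle by circle: for fixed n and r, Fatou's lemma in m is applied to the dilates of
  \<open>X n - X m\<close>.\<close>

lemma disc_complete:
  assumes X: "\<And>n. X n \<in> disc_functions s p"
    and C: "\<And>e. 0 < e \<Longrightarrow> \<exists>N. \<forall>m\<ge>N. \<forall>n\<ge>N. disc_norm s p (\<lambda>z. X m z - X n z) < e"
  obtains u where "u \<in> disc_functions s p" "(\<lambda>n. disc_norm s p (\<lambda>z. X n z - u z))
      \<longlonglongrightarrow> 0"
proof -
  obtain K where K: "0 \<le> K"
    "\<And>u z. u \<in> disc_functions s p \<Longrightarrow> cmod z < 1 \<Longrightarrow>
      cmod (u z) \<le> (1 / (pi * (1 - cmod z))) powr (1 / p) * (K * disc_norm s p u)"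
    using point_evaluation_bound by metis
  define L where "L R = (1 / (pi * (1 - R))) powr (1 / p) * K" for R :: real
  have L0: "0 \<le> L R" for R using K(1) by (simp add: L_def)
  have pt: "cmod (X m z - X n z) \<le> L R * disc_norm s p (\<lambda>z. X m z - X n z)"
    if "cmod z \<le> R" "R < 1" for m n z R
  proof -
    have "cmod (X m z - X n z)
        \<le> (1 / (pi * (1 - cmod z))) powr (1 / p) * (K * disc_norm s p (\<lambda>z. X m z - X n z))"
      using K(2)[OF disc_diff[OF X X], of z m n] that by simp
    also have "\<dots> \<le> (1 / (pi * (1 - R))) powr (1 / p)
        * (K * disc_norm s p (\<lambda>z. X m z - X n z))"
      using that p K(1) disc_norm_nonneg[OF disc_diff[OF X X]]
      by (intro mult_right_mono powr_mono2 divide_left_mono mult_left_mono) auto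
    finally show ?thesis by (simp add: L_def mult.assoc)
  qed
  have uc: "\<exists>N. \<forall>m\<ge>N. \<forall>n\<ge>N. \<forall>z. cmod z
      \<le> R \<longrightarrow> cmod (X m z - X n z) < e" if R: "R < 1" and e: "0 < e" for R e
  proof -
    obtain N where N: "\<forall>m\<ge>N. \<forall>n\<ge>N. disc_norm s p (\<lambda>z. X m z - X n z)
        < e / (L R + 1)"
      using C[of "e / (L R + 1)"] e L0[of R] by auto
    have "cmod (X m z - X n z) < e" if "N \<le> m" "N \<le> n" "cmod z \<le> R" for m n z
    proof -
      have "cmod (X m z - X n z) \<le> L R * disc_norm s p (\<lambda>z. X m z - X n z)"
        by (rule pt[OF that(3) R])
      also have "\<dots> \<le> L R * (e / (L R + 1))"
        using N that L0[of R] by (intro mult_left_mono) (auto intro: less_imp_le)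
      also have "\<dots> < e" using e L0[of R] by (simp add: field_simps)
      finally show ?thesis .
    qed
    then show ?thesis by blast
  qed
  \<comment> \<open>Outside the disc every \<open>X n\<close> vanishes, so the pointwise limit
    respects the convention of extension by 0.\<close>
  define u where "u z = lim (\<lambda>n. X n z)" for z
  have lim: "(\<lambda>n. X n z) \<longlonglongrightarrow> u z" for z
  proof (cases "cmod z < 1")
    case True
    have "Cauchy (\<lambda>n. X n z)"
    proof (rule metric_CauchyI)
      fix e :: real assume "0 < e"
      then obtain N where "\<forall>m\<ge>N. \<forall>n\<ge>N. \<forall>w. cmod w
          \<le> cmod z \<longrightarrow> cmod (X m w - X n w) < e"
        using uc[OF True] by blast
      then show "\<exists>N. \<forall>m\<ge>N. \<forall>n\<ge>N. dist (X m z) (X n z) < e"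
        unfolding dist_norm by auto
    qed
    then show ?thesis unfolding u_def using Cauchy_convergent_iff convergent_LIMSEQ_iff by blast
  next
    case False
    then have "X n z = 0" for n using disc_functionsD(2)[OF X, of z n] by simp
    then show ?thesis by (simp add: u_def)
  qed
  have uzero: "u z = 0" if "z \<notin> ball 0 1" for z
    using disc_functionsD(2)[OF X that] by (simp add: u_def)
  have hol: "u holomorphic_on ball 0 1"
  proof (rule holomorphic_uniform_sequence[of _ X])
    fix x :: complex assume "x \<in> ball 0 1"
    then have x: "cmod x < 1" by simp
    define R where "R = (1 + cmod x) / 2"
    have R: "cmod x < R" "R < 1" using x by (auto simp: R_def)
    have sub: "cmod z \<le> R" if "z \<in> cball x (R - cmod x)" for z
      using that norm_triangle_sub[of z x] by (simp add: dist_norm norm_minus_commute)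
    have "uniform_limit (cball x (R - cmod x)) X u sequentially"
    proof (rule uniform_limitI)
      fix e :: real assume e: "0 < e"
      obtain N where N: "\<And>m n z. N \<le> m \<Longrightarrow> N \<le> n \<Longrightarrow> cmod z
          \<le> R \<Longrightarrow> cmod (X m z - X n z) < e / 2"
        using uc[OF R(2), of "e / 2"] e by auto
      have "dist (X n z) (u z) < e" if n: "N \<le> n" and z: "z \<in> cball x (R - cmod x)" for n z
      proof -
        have "(\<lambda>m. cmod (X n z - X m z)) \<longlonglongrightarrow> cmod (X n z - u z)"
          by (intro tendsto_intros lim)
        then have "cmod (X n z - u z) \<le> e / 2"
          by (rule LIMSEQ_le_const2)
              (use N[OF n _ sub[OF z]] in \<open>auto intro!: exI[of _ N] less_imp_le\<close>)
        then show ?thesis using e by (simp add: dist_norm)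
      qed
      then show "\<forall>\<^sub>F n in sequentially. \<forall>x\<in>cball x (R - cmod x). dist (X n x) (u x) < e"
        unfolding eventually_sequentially by blast
    qed
    moreover have "cball x (R - cmod x) \<subseteq> ball 0 1" using sub R(2) by fastforce
    ultimately show "\<exists>d>0. cball x d \<subseteq> ball 0 1
        \<and> uniform_limit (cball x d) X u sequentially"
      using R by (intro exI[of _ "R - cmod x"]) auto
  qed (use disc_functionsD(1)[OF X] in auto)
  have tail: "\<exists>N. \<forall>n\<ge>N. (\<lambda>z. X n z - u z) \<in> disc_functions s p
      \<and> disc_norm s p (\<lambda>z. X n z - u z) \<le> e"
    if e: "0 < e" for e
  proof -
    \<comment> \<open>A norm below e / 2 bounds the value at 0 and the seminorm separately by e / 2;
      the two limits therefore add up to at most e.\<close>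
    obtain N where N: "\<And>m n. N \<le> m \<Longrightarrow> N
        \<le> n \<Longrightarrow> disc_norm s p (\<lambda>z. X m z - X n z) < e / 2"
      using C[of "e / 2"] e by auto
    have "(\<lambda>z. X n z - u z) \<in> disc_functions s p
        \<and> disc_norm s p (\<lambda>z. X n z - u z) \<le> e" if n: "N \<le> n" for n
    proof -
      have E: "gagliardo_energy s p (dilate r (\<lambda>z. X n z - u z)) \<le> ennreal ((e / 2) powr p)"
        if r: "0 < r" "r < 1" for r
      proof -
        have "gagliardo_energy s p (dilate r (\<lambda>z. X n z - u z))
            \<le> liminf (\<lambda>m. gagliardo_energy s p (dilate r (\<lambda>z. X n z - X m z)))"
        proof (rule gagliardo_energy_Fatou)
          show "dilate r (\<lambda>z. X n z - X m z) \<in> borel_measurable borel" for m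
            by (rule disc_functionsD(4)[OF disc_diff[OF X X]])
          show "dilate r (\<lambda>z. X n z - u z) \<in> borel_measurable borel"
            using hol uzero disc_functionsD(1,2)[OF X]
            by (intro measurable_dilate holomorphic_intros) auto
          show "AE \<sigma> in circ. (\<lambda>m. dilate r (\<lambda>z. X n z - X m z) \<sigma>)
              \<longlonglongrightarrow> dilate r (\<lambda>z. X n z - u z) \<sigma>"
            unfolding dilate_def by (intro always_eventually allI tendsto_intros lim)
        qed (use p in auto)
        also have "\<dots> \<le> ennreal ((e / 2) powr p)"
        proof (rule Liminf_le)
          have "gagliardo_energy s p (dilate r (\<lambda>z. X n z - X m z))
              \<le> ennreal ((e / 2) powr p)" if m: "N \<le> m" for m
          proof -
            have "gagliardo_sup s p (\<lambda>z. X n z - X m z) \<le> e / 2"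
              using N[OF n m] norm_ge_zero[of "X n 0 - X m 0"] unfolding disc_norm_eq by linarith
            then have "gagliardo_sup s p (\<lambda>z. X n z - X m z) powr p \<le> (e / 2) powr p"
              using p gagliardo_sup_nonneg[OF disc_diff[OF X X]] by (intro powr_mono2) auto
            then show ?thesis
              using gagliardo_energy_dilate_le[OF _ disc_diff[OF X X] r, of n m] p
              by (meson ennreal_leI order_trans less_trans zero_less_one)
          qed
          then show "\<forall>\<^sub>F m in sequentially. gagliardo_energy s p (dilate r (\<lambda>z. X n z - X m z)) \<le> ennreal ((e / 2) powr p)"
            by (auto simp: eventually_sequentially)
        qed simp
        finally show ?thesis .
      qed
      have le: "gagliardo s p (dilate r (\<lambda>z. X n z - u z)) \<le> e / 2" if "0 < r" "r < 1" for r
        using p e E[OF that] by (intro gagliardo_leI) auto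
      have mem: "(\<lambda>z. X n z - u z) \<in> disc_functions s p"
      proof (rule disc_functionsI[OF _ _ _ le])
        show "gagliardo_energy s p (dilate r (\<lambda>z. X n z - u z)) < \<infinity>" if "0 < r" "r < 1"
            for r
          using E[OF that] by (rule order_le_less_trans) simp
      qed (use hol uzero disc_functionsD(1,2)[OF X] in \<open>auto intro: holomorphic_intros\<close>)
      have "(\<lambda>m. cmod (X n 0 - X m 0)) \<longlonglongrightarrow> cmod (X n 0 - u 0)"
        by (intro tendsto_intros lim)
      then have "cmod (X n 0 - u 0) \<le> e / 2"
      proof (rule LIMSEQ_le_const2)
        have "cmod (X n 0 - X m 0) \<le> e / 2" if "N \<le> m" for m
          using N[OF n that] gagliardo_sup_nonneg[OF disc_diff[OF X X], of n m] unfolding disc_norm_eq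
              by linarith
        then show "\<exists>N. \<forall>m\<ge>N. cmod (X n 0 - X m 0) \<le> e / 2" by blast
      qed
      moreover have "gagliardo_sup s p (\<lambda>z. X n z - u z) \<le> e / 2" using le
          by (rule gagliardo_sup_leI)
      ultimately show ?thesis using mem unfolding disc_norm_eq by auto
    qed
    then show ?thesis by blast
  qed
  obtain N where N: "(\<lambda>z. X N z - u z) \<in> disc_functions s p" using tail[of 1] by auto
  \<comment> \<open>u is the difference of \<open>X N\<close> and \<open>X N - u\<close>, both of
    which lie in the space.\<close>
  have u: "u \<in> disc_functions s p" using disc_diff[OF X[of N] N] by simp
  show ?thesis
  proof (rule that[OF u], rule LIMSEQ_I)
    fix e :: real assume e: "0 < e"
    obtain N where N: "\<And>n. N \<le> n \<Longrightarrow> disc_norm s p (\<lambda>z. X n z - u z)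
        \<le> e / 2"
      using tail[of "e / 2"] e by auto
    have "norm (disc_norm s p (\<lambda>z. X n z - u z) - 0) < e" if "N \<le> n" for n
      using N[OF that] e disc_norm_nonneg[OF disc_diff[OF X u], of n] by simp
    then show "\<exists>N. \<forall>n\<ge>N. norm (disc_norm s p (\<lambda>z. X n z - u z) - 0) < e"
        by blast
  qed
qed

lemma banach_disc_space: "complex_banach_space (disc_space s p)"
proof -
  have vd: "vdiff (disc_space s p) u v = (\<lambda>z. u z - v z)" for u v
    by (simp add: vdiff_def disc_space_def)
  show ?thesis
  proof (unfold_locales, unfold vd)
    fix u assume "u \<in> vcarrier (disc_space s p)"
    then have u: "u \<in> disc_functions s p" by (simp add: disc_space_def)
    obtain K where K: "0 \<le> K"
      "\<And>u z. u \<in> disc_functions s p \<Longrightarrow> cmod z < 1 \<Longrightarrow>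
        cmod (u z) \<le> (1 / (pi * (1 - cmod z))) powr (1 / p) * (K * disc_norm s p u)"
      using point_evaluation_bound by metis
    have "u z = 0" if "disc_norm s p u = 0" for z
      using K(2)[OF u, of z] disc_functionsD(2)[OF u, of z] that by (cases "cmod z < 1") auto
    then show "vnorm (disc_space s p) u = 0 \<longleftrightarrow> u = vzero (disc_space s p)"
      using disc_zero(2) by (auto simp: disc_space_def)
  next
    fix X :: "nat \<Rightarrow> complex \<Rightarrow> complex"
    assume X: "\<And>n. X n \<in> vcarrier (disc_space s p)"
      "\<And>e. 0 < e \<Longrightarrow> \<exists>N. \<forall>m\<ge>N. \<forall>n\<ge>N. vnorm (disc_space s p) (\<lambda>z. X m z - X n z) < e"
    have "\<And>n. X n \<in> disc_functions s p"
      "\<And>e. 0 < e \<Longrightarrow> \<exists>N. \<forall>m\<ge>N. \<forall>n\<ge>N. disc_norm s p (\<lambda>z. X m z - X n z) < e"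
      using X by (simp_all add: disc_space_def)
    then obtain u where "u \<in> disc_functions s p" "(\<lambda>n. disc_norm s p (\<lambda>z. X n z - u z)) \<longlonglongrightarrow> 0"
      by (rule disc_complete)
    then show "\<exists>x\<in>vcarrier (disc_space s p). (\<lambda>n. vnorm (disc_space s p) (\<lambda>z. X n z - x z)) \<longlonglongrightarrow> 0"
      by (intro bexI[of _ u]) (simp_all add: disc_space_def)
  next
    fix u v assume "u \<in> vcarrier (disc_space s p)" "v \<in> vcarrier (disc_space s p)"
    then have uv: "u \<in> disc_functions s p" "v \<in> disc_functions s p"
        by (simp_all add: disc_space_def)
    show "vnorm (disc_space s p) (vadd (disc_space s p) u v)
        \<le> vnorm (disc_space s p) u + vnorm (disc_space s p) v"
      using disc_add(2)[OF uv] norm_triangle_ineq[of "u 0" "v 0"] by (simp add: disc_space_def disc_norm_eq)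
  qed (auto simp: disc_space_def disc_zero disc_add disc_scale disc_norm_nonneg disc_norm_eq
        gagliardo_sup_nonneg norm_mult algebra_simps)
qed

end

section \<open>The trace isomorphism\<close>

abbreviation circle_class :: "(complex \<Rightarrow> complex) \<Rightarrow> (complex \<Rightarrow> complex) set" where
  "circle_class f \<equiv> circle_ae `` {f}"

lemma circle_class_eq_iff: "circle_class f = circle_class g \<longleftrightarrow> (AE z in circ. f z = g z)"
  using eq_equiv_class_iff[OF equiv_circle_ae, of f g] by (simp add: circle_ae_iff)

lemma vadd_circle_class:
  "vadd (besov_plus s p) (circle_class f) (circle_class g) = circle_class (\<lambda>z. f z + g z)"
proof -
  have "(\<Union>f'\<in>circle_class f. \<Union>g'\<in>circle_class g. circle_class (\<lambda>z. f' z
      + g' z)) = circle_class (\<lambda>z. f z + g z)"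
  proof (rule UN_equiv_class2[OF equiv_circle_ae equiv_circle_ae])
    show "congruent2 circle_ae circle_ae (\<lambda>f' g'. circle_class (\<lambda>z. f' z + g' z))"
    proof (rule congruent2I')
      fix f f' g g' assume "(f, f') \<in> circle_ae" "(g, g') \<in> circle_ae"
      then have "AE z in circ. f z = f' z" "AE z in circ. g z = g' z" by (simp_all add: circle_ae_iff)
      then have "AE z in circ. f z + g z = f' z + g' z" by eventually_elim simp
      then show "circle_class (\<lambda>z. f z + g z) = circle_class (\<lambda>z. f' z + g' z)"
        by (simp only: circle_class_eq_iff)
    qed
  qed auto
  then show ?thesis by (simp add: besov_plus_def)
qed

lemma vscale_circle_class:
  "vscale (besov_plus s p) c (circle_class f) = circle_class (\<lambda>z. c * f z)"
proof -
  have "(\<Union>f'\<in>circle_class f. circle_class (\<lambda>z. c * f' z))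
      = circle_class (\<lambda>z. c * f z)"
  proof (rule UN_equiv_class[OF equiv_circle_ae])
    show "(\<lambda>f'. circle_class (\<lambda>z. c * f' z)) respects circle_ae"
    proof (rule congruentI)
      fix f f' assume "(f, f') \<in> circle_ae"
      then have "AE z in circ. f z = f' z" by (simp add: circle_ae_iff)
      then have "AE z in circ. c * f z = c * f' z" by eventually_elim simp
      then show "circle_class (\<lambda>z. c * f z) = circle_class (\<lambda>z. c * f' z)"
        by (simp only: circle_class_eq_iff)
    qed
  qed auto
  then show ?thesis by (simp add: besov_plus_def)
qed

lemma sobolev_norm_cong: "AE z in circ. f z = g z \<Longrightarrow> sobolev_norm s p f = sobolev_norm s p g"
  by (rule sobolev_norm_cong_AE) (simp add: circle_ae_iff)

lemma sobolev_norm_nonneg: "0 \<le> sobolev_norm s p f"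
  by (simp add: sobolev_norm_def Lp_norm_def gagliardo_def)

lemma sobolev_norm_add:
  assumes p: "1 < p" and f: "f \<in> sobolev_functions s p" and g: "g \<in> sobolev_functions s p"
  shows "sobolev_norm s p (\<lambda>z. f z + g z) \<le> sobolev_norm s p f + sobolev_norm s p g"
proof -
  obtain f' where f': "f' \<in> borel_measurable borel" "AE z in circ. f z = f' z"
    "Lp_energy p f' < \<infinity>" "gagliardo_energy s p f' < \<infinity>"
    using sobolev_rep[OF f] by metis
  obtain g' where g': "g' \<in> borel_measurable borel" "AE z in circ. g z = g' z"
    "Lp_energy p g' < \<infinity>" "gagliardo_energy s p g' < \<infinity>"
    using sobolev_rep[OF g] by metis
  have "AE z in circ. f z + g z = f' z + g' z"
    using f'(2) g'(2) by eventually_elim simp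
  then have "sobolev_norm s p (\<lambda>z. f z + g z) = sobolev_norm s p (\<lambda>z. f' z + g' z)"
    by (rule sobolev_norm_cong)
  then show ?thesis
    unfolding sobolev_norm_cong[OF f'(2)] sobolev_norm_cong[OF g'(2)] unfolding sobolev_norm_def
    using Lp_norm_add(2)[OF p f'(1) g'(1) f'(3) g'(3)] gagliardo_add(2)[OF p f'(1) g'(1) f'(4) g'(4)]
    by linarith
qed

lemma sobolev_norm_scale:
  assumes p: "1 < p" and f: "f \<in> sobolev_functions s p"
  shows "sobolev_norm s p (\<lambda>z. c * f z) = cmod c * sobolev_norm s p f"
proof -
  obtain f' where f': "f' \<in> borel_measurable borel" "AE z in circ. f z = f' z"
    "Lp_energy p f' < \<infinity>" "gagliardo_energy s p f' < \<infinity>"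
    using sobolev_rep[OF f] by metis
  have "AE z in circ. c * f z = c * f' z"
    using f'(2) by eventually_elim simp
  then have "sobolev_norm s p (\<lambda>z. c * f z) = sobolev_norm s p (\<lambda>z. c * f' z)"
    by (rule sobolev_norm_cong)
  then show ?thesis
    unfolding sobolev_norm_cong[OF f'(2)] using f'(1) p
        by (simp add: sobolev_norm_def Lp_norm_scale gagliardo_scale distrib_left)
qed

context
  fixes s p :: real
  assumes p: "1 < p" and s: "0 < s"
begin

abbreviation "besov \<equiv> besov_plus s p"

lemma trace_radial_limit:
  assumes u: "u \<in> disc_functions s p"
  shows "AE \<sigma> in circ. ((\<lambda>r::real. u (of_real r * \<sigma>))
      \<longlongrightarrow> boundary_trace u \<sigma>) (at_left 1)"
  using AE_radial_limit[OF p s u]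
proof eventually_elim
  case (elim \<sigma>)
  then obtain l where l: "((\<lambda>r::real. u (of_real r * \<sigma>))
      \<longlongrightarrow> l) (at_left 1)" by blast
  then have "boundary_trace u \<sigma> = l"
    unfolding boundary_trace_def by (intro tendsto_Lim) (auto simp: trivial_limit_at_left_real)
  then show ?case using l by simp
qed

text \<open>\<open>Lim\<close> is unspecified where the radial limit fails to exist, so
  \<open>boundary_trace\<close> is additive only almost everywhere, and linearity holds at the level
  of classes.\<close>

lemma trace_map_add:
  assumes u: "u \<in> disc_functions s p" and v: "v \<in> disc_functions s p"
  shows "vadd besov (trace_map u) (trace_map v) = trace_map (\<lambda>z. u z + v z)"
proof -
  have "AE \<sigma> in circ. ((\<lambda>r::real. u (of_real r * \<sigma>) + v (of_real r * \<sigma>))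
      \<longlongrightarrow> boundary_trace u \<sigma> + boundary_trace v \<sigma>) (at_left 1)"
    using trace_radial_limit[OF u] trace_radial_limit[OF v] by eventually_elim (rule tendsto_add)
  then have "AE \<sigma> in circ. boundary_trace (\<lambda>z. u z + v z) \<sigma>
      = boundary_trace u \<sigma> + boundary_trace v \<sigma>"
    by (rule boundary_trace_AE)
  then show ?thesis
    unfolding trace_map_def vadd_circle_class circle_class_eq_iff by eventually_elim simp
qed

lemma trace_map_scale:
  assumes u: "u \<in> disc_functions s p"
  shows "vscale besov c (trace_map u) = trace_map (\<lambda>z. c * u z)"
proof -
  have "AE \<sigma> in circ. ((\<lambda>r::real. c * u (of_real r * \<sigma>)) \<longlongrightarrow> c
      * boundary_trace u \<sigma>) (at_left 1)"
    using trace_radial_limit[OF u] by eventually_elim (rule tendsto_mult_left)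
  then have "AE \<sigma> in circ. boundary_trace (\<lambda>z. c * u z) \<sigma>
      = c * boundary_trace u \<sigma>"
    by (rule boundary_trace_AE)
  then show ?thesis
    unfolding trace_map_def vscale_circle_class circle_class_eq_iff by eventually_elim simp
qed

lemma trace_map_diff:
  assumes u: "u \<in> disc_functions s p" and v: "v \<in> disc_functions s p"
  shows "vdiff besov (trace_map u) (trace_map v) = trace_map (\<lambda>z. u z - v z)"
  using trace_map_add[OF u disc_scale(1)[OF p s v, of "-1"]] trace_map_scale[OF v, of "-1"]
  by (simp add: vdiff_def)

lemma vnorm_trace_map: "vnorm besov (trace_map u) = sobolev_norm s p (boundary_trace u)"
  by (simp add: trace_map_def vnorm_besov_plus)

lemma trace_poisson:
  assumes f: "f \<in> besov_plus_functions s p"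
  shows "poisson_ext f \<in> disc_functions s p" "trace_map (poisson_ext f) = circle_class f"
proof -
  obtain g where g: "g \<in> borel_measurable borel" "AE z in circ. f z = g z"
    "Lp_energy p g < \<infinity>" "gagliardo_energy s p g < \<infinity>"
    "\<And>k. 0 < k \<Longrightarrow> (LINT y|circ. y ^ k * g y) = 0"
    using that by (rule besov_rep[OF f])
  note ext = poisson_ext_disc[OF p s g(2,1,3,4,5)]
  show "poisson_ext f \<in> disc_functions s p" by (rule ext(1))
  have "AE \<sigma> in circ. boundary_trace (poisson_ext f) \<sigma> = g \<sigma>"
    by (rule boundary_trace_AE[OF ext(2)])
  then show "trace_map (poisson_ext f) = circle_class f"
    unfolding trace_map_def circle_class_eq_iff using g(2) by eventually_elim simp
qed

text \<open>Injectivity: u is recovered from its trace by the Poisson extension, which depends only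
  on the class. Surjectivity: the Poisson extension of a representative has that class as
  trace.\<close>

lemma bij_trace_map: "bij_betw trace_map (disc_functions s p) (vcarrier besov)"
proof -
  have car: "vcarrier besov = besov_plus_functions s p // circle_ae"
    by (simp add: besov_plus_def)
  have "inj_on trace_map (disc_functions s p)"
  proof (rule inj_onI)
    fix u v assume uv: "u \<in> disc_functions s p" "v \<in> disc_functions s p"
        and eq: "trace_map u = trace_map v"
    have "boundary_trace v \<in> sobolev_functions s p"
      using trace_besov(1)[OF p s uv(2)] by (simp add: besov_plus_functions_def)
    then obtain g where g: "g \<in> borel_measurable borel" "AE z in circ. boundary_trace v z = g z"
      using sobolev_rep by metis
    have "AE z in circ. boundary_trace u z = boundary_trace v z"
      using eq by (simp only: trace_map_def circle_class_eq_iff)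
    then have g': "AE z in circ. boundary_trace u z = g z"
      using g(2) by eventually_elim simp
    have "poisson_ext (boundary_trace u) z = poisson_ext (boundary_trace v) z" for z
      using poisson_ext_eq[OF g(1) g', of z] poisson_ext_eq[OF g, of z]
      by (cases "cmod z < 1") (auto simp: poisson_ext_def)
    then show "u = v"
      using trace_besov(2)[OF p s uv(1)] trace_besov(2)[OF p s uv(2)] by (simp add: fun_eq_iff)
  qed
  moreover have "trace_map ` disc_functions s p = besov_plus_functions s p // circle_ae"
  proof
    show "trace_map ` disc_functions s p \<subseteq> besov_plus_functions s p // circle_ae"
      using trace_besov(1)[OF p s] by (auto simp: trace_map_def intro: quotientI)
    show "besov_plus_functions s p // circle_ae \<subseteq> trace_map ` disc_functions s p"
      using trace_poisson by (auto elim!: quotientE intro: rev_image_eqI)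
  qed
  ultimately show ?thesis unfolding car by (rule bij_betw_imageI)
qed

section \<open>Transport of the Banach space structure along the trace\<close>

lemma trace_mapE:
  assumes "X \<in> vcarrier besov"
  obtains u where "u \<in> disc_functions s p" "X = trace_map u"
  using assms bij_betw_imp_surj_on[OF bij_trace_map] by blast

lemma trace_map_in: "u \<in> disc_functions s p \<Longrightarrow> trace_map u \<in> vcarrier besov"
  using bij_betw_imp_surj_on[OF bij_trace_map] by blast

lemma boundary_trace_sobolev: "u \<in> disc_functions s p \<Longrightarrow> boundary_trace u \<in> sobolev_functions s p"
  using trace_besov(1)[OF p s] by (simp add: besov_plus_functions_def)

lemma vzero_besov: "vzero besov = trace_map (\<lambda>z. 0)"
proof -
  have "AE \<sigma> in circ. ((\<lambda>r::real. 0::complex) \<longlongrightarrow> 0) (at_left 1)" by simp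
  then have "AE \<sigma> in circ. boundary_trace (\<lambda>z. 0) \<sigma> = 0" by (rule boundary_trace_AE)
  then have "trace_map (\<lambda>z. 0) = circle_class (\<lambda>z. 0)"
    by (simp only: trace_map_def circle_class_eq_iff)
  then show ?thesis by (simp add: besov_plus_def)
qed

text \<open>The sequence is pulled back to analytic functions, where \<open>trace_besov\<close>
  makes it Cauchy for \<open>disc_norm\<close>; \<open>sobolev_norm_trace_le\<close> carries the
  limit found there back to the circle.\<close>

lemma besov_complete:
  assumes X: "\<And>n::nat. X n \<in> vcarrier besov"
    and C: "\<And>e. 0 < e \<Longrightarrow> \<exists>N. \<forall>m\<ge>N. \<forall>n\<ge>N. vnorm besov (vdiff besov (X m) (X n)) < e"
  shows "\<exists>x\<in>vcarrier besov. (\<lambda>n. vnorm besov (vdiff besov (X n) x))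
      \<longlonglongrightarrow> 0"
proof -
  have "\<exists>u. \<forall>n. u n \<in> disc_functions s p \<and> X n = trace_map (u n)"
    using trace_mapE[OF X] by (intro choice allI) blast
  then obtain U where U: "\<And>n. U n \<in> disc_functions s p" "\<And>n. X n = trace_map (U n)" by blast
  obtain \<kappa> where \<kappa>: "poincare_constant s p \<kappa>" using poincare_constant_exists[OF p s]
      by blast
  let ?K = "1 + (\<kappa> + (2 * pi) powr (1 / p))"
  have "\<exists>N. \<forall>m\<ge>N. \<forall>n\<ge>N. disc_norm s p (\<lambda>z. U m z - U n z) < e"
      if "0 < e" for e
  proof -
    have "disc_norm s p (\<lambda>z. U m z - U n z) \<le> vnorm besov (vdiff besov (X m) (X n))" for m n
      unfolding U(2) trace_map_diff[OF U(1) U(1)] vnorm_trace_map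
      by (rule trace_besov(4)[OF p s disc_diff[OF p s U(1) U(1)]])
    then show ?thesis using C[OF that] by (meson order_le_less_trans)
  qed
  then obtain u where u: "u \<in> disc_functions s p" "(\<lambda>n. disc_norm s p (\<lambda>z. U n z - u z)) \<longlonglongrightarrow> 0"
    by (rule disc_complete[OF p s U(1)])
  have "(\<lambda>n. vnorm besov (vdiff besov (X n) (trace_map u))) \<longlonglongrightarrow> 0"
  proof (rule tendsto_sandwich[where f = "\<lambda>_. 0"])
    show "(\<lambda>n. ?K * disc_norm s p (\<lambda>z. U n z - u z)) \<longlonglongrightarrow> 0"
      using tendsto_mult_left[OF u(2), of ?K] by simp
    show "\<forall>\<^sub>F n in sequentially. vnorm besov (vdiff besov (X n) (trace_map u))
        \<le> ?K * disc_norm s p (\<lambda>z. U n z - u z)"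
      unfolding U(2) trace_map_diff[OF U(1) u(1)] vnorm_trace_map
      by (intro always_eventually allI sobolev_norm_trace_le[OF p s disc_diff[OF p s U(1) u(1)] \<kappa>])
    show "\<forall>\<^sub>F n in sequentially. 0 \<le> vnorm besov (vdiff besov (X n) (trace_map u))"
      unfolding U(2) trace_map_diff[OF U(1) u(1)] vnorm_trace_map
      by (intro always_eventually allI sobolev_norm_nonneg)
  qed simp
  then show ?thesis using trace_map_in[OF u(1)] by blast
qed

text \<open>Every element is the trace of an analytic function, and sums and multiples of traces are
  traces. The vector space axioms thus reduce to pointwise identities between functions on the
  disc.\<close>

lemma banach_besov_plus: "complex_banach_space besov"
proof
  fix X :: "nat \<Rightarrow> (complex \<Rightarrow> complex) set"
  assume "\<And>n. X n \<in> vcarrier besov"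
    "\<And>e. 0 < e \<Longrightarrow> \<exists>N. \<forall>m\<ge>N. \<forall>n\<ge>N. vnorm besov (vdiff besov (X m) (X n)) < e"
  then show "\<exists>x\<in>vcarrier besov. (\<lambda>n. vnorm besov (vdiff besov (X n) x))
      \<longlonglongrightarrow> 0"
    by (rule besov_complete)
next
  show "vzero besov \<in> vcarrier besov"
    unfolding vzero_besov by (rule trace_map_in[OF disc_zero(1)[OF p s]])
next
  fix X assume "X \<in> vcarrier besov"
  then obtain u where u: "u \<in> disc_functions s p" and X: "X = trace_map u" by (rule trace_mapE)
  show "vscale besov a X \<in> vcarrier besov" for a
    unfolding X trace_map_scale[OF u] by (rule trace_map_in[OF disc_scale(1)[OF p s u]])
  show "vadd besov X (vzero besov) = X"
    unfolding X vzero_besov trace_map_add[OF u disc_zero(1)[OF p s]] by simp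
  show "vdiff besov X X = vzero besov"
    unfolding X vzero_besov trace_map_diff[OF u u] by simp
  show "vscale besov (a + b) X = vadd besov (vscale besov a X) (vscale besov b X)" for a b
    unfolding X trace_map_scale[OF u] trace_map_add[OF disc_scale(1)[OF p s u] disc_scale(1)[OF p s u]]
    by (simp add: distrib_right)
  show "vscale besov a (vscale besov b X) = vscale besov (a * b) X" for a b
    unfolding X trace_map_scale[OF u] trace_map_scale[OF disc_scale(1)[OF p s u]] by (simp add: mult.assoc)
  show "vscale besov 1 X = X"
    unfolding X trace_map_scale[OF u] by simp
  show "0 \<le> vnorm besov X"
    unfolding X vnorm_trace_map by (rule sobolev_norm_nonneg)
  show "vnorm besov (vscale besov a X) = cmod a * vnorm besov X" for a
    unfolding X using sobolev_norm_scale[OF p boundary_trace_sobolev[OF u]]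
    by (simp add: trace_map_def vscale_circle_class vnorm_besov_plus)
  show "vnorm besov X = 0 \<longleftrightarrow> X = vzero besov"
  proof
    \<comment> \<open>The lower norm bound for the trace reduces definiteness to that of
      \<open>disc_norm\<close>.\<close>
    assume "vnorm besov X = 0"
    then have "disc_norm s p u = 0"
      using trace_besov(4)[OF p s u] disc_norm_nonneg[OF p s u] by (simp add: X vnorm_trace_map)
    then have "u = (\<lambda>z. 0)"
      using complex_banach_space.norm_eq_zero[OF banach_disc_space[OF p s], of u] u
      by (simp add: disc_space_def)
    then show "X = vzero besov" by (simp add: X vzero_besov)
  next
    assume X: "X = vzero besov"
    obtain \<kappa> where \<kappa>: "poincare_constant s p \<kappa>"
        using poincare_constant_exists[OF p s] by blast
    show "vnorm besov X = 0"
      using sobolev_norm_trace_le[OF p s disc_zero(1)[OF p s] \<kappa>] disc_zero(2)[OF p s]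
        sobolev_norm_nonneg[of s p "boundary_trace (\<lambda>z. 0)"]
      by (simp add: X vzero_besov vnorm_trace_map)
  qed
next
  fix X Y assume "X \<in> vcarrier besov" "Y \<in> vcarrier besov"
  then obtain u v where u: "u \<in> disc_functions s p" and X: "X = trace_map u"
    and v: "v \<in> disc_functions s p" and Y: "Y = trace_map v" by (metis trace_mapE)
  note XY = X Y trace_map_add[OF u v] trace_map_add[OF v u] trace_map_scale[OF u] trace_map_scale[OF v]
  show "vadd besov X Y \<in> vcarrier besov"
    unfolding XY by (rule trace_map_in[OF disc_add(1)[OF p s u v]])
  show "vadd besov X Y = vadd besov Y X"
    unfolding XY by (simp add: add.commute)
  show "vscale besov a (vadd besov X Y)
      = vadd besov (vscale besov a X) (vscale besov a Y)" for a
    unfolding XY trace_map_scale[OF disc_add(1)[OF p s u v]]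
      trace_map_add[OF disc_scale(1)[OF p s u] disc_scale(1)[OF p s v]] by (simp add: distrib_left)
  show "vnorm besov (vadd besov X Y) \<le> vnorm besov X + vnorm besov Y"
    unfolding X Y using sobolev_norm_add[OF p boundary_trace_sobolev[OF u] boundary_trace_sobolev[OF v]]
    by (simp add: trace_map_def vadd_circle_class vnorm_besov_plus)
  fix Z assume "Z \<in> vcarrier besov"
  then obtain w where w: "w \<in> disc_functions s p" and Z: "Z = trace_map w" by (rule trace_mapE)
  show "vadd besov (vadd besov X Y) Z = vadd besov X (vadd besov Y Z)"
    unfolding XY Z trace_map_add[OF v w] trace_map_add[OF disc_add(1)[OF p s u v] w]
      trace_map_add[OF u disc_add(1)[OF p s v w]] by (simp add: add.assoc)
qed

lemma inv_trace_map:
  assumes "g \<in> besov_plus_functions s p"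
  shows "inv_into (disc_functions s p) trace_map (circle_class g) = poisson_ext g"
  using bij_trace_map trace_poisson[OF assms] by (intro inv_into_f_eq) (auto simp: bij_betw_def)

lemma banach_isomorphism_trace_map: "banach_isomorphism (disc_space s p) besov trace_map"
proof -
  interpret V: complex_banach_space "disc_space s p" by (rule banach_disc_space[OF p s])
  interpret W: complex_banach_space besov by (rule banach_besov_plus)
  have car: "vcarrier (disc_space s p) = disc_functions s p" by (simp add: disc_space_def)
  show ?thesis
  proof
    show "bij_betw trace_map (vcarrier (disc_space s p)) (vcarrier besov)"
      unfolding car by (rule bij_trace_map)
    show "trace_map (vadd (disc_space s p) x y) = vadd besov (trace_map x) (trace_map y)"
      if "x \<in> vcarrier (disc_space s p)" "y \<in> vcarrier (disc_space s p)" for x y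
      using that trace_map_add by (simp add: disc_space_def)
    show "trace_map (vscale (disc_space s p) a x) = vscale besov a (trace_map x)"
      if "x \<in> vcarrier (disc_space s p)" for a x
      using that trace_map_scale by (simp add: disc_space_def)
    obtain \<kappa> where \<kappa>: "poincare_constant s p \<kappa>"
        using poincare_constant_exists[OF p s] by blast
    have "\<forall>x\<in>vcarrier (disc_space s p). vnorm besov (trace_map x)
        \<le> (1 + (\<kappa> + (2 * pi) powr (1 / p))) * vnorm (disc_space s p) x"
      using sobolev_norm_trace_le[OF p s _ \<kappa>] by (simp add: disc_space_def vnorm_trace_map)
    then show "\<exists>K. \<forall>x\<in>vcarrier (disc_space s p). vnorm besov (trace_map x)
        \<le> K * vnorm (disc_space s p) x"
      by blast
    have "vnorm (disc_space s p) (inv_into (vcarrier (disc_space s p)) trace_map y) \<le> 1 * vnorm besov y"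
      if y: "y \<in> vcarrier besov" for y
    proof -
      obtain u where u: "u \<in> disc_functions s p" and yu: "y = trace_map u"
        using y by (rule trace_mapE)
      have "inv_into (disc_functions s p) trace_map y = u"
        unfolding yu using u bij_trace_map by (intro inv_into_f_f) (auto simp: bij_betw_def)
      then show ?thesis
        using trace_besov(4)[OF p s u] by (simp add: car yu vnorm_trace_map) (simp add: disc_space_def)
    qed
    then show "\<exists>K. \<forall>y\<in>vcarrier besov.
        vnorm (disc_space s p) (inv_into (vcarrier (disc_space s p)) trace_map y) \<le> K * vnorm besov y"
      by blast
  qed
qed

end

text \<open>The first conjunct gives \<open>boundary_trace\<close> its meaning: it makes the value
  of \<open>Lim\<close> the radial limit at almost every point. The inverse is stated on
  representatives g, so it also shows that the Poisson extension is well defined on classes.\<close>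

theorem theorem12:
  fixes p s :: real
  assumes "1 < p" and "0 < s" and "s < 1"
  shows
    "(\<forall>u\<in>disc_functions s p.
        AE \<theta> in angles. \<exists>l. ((\<lambda>r::real. u (of_real r * cis \<theta>)) \<longlongrightarrow> l) (at_left 1)) \<and>
     banach_isomorphism (disc_space s p) (besov_plus s p) trace_map \<and>
     (\<forall>g\<in>besov_plus_functions s p.
        inv_into (disc_functions s p) trace_map (circle_ae `` {g}) = poisson_ext g) \<and>
     (\<forall>\<kappa>. poincare_constant s p \<kappa> \<longrightarrow>
        (let C = \<kappa> + (2 * pi) powr (1 / p) in
          \<forall>u\<in>disc_functions s p.
            disc_norm s p u \<le> sobolev_norm s p (boundary_trace u) \<and>
            sobolev_norm s p (boundary_trace u) \<le> (1 + C) * disc_norm s p u))"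
proof (intro conjI ballI allI impI)
  show "AE \<theta> in angles. \<exists>l. ((\<lambda>r::real. u (of_real r * cis \<theta>)) \<longlongrightarrow> l) (at_left 1)"
    if "u \<in> disc_functions s p" for u
    using AE_radial_limit[OF assms(1,2) that] by (simp only: AE_circ_iff)
  show "banach_isomorphism (disc_space s p) (besov_plus s p) trace_map"
    by (rule banach_isomorphism_trace_map[OF assms(1,2)])
  show "inv_into (disc_functions s p) trace_map (circle_ae `` {g}) = poisson_ext g"
    if "g \<in> besov_plus_functions s p" for g
    by (rule inv_trace_map[OF assms(1,2) that])
  show "let C = \<kappa> + (2 * pi) powr (1 / p) in
      \<forall>u\<in>disc_functions s p.
        disc_norm s p u \<le> sobolev_norm s p (boundary_trace u) \<and>
        sobolev_norm s p (boundary_trace u) \<le> (1 + C) * disc_norm s p u"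
    if "poincare_constant s p \<kappa>" for \<kappa>
    unfolding Let_def
    using trace_besov(4)[OF assms(1,2)] sobolev_norm_trace_le[OF assms(1,2) _ that] by blast
qed

end
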